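(* Let $\mathcal{C}=\bigoplus_{g\in G}\mathcal{C}_g$ be an extension of a Fibonacci category $\mathcal{F}$. Then $\mathcal{C}=\mathcal{F}\bullet\mathcal{C}_{pt}$ is an exact factorization of $\mathcal{F}$ and $\mathcal{C}_{pt}$.
   Context: Fusion categories are over an algebraically closed field of characteristic $0$. A Fibonacci category is a rank $2$ fusion category with simple objects $\mathbf{1},X$ and $X\otimes X\cong\mathbf{1}\oplus X$. An extension of $\mathcal{F}$ is a fusion category $\mathcal{C}$ with a faithful grading $\mathcal{C}=\bigoplus_{g\in G}\mathcal{C}_g$ by a finite group $G$ (all $\mathcal{C}_g\neq0$, $\mathcal{C}_g\otimes\mathcal{C}_h\subseteq\mathcal{C}_{gh}$, $(\mathcal{C}_g)^*=\mathcal{C}_{g^{-1}}$) whose trivial component $\mathcal{C}_e$ is equivalent to $\mathcal{F}$; $\mathcal{F}$ is identified with $\mathcal{C}_e$. $\mathcal{C}_{pt}$ is the fusion subcategory generated by the invertible simple objects of $\mathcal{C}$. For fusion subcategories $\mathcal{A},\mathcal{B}$ of $\mathcal{C}$, $\mathcal{A}\mathcal{B}$ is the full abelian subcategory spanned by direct summands of $X\otimes Y$, $X\in\mathcal{A}$, $Y\in\mathcal{B}$. $\mathcal{C}=\mathcal{A}\bullet\mathcal{B}$ (exact factorization) means $\mathcal{C}=\mathcal{A}\mathcal{B}$ and $\mathcal{A}\cap\mathcal{B}=\mathrm{Vec}$. *)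

theory Defs
  imports "HOL-Algebra.Module" "HOL-Computational_Algebra.Polynomial"
begin

section \<open>Linear categories\<close>

text \<open>
  The data of a monoidal category enriched in vector spaces. Objects form a set inside a type;
  arrows carry their domain and codomain, and \<open>g \<cdot> f\<close> (first \<open>f\<close>, then \<open>g\<close>) is meaningful only if
  \<open>cod f = dom g\<close>. Likewise \<open>f \<oplus>\<^sub>a g\<close> is meaningful only for parallel arrows.
\<close>

record ('o, 'm, 'k) moncat =
  obj :: "'o set"
  arr :: "'m set"
  dom_of :: "'m \<Rightarrow> 'o"
  cod_of :: "'m \<Rightarrow> 'o"
  ident :: "'o \<Rightarrow> 'm"
  comp_arr :: "'m \<Rightarrow> 'm \<Rightarrow> 'm" (infixl "\<cdot>\<index>" 65)
  zero_arr :: "'o \<Rightarrow> 'o \<Rightarrow> 'm"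
  add_arr :: "'m \<Rightarrow> 'm \<Rightarrow> 'm" (infixl "\<oplus>\<^sub>a\<index>" 60)
  scale_arr :: "'k \<Rightarrow> 'm \<Rightarrow> 'm" (infixr "\<odot>\<^sub>a\<index>" 75)
  tensor_obj :: "'o \<Rightarrow> 'o \<Rightarrow> 'o" (infixl "\<otimes>\<^sub>o\<index>" 70)
  tensor_arr :: "'m \<Rightarrow> 'm \<Rightarrow> 'm" (infixl "\<otimes>\<^sub>a\<index>" 70)
  unit_obj :: "'o"
  associator :: "'o \<Rightarrow> 'o \<Rightarrow> 'o \<Rightarrow> 'm"
  left_unitor :: "'o \<Rightarrow> 'm"
  right_unitor :: "'o \<Rightarrow> 'm"

definition mor :: "('o, 'm, 'k, 'z) moncat_scheme \<Rightarrow> 'o \<Rightarrow> 'o \<Rightarrow> 'm set" where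
  "mor C A B = {f \<in> arr C. dom_of C f = A \<and> cod_of C f = B}"

definition scalars :: "('k::field) ring" where
  "scalars = \<lparr>carrier = UNIV, monoid.mult = (*), one = 1, ring.zero = 0, add = (+)\<rparr>"

text \<open>
  The hom-space from \<open>A\<close> to \<open>B\<close>. The record type forces multiplicative fields; they are relevant only
  for \<open>A = B\<close> and are not constrained by the module axioms.
\<close>

definition hom_space ::
    "('o, 'm, 'k, 'z) moncat_scheme \<Rightarrow> 'o \<Rightarrow> 'o \<Rightarrow> ('k, 'm) Module.module" where
  "hom_space C A B =
    \<lparr>carrier = mor C A B, monoid.mult = comp_arr C, one = ident C A,
     ring.zero = zero_arr C A B, add = add_arr C, module.smult = scale_arr C\<rparr>"

locale linear_category =
  fixes C :: "('o, 'm, 'k::field) moncat" (structure)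
  assumes dom_cod: "f \<in> arr C \<Longrightarrow> dom_of C f \<in> obj C \<and> cod_of C f \<in> obj C"
    and ident_mor: "A \<in> obj C \<Longrightarrow> ident C A \<in> mor C A A"
    and comp_mor: "f \<in> mor C X Y \<Longrightarrow> g \<in> mor C Y Z \<Longrightarrow> g \<cdot> f \<in> mor C X Z"
    and comp_ident: "f \<in> mor C X Y \<Longrightarrow> f \<cdot> ident C X = f \<and> ident C Y \<cdot> f = f"
    and comp_assoc:
      "f \<in> mor C W X \<Longrightarrow> g \<in> mor C X Y \<Longrightarrow> h \<in> mor C Y Z \<Longrightarrow> (h \<cdot> g) \<cdot> f = h \<cdot> (g \<cdot> f)"
    and hom_module:
      "X \<in> obj C \<Longrightarrow> Y \<in> obj C \<Longrightarrow> Module.module scalars (hom_space C X Y)"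
    and comp_add_right:
      "f \<in> mor C X Y \<Longrightarrow> f' \<in> mor C X Y \<Longrightarrow> g \<in> mor C Y Z \<Longrightarrow>
        g \<cdot> (f \<oplus>\<^sub>a f') = (g \<cdot> f) \<oplus>\<^sub>a (g \<cdot> f')"
    and comp_add_left:
      "f \<in> mor C X Y \<Longrightarrow> g \<in> mor C Y Z \<Longrightarrow> g' \<in> mor C Y Z \<Longrightarrow>
        (g \<oplus>\<^sub>a g') \<cdot> f = (g \<cdot> f) \<oplus>\<^sub>a (g' \<cdot> f)"
    and comp_scale_right:
      "f \<in> mor C X Y \<Longrightarrow> g \<in> mor C Y Z \<Longrightarrow> g \<cdot> (c \<odot>\<^sub>a f) = c \<odot>\<^sub>a (g \<cdot> f)"
    and comp_scale_left:
      "f \<in> mor C X Y \<Longrightarrow> g \<in> mor C Y Z \<Longrightarrow> (c \<odot>\<^sub>a g) \<cdot> f = c \<odot>\<^sub>a (g \<cdot> f)"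

definition inverse_arrs :: "('o, 'm, 'k, 'z) moncat_scheme \<Rightarrow> 'm \<Rightarrow> 'm \<Rightarrow> bool" where
  "inverse_arrs C f g \<longleftrightarrow>
    f \<in> arr C \<and> g \<in> mor C (cod_of C f) (dom_of C f) \<and>
    comp_arr C g f = ident C (dom_of C f) \<and> comp_arr C f g = ident C (cod_of C f)"

definition iso_arr :: "('o, 'm, 'k, 'z) moncat_scheme \<Rightarrow> 'm \<Rightarrow> bool" where
  "iso_arr C f \<longleftrightarrow> (\<exists>g. inverse_arrs C f g)"

definition iso_obj :: "('o, 'm, 'k, 'z) moncat_scheme \<Rightarrow> 'o \<Rightarrow> 'o \<Rightarrow> bool" where
  "iso_obj C X Y \<longleftrightarrow> X \<in> obj C \<and> Y \<in> obj C \<and> (\<exists>f \<in> mor C X Y. iso_arr C f)"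

text \<open>
  \<open>direct_sum C Xs S\<close>: the object \<open>S\<close> is a biproduct of the list \<open>Xs\<close>, with inclusions \<open>\<iota>\<close> and
  projections \<open>\<pi>\<close>. For the empty list this says \<open>ident C S = 0\<close>, i.e. \<open>S\<close> is a zero object.
\<close>

definition direct_sum :: "('o, 'm, 'k, 'z) moncat_scheme \<Rightarrow> 'o list \<Rightarrow> 'o \<Rightarrow> bool" where
  "direct_sum C Xs S \<longleftrightarrow>
    set Xs \<subseteq> obj C \<and> S \<in> obj C \<and>
    (\<exists>\<iota> \<pi>.
      (\<forall>i < length Xs. \<iota> i \<in> mor C (Xs ! i) S \<and> \<pi> i \<in> mor C S (Xs ! i)) \<and>
      (\<forall>i < length Xs. \<forall>j < length Xs.
        comp_arr C (\<pi> i) (\<iota> j) =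
          (if i = j then ident C (Xs ! i) else zero_arr C (Xs ! j) (Xs ! i))) \<and>
      finsum (hom_space C S S) (\<lambda>i. comp_arr C (\<iota> i) (\<pi> i)) {..<length Xs} = ident C S)"

definition zero_obj :: "('o, 'm, 'k, 'z) moncat_scheme \<Rightarrow> 'o \<Rightarrow> bool" where
  "zero_obj C Z \<longleftrightarrow> direct_sum C [] Z"

definition direct_summand :: "('o, 'm, 'k, 'z) moncat_scheme \<Rightarrow> 'o \<Rightarrow> 'o \<Rightarrow> bool" where
  "direct_summand C X S \<longleftrightarrow> (\<exists>Y. direct_sum C [X, Y] S)"

definition mono_arr :: "('o, 'm, 'k, 'z) moncat_scheme \<Rightarrow> 'm \<Rightarrow> bool" where
  "mono_arr C f \<longleftrightarrow> f \<in> arr C \<and>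
    (\<forall>T g h. g \<in> mor C T (dom_of C f) \<longrightarrow> h \<in> mor C T (dom_of C f) \<longrightarrow>
      comp_arr C f g = comp_arr C f h \<longrightarrow> g = h)"

definition epi_arr :: "('o, 'm, 'k, 'z) moncat_scheme \<Rightarrow> 'm \<Rightarrow> bool" where
  "epi_arr C f \<longleftrightarrow> f \<in> arr C \<and>
    (\<forall>T g h. g \<in> mor C (cod_of C f) T \<longrightarrow> h \<in> mor C (cod_of C f) T \<longrightarrow>
      comp_arr C g f = comp_arr C h f \<longrightarrow> g = h)"

definition is_kernel :: "('o, 'm, 'k, 'z) moncat_scheme \<Rightarrow> 'm \<Rightarrow> 'm \<Rightarrow> bool" where
  "is_kernel C k f \<longleftrightarrow> f \<in> arr C \<and> k \<in> arr C \<and> cod_of C k = dom_of C f \<and>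
    comp_arr C f k = zero_arr C (dom_of C k) (cod_of C f) \<and>
    (\<forall>T h. h \<in> mor C T (dom_of C f) \<longrightarrow> comp_arr C f h = zero_arr C T (cod_of C f) \<longrightarrow>
      (\<exists>!u. u \<in> mor C T (dom_of C k) \<and> comp_arr C k u = h))"

definition is_cokernel :: "('o, 'm, 'k, 'z) moncat_scheme \<Rightarrow> 'm \<Rightarrow> 'm \<Rightarrow> bool" where
  "is_cokernel C q f \<longleftrightarrow> f \<in> arr C \<and> q \<in> arr C \<and> dom_of C q = cod_of C f \<and>
    comp_arr C q f = zero_arr C (dom_of C f) (cod_of C q) \<and>
    (\<forall>T h. h \<in> mor C (cod_of C f) T \<longrightarrow> comp_arr C h f = zero_arr C (dom_of C f) T \<longrightarrow>
      (\<exists>!u. u \<in> mor C (cod_of C q) T \<and> comp_arr C u q = h))"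

locale abelian_linear_category = linear_category +
  assumes direct_sums_exist: "set Xs \<subseteq> obj C \<Longrightarrow> \<exists>S. direct_sum C Xs S"
    and kernels_exist: "f \<in> arr C \<Longrightarrow> \<exists>k. is_kernel C k f"
    and cokernels_exist: "f \<in> arr C \<Longrightarrow> \<exists>q. is_cokernel C q f"
    and mono_is_kernel: "mono_arr C f \<Longrightarrow> \<exists>g. is_kernel C f g"
    and epi_is_cokernel: "epi_arr C f \<Longrightarrow> \<exists>g. is_cokernel C f g"

definition simple_obj :: "('o, 'm, 'k, 'z) moncat_scheme \<Rightarrow> 'o \<Rightarrow> bool" where
  "simple_obj C X \<longleftrightarrow> X \<in> obj C \<and> \<not> zero_obj C X \<and>
    (\<forall>f. mono_arr C f \<longrightarrow> cod_of C f = X \<longrightarrow> zero_obj C (dom_of C f) \<or> iso_arr C f)"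


section \<open>Fusion categories\<close>

locale linear_monoidal_category = linear_category +
  assumes unit_in_obj: "unit_obj C \<in> obj C"
    and tensor_in_obj: "X \<in> obj C \<Longrightarrow> Y \<in> obj C \<Longrightarrow> X \<otimes>\<^sub>o Y \<in> obj C"
    and tensor_mor:
      "f \<in> mor C X Y \<Longrightarrow> g \<in> mor C X' Y' \<Longrightarrow> f \<otimes>\<^sub>a g \<in> mor C (X \<otimes>\<^sub>o X') (Y \<otimes>\<^sub>o Y')"
    and tensor_ident:
      "X \<in> obj C \<Longrightarrow> Y \<in> obj C \<Longrightarrow> ident C X \<otimes>\<^sub>a ident C Y = ident C (X \<otimes>\<^sub>o Y)"
    and tensor_comp:
      "f \<in> mor C X Y \<Longrightarrow> g \<in> mor C Y Z \<Longrightarrow> f' \<in> mor C X' Y' \<Longrightarrow> g' \<in> mor C Y' Z' \<Longrightarrow>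
        (g \<cdot> f) \<otimes>\<^sub>a (g' \<cdot> f') = (g \<otimes>\<^sub>a g') \<cdot> (f \<otimes>\<^sub>a f')"
    and tensor_add_left:
      "f \<in> mor C X Y \<Longrightarrow> f' \<in> mor C X Y \<Longrightarrow> g \<in> mor C X' Y' \<Longrightarrow>
        (f \<oplus>\<^sub>a f') \<otimes>\<^sub>a g = (f \<otimes>\<^sub>a g) \<oplus>\<^sub>a (f' \<otimes>\<^sub>a g)"
    and tensor_add_right:
      "f \<in> mor C X Y \<Longrightarrow> g \<in> mor C X' Y' \<Longrightarrow> g' \<in> mor C X' Y' \<Longrightarrow>
        f \<otimes>\<^sub>a (g \<oplus>\<^sub>a g') = (f \<otimes>\<^sub>a g) \<oplus>\<^sub>a (f \<otimes>\<^sub>a g')"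
    and tensor_scale_left:
      "f \<in> mor C X Y \<Longrightarrow> g \<in> mor C X' Y' \<Longrightarrow> (c \<odot>\<^sub>a f) \<otimes>\<^sub>a g = c \<odot>\<^sub>a (f \<otimes>\<^sub>a g)"
    and tensor_scale_right:
      "f \<in> mor C X Y \<Longrightarrow> g \<in> mor C X' Y' \<Longrightarrow> f \<otimes>\<^sub>a (c \<odot>\<^sub>a g) = c \<odot>\<^sub>a (f \<otimes>\<^sub>a g)"
    and associator_mor:
      "X \<in> obj C \<Longrightarrow> Y \<in> obj C \<Longrightarrow> Z \<in> obj C \<Longrightarrow>
        associator C X Y Z \<in> mor C ((X \<otimes>\<^sub>o Y) \<otimes>\<^sub>o Z) (X \<otimes>\<^sub>o (Y \<otimes>\<^sub>o Z))"
    and associator_iso: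
      "X \<in> obj C \<Longrightarrow> Y \<in> obj C \<Longrightarrow> Z \<in> obj C \<Longrightarrow> iso_arr C (associator C X Y Z)"
    and associator_natural:
      "f \<in> mor C X X' \<Longrightarrow> g \<in> mor C Y Y' \<Longrightarrow> h \<in> mor C Z Z' \<Longrightarrow>
        associator C X' Y' Z' \<cdot> ((f \<otimes>\<^sub>a g) \<otimes>\<^sub>a h) = (f \<otimes>\<^sub>a (g \<otimes>\<^sub>a h)) \<cdot> associator C X Y Z"
    and left_unitor_mor: "X \<in> obj C \<Longrightarrow> left_unitor C X \<in> mor C (unit_obj C \<otimes>\<^sub>o X) X"
    and left_unitor_iso: "X \<in> obj C \<Longrightarrow> iso_arr C (left_unitor C X)"
    and left_unitor_natural:
      "f \<in> mor C X Y \<Longrightarrow> left_unitor C Y \<cdot> (ident C (unit_obj C) \<otimes>\<^sub>a f) = f \<cdot> left_unitor C X"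
    and right_unitor_mor: "X \<in> obj C \<Longrightarrow> right_unitor C X \<in> mor C (X \<otimes>\<^sub>o unit_obj C) X"
    and right_unitor_iso: "X \<in> obj C \<Longrightarrow> iso_arr C (right_unitor C X)"
    and right_unitor_natural:
      "f \<in> mor C X Y \<Longrightarrow> right_unitor C Y \<cdot> (f \<otimes>\<^sub>a ident C (unit_obj C)) = f \<cdot> right_unitor C X"
    and pentagon:
      "W \<in> obj C \<Longrightarrow> X \<in> obj C \<Longrightarrow> Y \<in> obj C \<Longrightarrow> Z \<in> obj C \<Longrightarrow>
        (ident C W \<otimes>\<^sub>a associator C X Y Z) \<cdot> associator C W (X \<otimes>\<^sub>o Y) Z \<cdot>
          (associator C W X Y \<otimes>\<^sub>a ident C Z) =
        associator C W X (Y \<otimes>\<^sub>o Z) \<cdot> associator C (W \<otimes>\<^sub>o X) Y Z"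
    and triangle:
      "X \<in> obj C \<Longrightarrow> Y \<in> obj C \<Longrightarrow>
        (ident C X \<otimes>\<^sub>a left_unitor C Y) \<cdot> associator C X (unit_obj C) Y =
        right_unitor C X \<otimes>\<^sub>a ident C Y"

text \<open>
  \<open>left_dual C X D\<close>: the object \<open>D\<close> is a left dual \<open>X\<^sup>*\<close> of \<open>X\<close>, with \<open>ev : D \<otimes> X \<rightarrow> 1\<close> and
  \<open>coev : 1 \<rightarrow> X \<otimes> D\<close>. In the two zigzag identities the unitor has been moved to the right-hand side;
  \<open>b\<close> is the inverse of the associator. Equivalently, \<open>X\<close> is a right dual of \<open>D\<close>.
\<close>

definition left_dual :: "('o, 'm, 'k, 'z) moncat_scheme \<Rightarrow> 'o \<Rightarrow> 'o \<Rightarrow> bool" where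
  "left_dual C X D \<longleftrightarrow> X \<in> obj C \<and> D \<in> obj C \<and>
    (\<exists>ev coev b.
      ev \<in> mor C (D \<otimes>\<^sub>o\<^bsub>C\<^esub> X) (unit_obj C) \<and>
      coev \<in> mor C (unit_obj C) (X \<otimes>\<^sub>o\<^bsub>C\<^esub> D) \<and>
      inverse_arrs C (associator C D X D) b \<and>
      right_unitor C X \<cdot>\<^bsub>C\<^esub> (ident C X \<otimes>\<^sub>a\<^bsub>C\<^esub> ev) \<cdot>\<^bsub>C\<^esub> associator C X D X
        \<cdot>\<^bsub>C\<^esub> (coev \<otimes>\<^sub>a\<^bsub>C\<^esub> ident C X) = left_unitor C X \<and>
      left_unitor C D \<cdot>\<^bsub>C\<^esub> (ev \<otimes>\<^sub>a\<^bsub>C\<^esub> ident C D) \<cdot>\<^bsub>C\<^esub> b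
        \<cdot>\<^bsub>C\<^esub> (ident C D \<otimes>\<^sub>a\<^bsub>C\<^esub> coev) = right_unitor C D)"

locale fusion_category = abelian_linear_category C + linear_monoidal_category C
  for C :: "('o, 'm, 'k::{alg_closed_field, field_char_0}) moncat" (structure) +
  assumes left_duals_exist: "X \<in> obj C \<Longrightarrow> \<exists>D. left_dual C X D"
    and right_duals_exist: "X \<in> obj C \<Longrightarrow> \<exists>D. left_dual C D X"
    and semisimple:
      "X \<in> obj C \<Longrightarrow> \<exists>Ss. (\<forall>S \<in> set Ss. simple_obj C S) \<and> direct_sum C Ss X"
    and finitely_many_simples:
      "\<exists>Ss. finite Ss \<and> (\<forall>S. simple_obj C S \<longrightarrow> (\<exists>T \<in> Ss. iso_obj C S T))"
    and hom_finite_dim: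
      "X \<in> obj C \<Longrightarrow> Y \<in> obj C \<Longrightarrow>
        \<exists>B. finite B \<and> B \<subseteq> mor C X Y \<and>
          (\<forall>f \<in> mor C X Y. \<exists>c. f = finsum (hom_space C X Y) (\<lambda>b. c b \<odot>\<^sub>a b) B)"
    and unit_endomorphisms:
      "f \<in> mor C (unit_obj C) (unit_obj C) \<Longrightarrow> \<exists>!c. f = c \<odot>\<^sub>a ident C (unit_obj C)"

definition fibonacci_category ::
    "('o, 'm, 'k::{alg_closed_field, field_char_0}) moncat \<Rightarrow> bool" where
  "fibonacci_category F \<longleftrightarrow> fusion_category F \<and>
    (\<exists>X. simple_obj F X \<and> \<not> iso_obj F X (unit_obj F) \<and>
      (\<forall>S. simple_obj F S \<longrightarrow> iso_obj F S (unit_obj F) \<or> iso_obj F S X) \<and>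
      direct_sum F [unit_obj F, X] (X \<otimes>\<^sub>o\<^bsub>F\<^esub> X))"


section \<open>Equivalences of fusion categories\<close>

text \<open>
  A linear strong monoidal functor, given by its action on objects and arrows, the tensor
  constraint \<open>J X Y : \<Phi> X \<otimes> \<Phi> Y \<rightarrow> \<Phi> (X \<otimes> Y)\<close> and the unit constraint \<open>u : 1 \<rightarrow> \<Phi> 1\<close>.
\<close>

locale linear_monoidal_functor =
  B: linear_monoidal_category B + C: linear_monoidal_category C
  for B :: "('p, 'n, 'k::field) moncat" and C :: "('o, 'm, 'k) moncat" +
  fixes \<Phi>\<^sub>o :: "'p \<Rightarrow> 'o" and \<Phi>\<^sub>a :: "'n \<Rightarrow> 'm" and J :: "'p \<Rightarrow> 'p \<Rightarrow> 'm" and u :: 'm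
  assumes map_obj: "X \<in> obj B \<Longrightarrow> \<Phi>\<^sub>o X \<in> obj C"
    and map_mor: "f \<in> mor B X Y \<Longrightarrow> \<Phi>\<^sub>a f \<in> mor C (\<Phi>\<^sub>o X) (\<Phi>\<^sub>o Y)"
    and map_ident: "X \<in> obj B \<Longrightarrow> \<Phi>\<^sub>a (ident B X) = ident C (\<Phi>\<^sub>o X)"
    and map_comp:
      "f \<in> mor B X Y \<Longrightarrow> g \<in> mor B Y Z \<Longrightarrow> \<Phi>\<^sub>a (g \<cdot>\<^bsub>B\<^esub> f) = \<Phi>\<^sub>a g \<cdot>\<^bsub>C\<^esub> \<Phi>\<^sub>a f"
    and map_add:
      "f \<in> mor B X Y \<Longrightarrow> g \<in> mor B X Y \<Longrightarrow> \<Phi>\<^sub>a (f \<oplus>\<^sub>a\<^bsub>B\<^esub> g) = \<Phi>\<^sub>a f \<oplus>\<^sub>a\<^bsub>C\<^esub> \<Phi>\<^sub>a g"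
    and map_scale: "f \<in> mor B X Y \<Longrightarrow> \<Phi>\<^sub>a (c \<odot>\<^sub>a\<^bsub>B\<^esub> f) = c \<odot>\<^sub>a\<^bsub>C\<^esub> \<Phi>\<^sub>a f"
    and J_mor:
      "X \<in> obj B \<Longrightarrow> Y \<in> obj B \<Longrightarrow>
        J X Y \<in> mor C (\<Phi>\<^sub>o X \<otimes>\<^sub>o\<^bsub>C\<^esub> \<Phi>\<^sub>o Y) (\<Phi>\<^sub>o (X \<otimes>\<^sub>o\<^bsub>B\<^esub> Y))"
    and J_iso: "X \<in> obj B \<Longrightarrow> Y \<in> obj B \<Longrightarrow> iso_arr C (J X Y)"
    and J_natural:
      "f \<in> mor B X X' \<Longrightarrow> g \<in> mor B Y Y' \<Longrightarrow>
        \<Phi>\<^sub>a (f \<otimes>\<^sub>a\<^bsub>B\<^esub> g) \<cdot>\<^bsub>C\<^esub> J X Y = J X' Y' \<cdot>\<^bsub>C\<^esub> (\<Phi>\<^sub>a f \<otimes>\<^sub>a\<^bsub>C\<^esub> \<Phi>\<^sub>a g)"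
    and J_associator:
      "X \<in> obj B \<Longrightarrow> Y \<in> obj B \<Longrightarrow> Z \<in> obj B \<Longrightarrow>
        \<Phi>\<^sub>a (associator B X Y Z) \<cdot>\<^bsub>C\<^esub> J (X \<otimes>\<^sub>o\<^bsub>B\<^esub> Y) Z \<cdot>\<^bsub>C\<^esub> (J X Y \<otimes>\<^sub>a\<^bsub>C\<^esub> ident C (\<Phi>\<^sub>o Z)) =
        J X (Y \<otimes>\<^sub>o\<^bsub>B\<^esub> Z) \<cdot>\<^bsub>C\<^esub> (ident C (\<Phi>\<^sub>o X) \<otimes>\<^sub>a\<^bsub>C\<^esub> J Y Z)
          \<cdot>\<^bsub>C\<^esub> associator C (\<Phi>\<^sub>o X) (\<Phi>\<^sub>o Y) (\<Phi>\<^sub>o Z)"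
    and u_mor: "u \<in> mor C (unit_obj C) (\<Phi>\<^sub>o (unit_obj B))"
    and u_iso: "iso_arr C u"
    and u_left_unitor:
      "X \<in> obj B \<Longrightarrow>
        \<Phi>\<^sub>a (left_unitor B X) \<cdot>\<^bsub>C\<^esub> J (unit_obj B) X \<cdot>\<^bsub>C\<^esub> (u \<otimes>\<^sub>a\<^bsub>C\<^esub> ident C (\<Phi>\<^sub>o X)) =
        left_unitor C (\<Phi>\<^sub>o X)"
    and u_right_unitor:
      "X \<in> obj B \<Longrightarrow>
        \<Phi>\<^sub>a (right_unitor B X) \<cdot>\<^bsub>C\<^esub> J X (unit_obj B) \<cdot>\<^bsub>C\<^esub> (ident C (\<Phi>\<^sub>o X) \<otimes>\<^sub>a\<^bsub>C\<^esub> u) =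
        right_unitor C (\<Phi>\<^sub>o X)"

definition tensor_equivalent ::
    "('p, 'n, 'k::field) moncat \<Rightarrow> ('o, 'm, 'k) moncat \<Rightarrow> bool" where
  "tensor_equivalent B C \<longleftrightarrow>
    (\<exists>\<Phi>\<^sub>o \<Phi>\<^sub>a J u. linear_monoidal_functor B C \<Phi>\<^sub>o \<Phi>\<^sub>a J u \<and>
      (\<forall>X \<in> obj B. \<forall>Y \<in> obj B. bij_betw \<Phi>\<^sub>a (mor B X Y) (mor C (\<Phi>\<^sub>o X) (\<Phi>\<^sub>o Y))) \<and>
      (\<forall>Y \<in> obj C. \<exists>X \<in> obj B. iso_obj C (\<Phi>\<^sub>o X) Y))"


section \<open>Subcategories\<close>

text \<open>
  All subcategories below are full and closed under isomorphism, so they are represented by their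
  sets of objects, and intersections and equalities of subcategories are those of object sets.
\<close>

definition full_subcat :: "('o, 'm, 'k) moncat \<Rightarrow> 'o set \<Rightarrow> ('o, 'm, 'k) moncat" where
  "full_subcat C A =
    C\<lparr>obj := obj C \<inter> A, arr := {f \<in> arr C. dom_of C f \<in> A \<and> cod_of C f \<in> A}\<rparr>"

text \<open>
  In a semisimple category every subobject and quotient is a direct summand, so these closure
  conditions describe the (replete) full abelian subcategories.
\<close>

definition full_abelian_subcat :: "('o, 'm, 'k) moncat \<Rightarrow> 'o set \<Rightarrow> bool" where
  "full_abelian_subcat C A \<longleftrightarrow> A \<subseteq> obj C \<and>
    (\<forall>X Y. X \<in> A \<longrightarrow> iso_obj C X Y \<longrightarrow> Y \<in> A) \<and>
    (\<forall>Xs S. set Xs \<subseteq> A \<longrightarrow> direct_sum C Xs S \<longrightarrow> S \<in> A) \<and>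
    (\<forall>X S. S \<in> A \<longrightarrow> direct_summand C X S \<longrightarrow> X \<in> A)"

definition fusion_subcat :: "('o, 'm, 'k) moncat \<Rightarrow> 'o set \<Rightarrow> bool" where
  "fusion_subcat C A \<longleftrightarrow> full_abelian_subcat C A \<and> unit_obj C \<in> A \<and>
    (\<forall>X \<in> A. \<forall>Y \<in> A. X \<otimes>\<^sub>o\<^bsub>C\<^esub> Y \<in> A) \<and>
    (\<forall>X D. X \<in> A \<longrightarrow> left_dual C X D \<or> left_dual C D X \<longrightarrow> D \<in> A)"

definition generated_fusion_subcat :: "('o, 'm, 'k) moncat \<Rightarrow> 'o set \<Rightarrow> 'o set" where
  "generated_fusion_subcat C T = \<Inter>{A. fusion_subcat C A \<and> T \<subseteq> A}"

definition invertible_obj :: "('o, 'm, 'k) moncat \<Rightarrow> 'o \<Rightarrow> bool" where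
  "invertible_obj C X \<longleftrightarrow> X \<in> obj C \<and>
    (\<exists>Y \<in> obj C. iso_obj C (X \<otimes>\<^sub>o\<^bsub>C\<^esub> Y) (unit_obj C) \<and> iso_obj C (Y \<otimes>\<^sub>o\<^bsub>C\<^esub> X) (unit_obj C))"

definition pointed_part :: "('o, 'm, 'k) moncat \<Rightarrow> 'o set" where
  "pointed_part C = generated_fusion_subcat C {X. simple_obj C X \<and> invertible_obj C X}"

definition vec_subcat :: "('o, 'm, 'k) moncat \<Rightarrow> 'o set" where
  "vec_subcat C = {S. \<exists>n. direct_sum C (replicate n (unit_obj C)) S}"

definition product_subcat :: "('o, 'm, 'k) moncat \<Rightarrow> 'o set \<Rightarrow> 'o set \<Rightarrow> 'o set" where
  "product_subcat C A B =
    {S. \<exists>Zs. direct_sum C Zs S \<and>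
      (\<forall>Z \<in> set Zs. \<exists>X \<in> A. \<exists>Y \<in> B. direct_summand C Z (X \<otimes>\<^sub>o\<^bsub>C\<^esub> Y))}"

definition exact_factorization :: "('o, 'm, 'k) moncat \<Rightarrow> 'o set \<Rightarrow> 'o set \<Rightarrow> bool" where
  "exact_factorization C A B \<longleftrightarrow> fusion_subcat C A \<and> fusion_subcat C B \<and>
    product_subcat C A B = obj C \<and> A \<inter> B = vec_subcat C"


section \<open>Graded extensions\<close>

text \<open>
  \<open>D g\<close> is the component \<open>C\<^sub>g\<close>. The decomposition \<open>C = \<Oplus>\<^sub>g C\<^sub>g\<close> into full abelian subcategories
  means that different components are orthogonal and every object is a direct sum of objects of
  the components; \<open>gs\<close> enumerates the group.
\<close>

definition faithful_grading ::
    "('o, 'm, 'k) moncat \<Rightarrow> ('g, 'x) monoid_scheme \<Rightarrow> ('g \<Rightarrow> 'o set) \<Rightarrow> bool" where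
  "faithful_grading C G D \<longleftrightarrow>
    (\<forall>g \<in> carrier G. full_abelian_subcat C (D g)) \<and>
    (\<forall>g \<in> carrier G. \<forall>h \<in> carrier G. g \<noteq> h \<longrightarrow>
      (\<forall>X \<in> D g. \<forall>Y \<in> D h. mor C X Y = {zero_arr C X Y})) \<and>
    (\<forall>S \<in> obj C. \<exists>gs X. distinct gs \<and> set gs = carrier G \<and>
      (\<forall>g \<in> carrier G. X g \<in> D g) \<and> direct_sum C (map X gs) S) \<and>
    (\<forall>g \<in> carrier G. \<exists>X \<in> D g. \<not> zero_obj C X) \<and>
    (\<forall>g \<in> carrier G. \<forall>h \<in> carrier G. \<forall>X \<in> D g. \<forall>Y \<in> D h.
      X \<otimes>\<^sub>o\<^bsub>C\<^esub> Y \<in> D (g \<otimes>\<^bsub>G\<^esub> h)) \<and>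
    (\<forall>g \<in> carrier G. {X'. \<exists>X \<in> D g. left_dual C X X'} = D (inv\<^bsub>G\<^esub> g))"

definition graded_extension ::
    "('p, 'n, 'k::{alg_closed_field, field_char_0}) moncat \<Rightarrow> ('o, 'm, 'k) moncat \<Rightarrow>
      ('g, 'x) monoid_scheme \<Rightarrow> ('g \<Rightarrow> 'o set) \<Rightarrow> bool" where
  "graded_extension F C G D \<longleftrightarrow>
    fusion_category C \<and> Group.group G \<and> finite (carrier G) \<and> faithful_grading C G D \<and>
    tensor_equivalent F (full_subcat C (D \<one>\<^bsub>G\<^esub>))"

end

(* Let X be the nontrivial simple object of the Fibonacci component. Every component C_g contains an
   invertible object: take M simple in C_g. Since X(XM) = M + XM, counting simple summands shows that
   XN is simple for N = M or for some simple summand N of XM, and then XN and N are not isomorphic.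
   By duality Hom(X, N N* ) = Hom(XN, N) = 0, so N N* in C_e is a multiple of 1, and Schur's lemma gives
   N N* = 1. Consequently every object Z of C_g is (Z N* ) N with Z N* in C_e. Conversely the
   subcategory generated by the invertible objects consists of sums of invertible objects, and X is not
   invertible, because X X = 1 + X is not simple. *)

theory Submission
  imports Defs
begin

section \<open>Linear categories\<close>

text \<open>The axioms give scalar endomorphisms only for the unit. For other simple objects they
  come from finite-dimensional Hom spaces over an algebraically closed field: an endomorphism
  satisfies a nonzero polynomial, whose linear factors are cancelled one at a time. The count relies
  neither on dimensions nor on uniqueness of decompositions; it is a Steinitz exchange. If all
  products with X in the component were non-simple and XM had n summands, then X(XM) would have n +
  1 jointly monic simple quotients, yet 2n independent simple subobjects, with n at least 2. XN and
  N differ because otherwise X(XN) would be simple, although it splits into N and XN. Of the duality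
  adjunction only injectivity enters: an arrow vanishes if its adjunct does. The triviality of N'N
  does not follow formally from that of NN'; it comes from the simplicity of N(N'N), which is
  isomorphic to N. Throughout, summands are handled as retracts and pairs of disjoint retracts,
  which survive composition and tensoring without any bookkeeping of complements.\<close>

context linear_category
begin

lemma mor_iff: "f \<in> mor C X Y \<longleftrightarrow> f \<in> arr C \<and> dom_of C f = X \<and> cod_of C f = Y"
  by (simp add: mor_def)

lemma mor_self: "f \<in> arr C \<Longrightarrow> f \<in> mor C (dom_of C f) (cod_of C f)"
  by (simp add: mor_iff)

lemma dom_cod_obj [simp]:
  "f \<in> arr C \<Longrightarrow> dom_of C f \<in> obj C" "f \<in> arr C \<Longrightarrow> cod_of C f \<in> obj C"
  using dom_cod by auto

lemma mor_obj: "f \<in> mor C X Y \<Longrightarrow> X \<in> obj C \<and> Y \<in> obj C"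
  using dom_cod by (auto simp: mor_iff)

lemma ident_arr [simp]:
  assumes "X \<in> obj C"
  shows "ident C X \<in> arr C" "dom_of C (ident C X) = X" "cod_of C (ident C X) = X"
  using ident_mor[OF assms] by (auto simp: mor_iff)

lemma comp_arr_simps [simp]:
  assumes "f \<in> arr C" "g \<in> arr C" "cod_of C f = dom_of C g"
  shows "g \<cdot> f \<in> arr C" "dom_of C (g \<cdot> f) = dom_of C f" "cod_of C (g \<cdot> f) = cod_of C g"
  using comp_mor[of f "dom_of C f" "cod_of C f" g "cod_of C g"] assms by (auto simp: mor_iff)

lemma comp_ident_simps [simp]:
  assumes "f \<in> arr C"
  shows "dom_of C f = X \<Longrightarrow> f \<cdot> ident C X = f" "cod_of C f = X \<Longrightarrow> ident C X \<cdot> f = f"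
  using comp_ident[OF mor_self[OF assms]] by auto

lemma comp_assoc_arr:
  assumes "f \<in> arr C" "g \<in> arr C" "h \<in> arr C" "cod_of C f = dom_of C g" "cod_of C g = dom_of C h"
  shows "(h \<cdot> g) \<cdot> f = h \<cdot> (g \<cdot> f)"
  using comp_assoc[of f _ _ g _ h] assms by (auto simp: mor_iff)

text \<open>Unpacks the module axioms once in terms of the category operations; later proofs return
  to \<open>hom_space\<close> as an abelian group only to evaluate \<open>finsum\<close>.\<close>

lemma hom_module_rules:
  assumes "X \<in> obj C" "Y \<in> obj C"
  shows zero_arr_mor: "zero_arr C X Y \<in> mor C X Y"
    and add_arr_mor: "\<And>f g. f \<in> mor C X Y \<Longrightarrow> g \<in> mor C X Y \<Longrightarrow> f \<oplus>\<^sub>a g \<in> mor C X Y"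
    and scale_arr_mor: "\<And>f c. f \<in> mor C X Y \<Longrightarrow> c \<odot>\<^sub>a f \<in> mor C X Y"
    and add_arr_zero: "\<And>f. f \<in> mor C X Y \<Longrightarrow> f \<oplus>\<^sub>a zero_arr C X Y = f"
    and add_zero_arr: "\<And>f. f \<in> mor C X Y \<Longrightarrow> zero_arr C X Y \<oplus>\<^sub>a f = f"
    and add_arr_comm: "\<And>f g. f \<in> mor C X Y \<Longrightarrow> g \<in> mor C X Y \<Longrightarrow> f \<oplus>\<^sub>a g = g \<oplus>\<^sub>a f"
    and add_arr_assoc: "\<And>f g h. f \<in> mor C X Y \<Longrightarrow> g \<in> mor C X Y \<Longrightarrow> h \<in> mor C X Y \<Longrightarrow>
      (f \<oplus>\<^sub>a g) \<oplus>\<^sub>a h = f \<oplus>\<^sub>a (g \<oplus>\<^sub>a h)"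
    and zero_scale_mor: "\<And>f. f \<in> mor C X Y \<Longrightarrow> 0 \<odot>\<^sub>a f = zero_arr C X Y"
    and one_scale_mor: "\<And>f. f \<in> mor C X Y \<Longrightarrow> 1 \<odot>\<^sub>a f = f"
    and scale_zero_arr: "\<And>c. c \<odot>\<^sub>a zero_arr C X Y = zero_arr C X Y"
    and scale_scale_mor: "\<And>f a b. f \<in> mor C X Y \<Longrightarrow> a \<odot>\<^sub>a (b \<odot>\<^sub>a f) = (a * b) \<odot>\<^sub>a f"
    and scale_add_mor: "\<And>f a b. f \<in> mor C X Y \<Longrightarrow> (a + b) \<odot>\<^sub>a f = a \<odot>\<^sub>a f \<oplus>\<^sub>a b \<odot>\<^sub>a f"
    and scale_distrib_mor: "\<And>f g a. f \<in> mor C X Y \<Longrightarrow> g \<in> mor C X Y \<Longrightarrow>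
      a \<odot>\<^sub>a (f \<oplus>\<^sub>a g) = a \<odot>\<^sub>a f \<oplus>\<^sub>a a \<odot>\<^sub>a g"
    and hom_abelian_group: "abelian_group (hom_space C X Y)"
proof -
  interpret M: Module.module scalars "hom_space C X Y" by (rule hom_module[OF assms])
  have c: "carrier (hom_space C X Y) = mor C X Y" "add (hom_space C X Y) = add_arr C"
    "ring.zero (hom_space C X Y) = zero_arr C X Y" "module.smult (hom_space C X Y) = scale_arr C"
    by (simp_all add: hom_space_def)
  have s: "carrier scalars = (UNIV :: 'k set)" "add scalars = ((+) :: 'k \<Rightarrow> _)"
    "monoid.mult scalars = ((*) :: 'k \<Rightarrow> _)" "one scalars = (1 :: 'k)" "ring.zero scalars = (0 :: 'k)"
    by (simp_all add: scalars_def)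
  show "zero_arr C X Y \<in> mor C X Y" using M.zero_closed by (simp add: c)
  show "f \<oplus>\<^sub>a g \<in> mor C X Y" if "f \<in> mor C X Y" "g \<in> mor C X Y" for f g
    using M.a_closed[of f g] that by (simp add: c)
  show "c \<odot>\<^sub>a f \<in> mor C X Y" if "f \<in> mor C X Y" for f c
    using M.smult_closed[of c f] that by (simp add: c s)
  show "f \<oplus>\<^sub>a zero_arr C X Y = f" if "f \<in> mor C X Y" for f
    using M.r_zero[of f] that by (simp add: c)
  show "zero_arr C X Y \<oplus>\<^sub>a f = f" if "f \<in> mor C X Y" for f
    using M.l_zero[of f] that by (simp add: c)
  show "f \<oplus>\<^sub>a g = g \<oplus>\<^sub>a f" if "f \<in> mor C X Y" "g \<in> mor C X Y" for f g
    using M.a_comm[of f g] that by (simp add: c)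
  show "(f \<oplus>\<^sub>a g) \<oplus>\<^sub>a h = f \<oplus>\<^sub>a (g \<oplus>\<^sub>a h)"
    if "f \<in> mor C X Y" "g \<in> mor C X Y" "h \<in> mor C X Y" for f g h
    using M.a_assoc[of f g h] that by (simp add: c)
  show "0 \<odot>\<^sub>a f = zero_arr C X Y" if "f \<in> mor C X Y" for f
    using M.smult_l_null[of f] that by (simp add: c s)
  show "1 \<odot>\<^sub>a f = f" if "f \<in> mor C X Y" for f
    using M.smult_one[of f] that by (simp add: c s)
  show "c \<odot>\<^sub>a zero_arr C X Y = zero_arr C X Y" for c
    using M.smult_r_null[of c] by (simp add: c s)
  show "a \<odot>\<^sub>a (b \<odot>\<^sub>a f) = (a * b) \<odot>\<^sub>a f" if "f \<in> mor C X Y" for f a b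
    using M.smult_assoc1[of a b f] that by (simp add: c s)
  show "(a + b) \<odot>\<^sub>a f = a \<odot>\<^sub>a f \<oplus>\<^sub>a b \<odot>\<^sub>a f" if "f \<in> mor C X Y" for f a b
    using M.smult_l_distr[of a b f] that by (simp add: c s)
  show "a \<odot>\<^sub>a (f \<oplus>\<^sub>a g) = a \<odot>\<^sub>a f \<oplus>\<^sub>a a \<odot>\<^sub>a g" if "f \<in> mor C X Y" "g \<in> mor C X Y" for f g a
    using M.smult_r_distr[of a f g] that by (simp add: c s)
  show "abelian_group (hom_space C X Y)" ..
qed

lemma zero_arr_simps [simp]:
  assumes "X \<in> obj C" "Y \<in> obj C"
  shows "zero_arr C X Y \<in> arr C" "dom_of C (zero_arr C X Y) = X" "cod_of C (zero_arr C X Y) = Y"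
  using zero_arr_mor[OF assms] by (auto simp: mor_iff)

lemma add_arr_simps [simp]:
  assumes "f \<in> arr C" "g \<in> arr C" "dom_of C g = dom_of C f" "cod_of C g = cod_of C f"
  shows "f \<oplus>\<^sub>a g \<in> arr C" "dom_of C (f \<oplus>\<^sub>a g) = dom_of C f" "cod_of C (f \<oplus>\<^sub>a g) = cod_of C f"
  using add_arr_mor[of "dom_of C f" "cod_of C f" f g] assms by (auto simp: mor_iff)

lemma scale_arr_simps [simp]:
  assumes "f \<in> arr C"
  shows "c \<odot>\<^sub>a f \<in> arr C" "dom_of C (c \<odot>\<^sub>a f) = dom_of C f" "cod_of C (c \<odot>\<^sub>a f) = cod_of C f"
  using scale_arr_mor[of "dom_of C f" "cod_of C f" f c] assms by (auto simp: mor_iff)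

lemma scale_simps [simp]:
  assumes "f \<in> arr C"
  shows "0 \<odot>\<^sub>a f = zero_arr C (dom_of C f) (cod_of C f)" "1 \<odot>\<^sub>a f = f"
    "a \<odot>\<^sub>a (b \<odot>\<^sub>a f) = (a * b) \<odot>\<^sub>a f"
  using zero_scale_mor[of "dom_of C f" "cod_of C f" f] one_scale_mor[of "dom_of C f" "cod_of C f" f]
    scale_scale_mor[of "dom_of C f" "cod_of C f" f] assms by (auto simp: mor_iff)

lemma comp_scale_simps [simp]:
  assumes "f \<in> arr C" "g \<in> arr C" "cod_of C f = dom_of C g"
  shows "g \<cdot> (c \<odot>\<^sub>a f) = c \<odot>\<^sub>a (g \<cdot> f)" "(c \<odot>\<^sub>a g) \<cdot> f = c \<odot>\<^sub>a (g \<cdot> f)"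
  using comp_scale_right comp_scale_left assms by (metis mor_iff)+

text \<open>Absorption is scalar linearity in disguise: a zero arrow is 0 times itself, and the
  scalar 0 can be pulled out of a composite.\<close>

lemma comp_zero_simps [simp]:
  assumes "f \<in> arr C" "X \<in> obj C"
  shows "Y = dom_of C f \<Longrightarrow> f \<cdot> zero_arr C X Y = zero_arr C X (cod_of C f)"
    "Y = cod_of C f \<Longrightarrow> zero_arr C Y X \<cdot> f = zero_arr C (dom_of C f) X"
proof -
  assume Y: "Y = dom_of C f"
  have "f \<cdot> zero_arr C X Y = f \<cdot> (0 \<odot>\<^sub>a zero_arr C X Y)" using assms Y by simp
  also have "\<dots> = 0 \<odot>\<^sub>a (f \<cdot> zero_arr C X Y)" using assms Y by (subst comp_scale_simps) simp_all
  finally show "f \<cdot> zero_arr C X Y = zero_arr C X (cod_of C f)" using assms Y by simp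
next
  assume Y: "Y = cod_of C f"
  have "zero_arr C Y X \<cdot> f = (0 \<odot>\<^sub>a zero_arr C Y X) \<cdot> f" using assms Y by simp
  also have "\<dots> = 0 \<odot>\<^sub>a (zero_arr C Y X \<cdot> f)" using assms Y by (subst comp_scale_simps) simp_all
  finally show "zero_arr C Y X \<cdot> f = zero_arr C (dom_of C f) X" using assms Y by simp
qed

text \<open>The category record carries scalars but no negation; subtraction through the scalar -1
  inherits its compatibility with composition and tensor from the linearity axioms.\<close>

definition minus_arr :: "'m \<Rightarrow> 'm \<Rightarrow> 'm" (infixl "\<ominus>\<^sub>a" 60) where
  "f \<ominus>\<^sub>a g = f \<oplus>\<^sub>a (- 1) \<odot>\<^sub>a g"

lemma minus_arr_simps [simp]:
  assumes "f \<in> arr C" "g \<in> arr C" "dom_of C g = dom_of C f" "cod_of C g = cod_of C f"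
  shows "f \<ominus>\<^sub>a g \<in> arr C" "dom_of C (f \<ominus>\<^sub>a g) = dom_of C f" "cod_of C (f \<ominus>\<^sub>a g) = cod_of C f"
  using assms by (simp_all add: minus_arr_def)

lemma minus_self [simp]:
  assumes "f \<in> arr C" shows "f \<ominus>\<^sub>a f = zero_arr C (dom_of C f) (cod_of C f)"
  using scale_add_mor[of "dom_of C f" "cod_of C f" f 1 "-1"] assms
  by (simp add: minus_arr_def mor_iff)

lemma minus_zero [simp]:
  assumes "f \<in> arr C" "dom_of C f = X" "cod_of C f = Y" shows "f \<ominus>\<^sub>a zero_arr C X Y = f"
  using assms scale_zero_arr[of X Y "-1"] add_arr_zero[of X Y f]
  by (auto simp: minus_arr_def mor_iff)

lemma minus_eq_zero_iff:
  assumes "f \<in> arr C" "g \<in> arr C" "dom_of C g = dom_of C f" "cod_of C g = cod_of C f"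
  shows "f \<ominus>\<^sub>a g = zero_arr C (dom_of C f) (cod_of C f) \<longleftrightarrow> f = g"
proof
  let ?z = "zero_arr C (dom_of C f) (cod_of C f)"
  assume *: "f \<ominus>\<^sub>a g = ?z"
  have m: "f \<in> mor C (dom_of C f) (cod_of C f)" "g \<in> mor C (dom_of C f) (cod_of C f)"
    "(-1) \<odot>\<^sub>a g \<in> mor C (dom_of C f) (cod_of C f)"
    using assms by (auto simp: mor_iff)
  have o: "dom_of C f \<in> obj C" "cod_of C f \<in> obj C" using assms by auto
  have "f = f \<oplus>\<^sub>a ((-1) \<odot>\<^sub>a g \<oplus>\<^sub>a g)"
    using scale_add_mor[OF o m(2), of "-1" 1] add_arr_zero[OF o m(1)] assms by simp
  also have "\<dots> = (f \<ominus>\<^sub>a g) \<oplus>\<^sub>a g"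
    using add_arr_assoc[OF o m(1,3,2)] by (simp add: minus_arr_def)
  also have "\<dots> = g" using * add_zero_arr[OF o m(2)] by simp
  finally show "f = g" .
qed (use assms in simp)

lemma comp_add_simps:
  assumes "f \<in> arr C" "f' \<in> arr C" "dom_of C f' = dom_of C f" "cod_of C f' = cod_of C f"
    and "g \<in> arr C"
  shows "cod_of C f = dom_of C g \<Longrightarrow> g \<cdot> (f \<oplus>\<^sub>a f') = (g \<cdot> f) \<oplus>\<^sub>a (g \<cdot> f')"
    "cod_of C g = dom_of C f \<Longrightarrow> (f \<oplus>\<^sub>a f') \<cdot> g = (f \<cdot> g) \<oplus>\<^sub>a (f' \<cdot> g)"
  using comp_add_right[of f _ _ f' g] comp_add_left[of g _ _ f _ f'] assms
  by (auto simp: mor_iff)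

lemma comp_minus_simps:
  assumes "f \<in> arr C" "f' \<in> arr C" "dom_of C f' = dom_of C f" "cod_of C f' = cod_of C f"
    and "g \<in> arr C"
  shows "cod_of C f = dom_of C g \<Longrightarrow> g \<cdot> (f \<ominus>\<^sub>a f') = (g \<cdot> f) \<ominus>\<^sub>a (g \<cdot> f')"
    "cod_of C g = dom_of C f \<Longrightarrow> (f \<ominus>\<^sub>a f') \<cdot> g = (f \<cdot> g) \<ominus>\<^sub>a (f' \<cdot> g)"
  using assms by (simp_all add: minus_arr_def comp_add_simps)

section \<open>Zero objects, biproducts, retracts and isomorphisms\<close>

lemma zero_eq_identD:
  assumes "f \<in> arr C" "ident C (dom_of C f) = zero_arr C (dom_of C f) (dom_of C f)
    \<or> ident C (cod_of C f) = zero_arr C (cod_of C f) (cod_of C f)"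
  shows "f = zero_arr C (dom_of C f) (cod_of C f)"
  using assms by (metis comp_ident_simps comp_zero_simps dom_cod_obj)

lemma zero_obj_iff: "zero_obj C Z \<longleftrightarrow> Z \<in> obj C \<and> ident C Z = zero_arr C Z Z"
proof -
  have "finsum (hom_space C Z Z) f {} = zero_arr C Z Z" if "Z \<in> obj C" for f :: "nat \<Rightarrow> 'm"
  proof -
    interpret abelian_group "hom_space C Z Z" by (rule hom_abelian_group[OF that that])
    show ?thesis by (subst finsum_empty) (simp add: hom_space_def)
  qed
  then show ?thesis by (auto simp: zero_obj_def direct_sum_def)
qed

text \<open>Lets linear equations pass through a finite sum without distributing
  \<open>finsum\<close> over composition or tensor: \<open>P\<close> will be an equation such as the
  vanishing of a composite, which is closed under addition.\<close>

lemma finsum_vanishes: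
  assumes "X \<in> obj C" "Y \<in> obj C" "finite I" "\<And>i. i \<in> I \<Longrightarrow> f i \<in> mor C X Y"
    and "P (zero_arr C X Y)"
    and "\<And>g h. g \<in> mor C X Y \<Longrightarrow> h \<in> mor C X Y \<Longrightarrow> P g \<Longrightarrow> P h \<Longrightarrow> P (g \<oplus>\<^sub>a h)"
    and "\<And>i. i \<in> I \<Longrightarrow> P (f i)"
  shows "P (finsum (hom_space C X Y) f I) \<and> finsum (hom_space C X Y) f I \<in> mor C X Y"
proof -
  interpret abelian_group "hom_space C X Y" by (rule hom_abelian_group[OF assms(1,2)])
  have c: "carrier (hom_space C X Y) = mor C X Y" "add (hom_space C X Y) = add_arr C"
    "ring.zero (hom_space C X Y) = zero_arr C X Y"
    by (simp_all add: hom_space_def)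
  show ?thesis using assms(3,4,7)
  proof (induction I rule: finite_induct)
    case empty
    then show ?case using assms(5) zero_closed by (simp add: c)
  next
    case (insert i I)
    have "f \<in> I \<rightarrow> carrier (hom_space C X Y)" "f i \<in> carrier (hom_space C X Y)"
      using insert.prems by (auto simp: c)
    then have "finsum (hom_space C X Y) f (insert i I) = f i \<oplus>\<^sub>a finsum (hom_space C X Y) f I"
      using insert.hyps by (simp add: c)
    moreover have "P (finsum (hom_space C X Y) f I) \<and> finsum (hom_space C X Y) f I \<in> mor C X Y"
      using insert.prems by (intro insert.IH) auto
    ultimately show ?case using insert.prems assms(6) add_arr_mor[OF assms(1,2)] by simp
  qed
qed

text \<open>The last conclusion recasts the completeness relation as an induction rule: a linear
  property of \<open>ident C S\<close> is checked on each \<open>\<iota> i \<cdot> \<pi> i\<close>.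
  Joint monicity and epicity of the summands are obtained this way.\<close>

lemma direct_sumE:
  assumes "direct_sum C Xs S"
  obtains \<iota> \<pi> where
    "\<And>i. i < length Xs \<Longrightarrow> Xs ! i \<in> obj C"
    "\<And>i. i < length Xs \<Longrightarrow> \<iota> i \<in> mor C (Xs ! i) S"
    "\<And>i. i < length Xs \<Longrightarrow> \<pi> i \<in> mor C S (Xs ! i)"
    "\<And>i. i < length Xs \<Longrightarrow> \<pi> i \<cdot> \<iota> i = ident C (Xs ! i)"
    "\<And>i j. i < length Xs \<Longrightarrow> j < length Xs \<Longrightarrow> i \<noteq> j \<Longrightarrow>
      \<pi> i \<cdot> \<iota> j = zero_arr C (Xs ! j) (Xs ! i)"
    "S \<in> obj C" "finsum (hom_space C S S) (\<lambda>i. \<iota> i \<cdot> \<pi> i) {..<length Xs} = ident C S"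
    "\<And>P. \<lbrakk>P (zero_arr C S S);
      \<And>g h. g \<in> mor C S S \<Longrightarrow> h \<in> mor C S S \<Longrightarrow> P g \<Longrightarrow> P h \<Longrightarrow> P (g \<oplus>\<^sub>a h);
      \<And>i. i < length Xs \<Longrightarrow> P (\<iota> i \<cdot> \<pi> i)\<rbrakk> \<Longrightarrow> P (ident C S)"
proof -
  from assms obtain \<iota> \<pi> where S: "set Xs \<subseteq> obj C" "S \<in> obj C"
    and m: "\<And>i. i < length Xs \<Longrightarrow> \<iota> i \<in> mor C (Xs ! i) S \<and> \<pi> i \<in> mor C S (Xs ! i)"
    and o: "\<And>i j. i < length Xs \<Longrightarrow> j < length Xs \<Longrightarrow>
        \<pi> i \<cdot> \<iota> j = (if i = j then ident C (Xs ! i) else zero_arr C (Xs ! j) (Xs ! i))"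
    and s: "finsum (hom_space C S S) (\<lambda>i. \<iota> i \<cdot> \<pi> i) {..<length Xs} = ident C S"
    unfolding direct_sum_def by blast
  show thesis
  proof (rule that[of \<iota> \<pi>])
    fix P :: "'m \<Rightarrow> bool"
    assume a: "P (zero_arr C S S)"
      "\<And>g h. g \<in> mor C S S \<Longrightarrow> h \<in> mor C S S \<Longrightarrow> P g \<Longrightarrow> P h \<Longrightarrow> P (g \<oplus>\<^sub>a h)"
      "\<And>i. i < length Xs \<Longrightarrow> P (\<iota> i \<cdot> \<pi> i)"
    have "\<And>i. i \<in> {..<length Xs} \<Longrightarrow> \<iota> i \<cdot> \<pi> i \<in> mor C S S"
      using m comp_mor by blast
    then show "P (ident C S)"
      using finsum_vanishes[of S S "{..<length Xs}" "\<lambda>i. \<iota> i \<cdot> \<pi> i" P] a S s by auto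
  qed (use S m o s in \<open>auto simp: subset_iff\<close>)
qed

text \<open>Two disjoint summands of \<open>S\<close> with no requirement that they exhaust it. This
  form passes to larger objects and to tensor products, and it suffices to refute
  simplicity.\<close>

definition orthogonal_split :: "'o \<Rightarrow> 'o \<Rightarrow> 'o \<Rightarrow> bool" where
  "orthogonal_split Y Z S \<longleftrightarrow> (\<exists>\<iota> \<pi> \<iota>' \<pi>'. \<iota> \<in> mor C Y S \<and> \<pi> \<in> mor C S Y \<and>
    \<iota>' \<in> mor C Z S \<and> \<pi>' \<in> mor C S Z \<and> \<pi> \<cdot> \<iota> = ident C Y \<and> \<pi>' \<cdot> \<iota>' = ident C Z \<and>
    \<pi> \<cdot> \<iota>' = zero_arr C Z Y \<and> \<pi>' \<cdot> \<iota> = zero_arr C Y Z)"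

text \<open>A direct summand without its complement, so that transitivity and tensoring are
  immediate; in an abelian category the complement is recovered in
  \<open>retract_direct_summand\<close>.\<close>

definition retract :: "'o \<Rightarrow> 'o \<Rightarrow> bool" where
  "retract X S \<longleftrightarrow> (\<exists>\<iota> \<pi>. \<iota> \<in> mor C X S \<and> \<pi> \<in> mor C S X \<and> \<pi> \<cdot> \<iota> = ident C X)"

lemma retract_obj: "retract X S \<Longrightarrow> X \<in> obj C \<and> S \<in> obj C"
  unfolding retract_def using mor_obj by blast

lemma retract_trans:
  assumes "retract X Y" "retract Y Z" shows "retract X Z"
proof -
  obtain i p i' p' where m: "i \<in> mor C X Y" "p \<in> mor C Y X" "p \<cdot> i = ident C X"
    "i' \<in> mor C Y Z" "p' \<in> mor C Z Y" "p' \<cdot> i' = ident C Y"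
    using assms unfolding retract_def by blast
  have "(p \<cdot> p') \<cdot> (i' \<cdot> i) = p \<cdot> ((p' \<cdot> i') \<cdot> i)"
    using m(1,2,4,5) by (simp add: comp_assoc_arr mor_iff)
  then show ?thesis unfolding retract_def using m comp_mor comp_ident by metis
qed

lemma iso_arrE:
  assumes "iso_arr C f" "f \<in> mor C X Y"
  obtains g where "g \<in> mor C Y X" "g \<cdot> f = ident C X" "f \<cdot> g = ident C Y"
  using assms unfolding iso_arr_def inverse_arrs_def by (auto simp: mor_iff)

lemma iso_arrI:
  assumes "f \<in> mor C X Y" "g \<in> mor C Y X" "g \<cdot> f = ident C X" "f \<cdot> g = ident C Y"
  shows "iso_arr C f"
  using assms unfolding iso_arr_def inverse_arrs_def by (auto simp: mor_iff)

lemma iso_objE: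
  assumes "iso_obj C X Y"
  obtains f g where "f \<in> mor C X Y" "g \<in> mor C Y X" "g \<cdot> f = ident C X" "f \<cdot> g = ident C Y"
  using assms unfolding iso_obj_def by (metis iso_arrE)

lemma iso_objI:
  assumes "f \<in> mor C X Y" "g \<in> mor C Y X" "g \<cdot> f = ident C X" "f \<cdot> g = ident C Y"
  shows "iso_obj C X Y"
  unfolding iso_obj_def using iso_arrI[OF assms] assms mor_obj by blast

lemma iso_objI_arr: "f \<in> mor C X Y \<Longrightarrow> iso_arr C f \<Longrightarrow> iso_obj C X Y"
  by (metis iso_arrE iso_objI)

lemma iso_obj_refl [simp]: "X \<in> obj C \<Longrightarrow> iso_obj C X X"
  by (rule iso_objI[of "ident C X" _ _ "ident C X"]) (auto simp: mor_iff)

lemma iso_obj_sym: "iso_obj C X Y \<Longrightarrow> iso_obj C Y X"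
  by (metis iso_objE iso_objI)

lemma iso_obj_retract: "iso_obj C X Y \<Longrightarrow> retract X Y"
  unfolding retract_def by (metis iso_objE)

lemma iso_obj_trans:
  assumes "iso_obj C X Y" "iso_obj C Y Z" shows "iso_obj C X Z"
proof -
  obtain i p i' p' where m: "i \<in> mor C X Y" "p \<in> mor C Y X" "p \<cdot> i = ident C X" "i \<cdot> p = ident C Y"
    "i' \<in> mor C Y Z" "p' \<in> mor C Z Y" "p' \<cdot> i' = ident C Y" "i' \<cdot> p' = ident C Z"
    using assms by (metis iso_objE)
  have "(p \<cdot> p') \<cdot> (i' \<cdot> i) = p \<cdot> ((p' \<cdot> i') \<cdot> i)" "(i' \<cdot> i) \<cdot> (p \<cdot> p') = i' \<cdot> ((i \<cdot> p) \<cdot> p')"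
    using m(1,2,5,6) by (simp_all add: comp_assoc_arr mor_iff)
  then show ?thesis using m comp_mor comp_ident iso_objI[of "i' \<cdot> i" X Z "p \<cdot> p'"] by metis
qed

lemma zero_obj_retract:
  assumes "retract X S" "zero_obj C S" shows "zero_obj C X"
proof -
  obtain i p where m: "i \<in> mor C X S" "p \<in> mor C S X" "p \<cdot> i = ident C X"
    using assms(1) unfolding retract_def by blast
  have "p = zero_arr C S X"
    using zero_eq_identD[of p] m(2) assms(2) by (auto simp: mor_iff zero_obj_iff)
  then show ?thesis using m by (auto simp: zero_obj_iff mor_iff)
qed

text \<open>Replaces the indexed sum by equations between four arrows, which isomorphisms and linear
  functors visibly preserve.\<close>

lemma direct_sum_pair_iff:
  "direct_sum C [X, Y] S \<longleftrightarrow> (\<exists>i p j q. i \<in> mor C X S \<and> p \<in> mor C S X \<and> j \<in> mor C Y S \<and> q \<in> mor C S Y \<and>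
    p \<cdot> i = ident C X \<and> q \<cdot> j = ident C Y \<and> p \<cdot> j = zero_arr C Y X \<and> q \<cdot> i = zero_arr C X Y \<and>
    i \<cdot> p \<oplus>\<^sub>a j \<cdot> q = ident C S)"
proof -
  have fs: "finsum (hom_space C S S) (\<lambda>n. I n \<cdot> P n) {..<Suc (Suc 0)} = I 0 \<cdot> P 0 \<oplus>\<^sub>a I (Suc 0) \<cdot> P (Suc 0)"
    if m: "I 0 \<in> mor C X S" "P 0 \<in> mor C S X" "I (Suc 0) \<in> mor C Y S" "P (Suc 0) \<in> mor C S Y"
    for I P :: "nat \<Rightarrow> 'm"
  proof -
    note o = mor_obj[OF m(1)]
    interpret M: abelian_group "hom_space C S S" by (rule hom_abelian_group) (use o in auto)
    have c: "carrier (hom_space C S S) = mor C S S" "add (hom_space C S S) = add_arr C"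
      "ring.zero (hom_space C S S) = zero_arr C S S" by (simp_all add: hom_space_def)
    have "I (Suc 0) \<cdot> P (Suc 0) \<oplus>\<^sub>a zero_arr C S S = I (Suc 0) \<cdot> P (Suc 0)"
      by (rule add_arr_zero) (use m o in \<open>auto simp: mor_iff\<close>)
    moreover have "{..<Suc (Suc 0)} = {0, Suc 0}" by auto
    ultimately show ?thesis using m by (simp add: c mor_iff Pi_def)
  qed
  show ?thesis
  proof
    assume "direct_sum C [X, Y] S"
    then obtain I P where m: "\<forall>i<Suc (Suc 0). I i \<in> mor C ([X, Y] ! i) S \<and> P i \<in> mor C S ([X, Y] ! i)"
      and r: "\<forall>i<Suc (Suc 0). \<forall>j<Suc (Suc 0). P i \<cdot> I j =
        (if i = j then ident C ([X, Y] ! i) else zero_arr C ([X, Y] ! j) ([X, Y] ! i))"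
      and s: "finsum (hom_space C S S) (\<lambda>i. I i \<cdot> P i) {..<Suc (Suc 0)} = ident C S"
      unfolding direct_sum_def by auto
    have m': "I 0 \<in> mor C X S" "P 0 \<in> mor C S X" "I (Suc 0) \<in> mor C Y S" "P (Suc 0) \<in> mor C S Y"
      using m[rule_format, of 0] m[rule_format, of "Suc 0"] by auto
    moreover have "P 0 \<cdot> I 0 = ident C X" "P (Suc 0) \<cdot> I (Suc 0) = ident C Y"
      "P 0 \<cdot> I (Suc 0) = zero_arr C Y X" "P (Suc 0) \<cdot> I 0 = zero_arr C X Y"
      using r by auto
    moreover have "I 0 \<cdot> P 0 \<oplus>\<^sub>a I (Suc 0) \<cdot> P (Suc 0) = ident C S" using fs[of I P, OF m'] s by simp
    ultimately show "\<exists>i p j q. i \<in> mor C X S \<and> p \<in> mor C S X \<and> j \<in> mor C Y S \<and> q \<in> mor C S Y \<and>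
      p \<cdot> i = ident C X \<and> q \<cdot> j = ident C Y \<and> p \<cdot> j = zero_arr C Y X \<and> q \<cdot> i = zero_arr C X Y \<and>
      i \<cdot> p \<oplus>\<^sub>a j \<cdot> q = ident C S" by blast
  next
    assume "\<exists>i p j q. i \<in> mor C X S \<and> p \<in> mor C S X \<and> j \<in> mor C Y S \<and> q \<in> mor C S Y \<and>
      p \<cdot> i = ident C X \<and> q \<cdot> j = ident C Y \<and> p \<cdot> j = zero_arr C Y X \<and> q \<cdot> i = zero_arr C X Y \<and>
      i \<cdot> p \<oplus>\<^sub>a j \<cdot> q = ident C S"
    then obtain i p j q where m: "i \<in> mor C X S" "p \<in> mor C S X" "j \<in> mor C Y S" "q \<in> mor C S Y"
      and r: "p \<cdot> i = ident C X" "q \<cdot> j = ident C Y" "p \<cdot> j = zero_arr C Y X" "q \<cdot> i = zero_arr C X Y"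
      and s: "i \<cdot> p \<oplus>\<^sub>a j \<cdot> q = ident C S" by blast
    define I where "I = (\<lambda>n::nat. if n = 0 then i else j)"
    define P where "P = (\<lambda>n::nat. if n = 0 then p else q)"
    have "\<forall>i<length [X, Y]. I i \<in> mor C ([X, Y] ! i) S \<and> P i \<in> mor C S ([X, Y] ! i)"
      using m by (auto simp: I_def P_def less_Suc_eq)
    moreover have "\<forall>i<length [X, Y]. \<forall>j<length [X, Y]. P i \<cdot> I j =
        (if i = j then ident C ([X, Y] ! i) else zero_arr C ([X, Y] ! j) ([X, Y] ! i))"
      using r by (auto simp: I_def P_def less_Suc_eq)
    moreover have "finsum (hom_space C S S) (\<lambda>n. I n \<cdot> P n) {..<length [X, Y]} = ident C S"
      using fs[of I P] m s by (simp add: I_def P_def)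
    ultimately show "direct_sum C [X, Y] S"
      unfolding direct_sum_def using mor_obj[OF m(1)] mor_obj[OF m(3)]
      by (intro conjI exI[of _ I] exI[of _ P]) simp_all
  qed
qed

lemma direct_sum_pair_target_iso:
  assumes "direct_sum C [X, Y] S" "iso_obj C S T"
  shows "direct_sum C [X, Y] T"
proof -
  obtain i p j q where m: "i \<in> mor C X S" "p \<in> mor C S X" "j \<in> mor C Y S" "q \<in> mor C S Y"
    and r: "p \<cdot> i = ident C X" "q \<cdot> j = ident C Y" "p \<cdot> j = zero_arr C Y X" "q \<cdot> i = zero_arr C X Y"
    and s: "i \<cdot> p \<oplus>\<^sub>a j \<cdot> q = ident C S" using assms(1) unfolding direct_sum_pair_iff by blast
  obtain f g where fg: "f \<in> mor C S T" "g \<in> mor C T S" "g \<cdot> f = ident C S" "f \<cdot> g = ident C T"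
    using assms(2) by (rule iso_objE)
  have c: "(b \<cdot> g) \<cdot> (f \<cdot> a) = b \<cdot> a" if "a \<in> mor C A S" "b \<in> mor C S B" for a b A B
  proof -
    have "(b \<cdot> g) \<cdot> (f \<cdot> a) = b \<cdot> ((g \<cdot> f) \<cdot> a)"
      using that fg(1,2) by (simp add: mor_iff comp_assoc_arr)
    then show ?thesis using that fg(3) by (simp add: mor_iff)
  qed
  have "(f \<cdot> i) \<cdot> (p \<cdot> g) \<oplus>\<^sub>a (f \<cdot> j) \<cdot> (q \<cdot> g) = f \<cdot> ((i \<cdot> p \<oplus>\<^sub>a j \<cdot> q) \<cdot> g)"
    using m fg(1,2) by (simp add: mor_iff comp_add_simps comp_assoc_arr)
  also have "\<dots> = ident C T" using s fg by (simp add: mor_iff)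
  finally have s': "(f \<cdot> i) \<cdot> (p \<cdot> g) \<oplus>\<^sub>a (f \<cdot> j) \<cdot> (q \<cdot> g) = ident C T" .
  have r': "(p \<cdot> g) \<cdot> (f \<cdot> i) = ident C X" "(q \<cdot> g) \<cdot> (f \<cdot> j) = ident C Y"
    "(p \<cdot> g) \<cdot> (f \<cdot> j) = zero_arr C Y X" "(q \<cdot> g) \<cdot> (f \<cdot> i) = zero_arr C X Y"
    using c m r by auto
  have "f \<cdot> i \<in> mor C X T" "p \<cdot> g \<in> mor C T X" "f \<cdot> j \<in> mor C Y T" "q \<cdot> g \<in> mor C T Y"
    using m fg(1,2) by (auto intro: comp_mor)
  with r' s' show ?thesis unfolding direct_sum_pair_iff by blast
qed

text \<open>Conjugating inclusions and projections by isomorphisms of the components leaves each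
  composite \<open>\<iota> i \<cdot> \<pi> i\<close> unchanged, so the completeness relation carries
  over.\<close>

lemma direct_sum_component_iso:
  assumes "direct_sum C Xs S" "length Ys = length Xs"
    and iso: "\<And>i. i < length Xs \<Longrightarrow> iso_obj C (Xs ! i) (Ys ! i)"
  shows "direct_sum C Ys S"
proof -
  let ?n = "length Xs"
  obtain \<iota> \<pi> where S: "set Xs \<subseteq> obj C" "S \<in> obj C"
    and m: "\<And>i. i < ?n \<Longrightarrow> \<iota> i \<in> mor C (Xs ! i) S" "\<And>i. i < ?n \<Longrightarrow> \<pi> i \<in> mor C S (Xs ! i)"
    and o: "\<And>i j. i < ?n \<Longrightarrow> j < ?n \<Longrightarrow>
        \<pi> i \<cdot> \<iota> j = (if i = j then ident C (Xs ! i) else zero_arr C (Xs ! j) (Xs ! i))"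
    and s: "finsum (hom_space C S S) (\<lambda>i. \<iota> i \<cdot> \<pi> i) {..<?n} = ident C S"
    using assms(1) unfolding direct_sum_def by blast
  have "\<exists>f g. i < ?n \<longrightarrow> f \<in> mor C (Xs ! i) (Ys ! i) \<and> g \<in> mor C (Ys ! i) (Xs ! i) \<and>
      g \<cdot> f = ident C (Xs ! i) \<and> f \<cdot> g = ident C (Ys ! i)" for i
    using iso by (metis iso_objE)
  then obtain f g where fg: "\<And>i. i < ?n \<Longrightarrow> f i \<in> mor C (Xs ! i) (Ys ! i)"
    "\<And>i. i < ?n \<Longrightarrow> g i \<in> mor C (Ys ! i) (Xs ! i)"
    "\<And>i. i < ?n \<Longrightarrow> g i \<cdot> f i = ident C (Xs ! i)" "\<And>i. i < ?n \<Longrightarrow> f i \<cdot> g i = ident C (Ys ! i)"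
    by metis
  have Ys: "Ys ! i \<in> obj C" if "i < ?n" for i using mor_obj[OF fg(1)[OF that]] by simp
  have e: "(\<iota> i \<cdot> g i) \<cdot> (f i \<cdot> \<pi> i) = \<iota> i \<cdot> \<pi> i" if i: "i < ?n" for i
  proof -
    have "(\<iota> i \<cdot> g i) \<cdot> (f i \<cdot> \<pi> i) = \<iota> i \<cdot> ((g i \<cdot> f i) \<cdot> \<pi> i)"
      using m[OF i] fg(1,2)[OF i] by (simp add: mor_iff comp_assoc_arr)
    then show ?thesis using m[OF i] fg(3)[OF i] by (simp add: mor_iff)
  qed
  have o': "(f i \<cdot> \<pi> i) \<cdot> (\<iota> j \<cdot> g j) = (if i = j then ident C (Ys ! i) else zero_arr C (Ys ! j) (Ys ! i))"
    if ij: "i < ?n" "j < ?n" for i j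
  proof -
    have "(f i \<cdot> \<pi> i) \<cdot> (\<iota> j \<cdot> g j) = f i \<cdot> ((\<pi> i \<cdot> \<iota> j) \<cdot> g j)"
      using m(2)[OF ij(1)] m(1)[OF ij(2)] fg(1)[OF ij(1)] fg(2)[OF ij(2)] by (simp add: mor_iff comp_assoc_arr)
    also have "\<dots> = (if i = j then ident C (Ys ! i) else zero_arr C (Ys ! j) (Ys ! i))"
      using fg(1)[OF ij(1)] fg(2)[OF ij(2)] fg(4)[OF ij(1)] Ys ij
        mor_obj[OF m(1)[OF ij(1)]] mor_obj[OF m(1)[OF ij(2)]]
      by (auto simp: mor_iff o[OF ij])
    finally show ?thesis .
  qed
  have "finsum (hom_space C S S) (\<lambda>i. (\<iota> i \<cdot> g i) \<cdot> (f i \<cdot> \<pi> i)) {..<?n} = ident C S"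
  proof -
    interpret M: abelian_group "hom_space C S S" by (rule hom_abelian_group[OF S(2) S(2)])
    have c: "carrier (hom_space C S S) = mor C S S" by (simp add: hom_space_def)
    have "finsum (hom_space C S S) (\<lambda>i. (\<iota> i \<cdot> g i) \<cdot> (f i \<cdot> \<pi> i)) {..<?n}
        = finsum (hom_space C S S) (\<lambda>i. \<iota> i \<cdot> \<pi> i) {..<?n}"
    proof (rule M.finsum_cong')
      show "(\<lambda>i. \<iota> i \<cdot> \<pi> i) \<in> {..<?n} \<rightarrow> carrier (hom_space C S S)"
        using m by (auto simp: c intro: comp_mor)
    qed (use e in auto)
    then show ?thesis using s by simp
  qed
  moreover have "\<forall>i<length Ys. \<iota> i \<cdot> g i \<in> mor C (Ys ! i) S \<and> f i \<cdot> \<pi> i \<in> mor C S (Ys ! i)"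
    using assms(2) by (simp add: comp_mor[OF fg(2) m(1)] comp_mor[OF m(2) fg(1)])
  moreover have "set Ys \<subseteq> obj C" using Ys assms(2) by (auto simp: in_set_conv_nth)
  ultimately show ?thesis
    unfolding direct_sum_def using o' S(2) assms(2)
    by (intro conjI exI[of _ "\<lambda>i. \<iota> i \<cdot> g i"] exI[of _ "\<lambda>i. f i \<cdot> \<pi> i"]) simp_all
qed

text \<open>The clause on \<open>h\<close> uses the induction rule for \<open>ident C S\<close>:
  killing \<open>h\<close> is an additive property, and each
  \<open>\<iota> i \<cdot> \<pi> i\<close> has it because \<open>\<pi> i\<close> does.\<close>

lemma direct_sum_jointly_monic:
  assumes "direct_sum C Xs S"
  obtains \<iota> \<pi> where "\<And>i. i < length Xs \<Longrightarrow> \<iota> i \<in> mor C (Xs ! i) S"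
    "\<And>i. i < length Xs \<Longrightarrow> \<pi> i \<in> mor C S (Xs ! i)"
    "\<And>i. i < length Xs \<Longrightarrow> \<pi> i \<cdot> \<iota> i = ident C (Xs ! i)"
    "\<And>i j. i < length Xs \<Longrightarrow> j < length Xs \<Longrightarrow> i \<noteq> j \<Longrightarrow>
      \<pi> i \<cdot> \<iota> j = zero_arr C (Xs ! j) (Xs ! i)"
    "\<And>A h. h \<in> mor C A S \<Longrightarrow> (\<And>i. i < length Xs \<Longrightarrow> \<pi> i \<cdot> h = zero_arr C A (Xs ! i)) \<Longrightarrow>
      h = zero_arr C A S"
  using assms
proof (rule direct_sumE)
  fix \<iota> \<pi>
  assume m: "\<And>i. i < length Xs \<Longrightarrow> \<iota> i \<in> mor C (Xs ! i) S"
    "\<And>i. i < length Xs \<Longrightarrow> \<pi> i \<in> mor C S (Xs ! i)"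
    and r: "\<And>i. i < length Xs \<Longrightarrow> \<pi> i \<cdot> \<iota> i = ident C (Xs ! i)"
      "\<And>i j. i < length Xs \<Longrightarrow> j < length Xs \<Longrightarrow> i \<noteq> j \<Longrightarrow>
      \<pi> i \<cdot> \<iota> j = zero_arr C (Xs ! j) (Xs ! i)"
    and P: "\<And>P. \<lbrakk>P (zero_arr C S S);
      \<And>g h. g \<in> mor C S S \<Longrightarrow> h \<in> mor C S S \<Longrightarrow> P g \<Longrightarrow> P h \<Longrightarrow> P (g \<oplus>\<^sub>a h);
      \<And>i. i < length Xs \<Longrightarrow> P (\<iota> i \<cdot> \<pi> i)\<rbrakk> \<Longrightarrow> P (ident C S)"
  show thesis
  proof (rule that[OF m r])
    fix A h assume h: "h \<in> mor C A S" "\<And>i. i < length Xs \<Longrightarrow> \<pi> i \<cdot> h = zero_arr C A (Xs ! i)"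
    note o = mor_obj[OF h(1)]
    have "ident C S \<cdot> h = zero_arr C A S"
    proof (rule P)
      fix i assume i: "i < length Xs"
      then show "(\<iota> i \<cdot> \<pi> i) \<cdot> h = zero_arr C A S"
        using m[OF i] h o by (auto simp: mor_iff comp_assoc_arr)
    next
      fix f g assume fg: "f \<in> mor C S S" "g \<in> mor C S S" "f \<cdot> h = zero_arr C A S" "g \<cdot> h = zero_arr C A S"
      then have "(f \<oplus>\<^sub>a g) \<cdot> h = zero_arr C A S \<oplus>\<^sub>a zero_arr C A S"
        using comp_add_left h(1) by metis
      then show "(f \<oplus>\<^sub>a g) \<cdot> h = zero_arr C A S" using add_arr_zero zero_arr_mor o by simp
    qed (use h(1) o in \<open>auto simp: mor_iff\<close>)
    then show "h = zero_arr C A S" using h(1) by (simp add: mor_iff)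
  qed
qed

end

section \<open>Semisimple categories\<close>

context abelian_linear_category
begin

lemma kernelE:
  assumes "f \<in> mor C X Y"
  obtains K k where "k \<in> mor C K X" "f \<cdot> k = zero_arr C K Y"
    "\<And>T g h. g \<in> mor C T K \<Longrightarrow> h \<in> mor C T K \<Longrightarrow> k \<cdot> g = k \<cdot> h \<Longrightarrow> g = h"
    "\<And>T h. h \<in> mor C T X \<Longrightarrow> f \<cdot> h = zero_arr C T Y \<Longrightarrow> \<exists>u \<in> mor C T K. k \<cdot> u = h"
proof -
  from assms have f: "f \<in> arr C" "dom_of C f = X" "cod_of C f = Y" by (auto simp: mor_iff)
  obtain k where k: "is_kernel C k f" using kernels_exist f(1) by blast
  then have k': "k \<in> arr C" "cod_of C k = X" "f \<cdot> k = zero_arr C (dom_of C k) Y"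
    and u: "\<And>T h. h \<in> mor C T X \<Longrightarrow> f \<cdot> h = zero_arr C T Y \<Longrightarrow>
      \<exists>!u. u \<in> mor C T (dom_of C k) \<and> k \<cdot> u = h"
    unfolding is_kernel_def f by auto
  show thesis
  proof (rule that[of k "dom_of C k"])
    fix T g h assume gh: "g \<in> mor C T (dom_of C k)" "h \<in> mor C T (dom_of C k)" "k \<cdot> g = k \<cdot> h"
    have "k \<cdot> h \<in> mor C T X" using gh k' by (auto simp: mor_iff)
    moreover have "f \<cdot> (k \<cdot> h) = zero_arr C T Y"
    proof -
      have "f \<cdot> (k \<cdot> h) = (f \<cdot> k) \<cdot> h"
        using gh k'(1,2) f comp_assoc_arr[of h k f] by (simp add: mor_iff)
      then show ?thesis using gh k' f by (auto simp: mor_iff)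
    qed
    ultimately show "g = h" using u[of "k \<cdot> h" T] gh by auto
  next
    fix T h assume "h \<in> mor C T X" "f \<cdot> h = zero_arr C T Y"
    then show "\<exists>u \<in> mor C T (dom_of C k). k \<cdot> u = h" using u by blast
  qed (use k' in \<open>auto simp: mor_iff\<close>)
qed

lemma mono_arrI:
  assumes "k \<in> mor C K X"
    "\<And>T g h. g \<in> mor C T K \<Longrightarrow> h \<in> mor C T K \<Longrightarrow> k \<cdot> g = k \<cdot> h \<Longrightarrow> g = h"
  shows "mono_arr C k"
  using assms unfolding mono_arr_def by (auto simp: mor_iff)

lemma simple_objD:
  assumes "simple_obj C X"
  shows "X \<in> obj C" "\<not> zero_obj C X" "ident C X \<noteq> zero_arr C X X"
  using assms by (auto simp: simple_obj_def zero_obj_iff)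

lemma zero_kernel_mono:
  assumes "f \<in> mor C X Y" "\<And>T h. h \<in> mor C T X \<Longrightarrow> f \<cdot> h = zero_arr C T Y \<Longrightarrow> h = zero_arr C T X"
  shows "mono_arr C f"
proof (rule mono_arrI[OF assms(1)])
  fix T g h assume gh: "g \<in> mor C T X" "h \<in> mor C T X" "f \<cdot> g = f \<cdot> h"
  then have "f \<cdot> (g \<ominus>\<^sub>a h) = zero_arr C T Y"
    using assms(1) by (auto simp: mor_iff comp_minus_simps)
  then have "g \<ominus>\<^sub>a h = zero_arr C T X"
    using gh by (intro assms(2)) (auto simp: mor_iff)
  then show "g = h" using gh minus_eq_zero_iff by (auto simp: mor_iff)
qed

text \<open>The kernel of \<open>f\<close> is a subobject of the simple \<open>S\<close>. It is not
  all of \<open>S\<close> since \<open>f\<close> is nonzero, so it is a zero object.\<close>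

lemma simple_source_mono:
  assumes "simple_obj C S" "f \<in> mor C S T" "f \<noteq> zero_arr C S T"
  shows "mono_arr C f"
proof -
  obtain K k where k: "k \<in> mor C K S" "f \<cdot> k = zero_arr C K T"
    "\<And>T g h. g \<in> mor C T K \<Longrightarrow> h \<in> mor C T K \<Longrightarrow> k \<cdot> g = k \<cdot> h \<Longrightarrow> g = h"
    "\<And>A h. h \<in> mor C A S \<Longrightarrow> f \<cdot> h = zero_arr C A T \<Longrightarrow> \<exists>u \<in> mor C A K. k \<cdot> u = h"
    using kernelE[OF assms(2)] by metis
  have m: "mono_arr C k" using k(1,3) by (rule mono_arrI)
  have "\<not> iso_arr C k"
  proof
    assume "iso_arr C k"
    then obtain g where g: "g \<in> mor C S K" "k \<cdot> g = ident C S" using k(1) by (metis iso_arrE)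
    have "f = f \<cdot> (k \<cdot> g)" using g assms by (auto simp: mor_iff)
    also have "\<dots> = (f \<cdot> k) \<cdot> g" using g k(1) assms(2) comp_assoc_arr[of g k f] by (simp add: mor_iff)
    also have "\<dots> = zero_arr C S T" using k(1,2) g(1) assms by (auto simp: mor_iff)
    finally show False using assms(3) by simp
  qed
  then have z: "zero_obj C K" using assms(1) m k(1) unfolding simple_obj_def by (auto simp: mor_iff)
  show ?thesis
  proof (rule zero_kernel_mono[OF assms(2)])
    fix A h assume h: "h \<in> mor C A S" "f \<cdot> h = zero_arr C A T"
    then obtain u where u: "u \<in> mor C A K" "k \<cdot> u = h" using k(4) by blast
    have "u = zero_arr C A K" using zero_eq_identD[of u] u(1) z by (auto simp: mor_iff zero_obj_iff)
    then show "h = zero_arr C A S" using u k(1) mor_obj[OF u(1)] by (auto simp: mor_iff)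
  qed
qed

text \<open>A nonzero arrow out of \<open>S\<close> is monic, and a monic arrow into the simple
  \<open>T\<close> from a nonzero object is invertible.\<close>

lemma schur_iso:
  assumes "simple_obj C S" "simple_obj C T" "f \<in> mor C S T" "f \<noteq> zero_arr C S T"
  shows "iso_arr C f"
  using simple_source_mono[OF assms(1,3,4)] assms unfolding simple_obj_def by (auto simp: mor_iff)

lemma split_mono:
  assumes "i \<in> mor C X S" "p \<in> mor C S X" "p \<cdot> i = ident C X"
  shows "mono_arr C i"
proof (rule mono_arrI[OF assms(1)])
  fix T g h assume gh: "g \<in> mor C T X" "h \<in> mor C T X" "i \<cdot> g = i \<cdot> h"
  have "x = p \<cdot> (i \<cdot> x)" if "x \<in> mor C T X" for x
    using that assms comp_assoc_arr[of x i p] by (simp add: mor_iff)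
  then show "g = h" using gh by metis
qed

lemma retract_simple_iso:
  assumes "retract T S" "simple_obj C S" "\<not> zero_obj C T"
  shows "iso_obj C T S"
proof -
  obtain i p where m: "i \<in> mor C T S" "p \<in> mor C S T" "p \<cdot> i = ident C T"
    using assms(1) unfolding retract_def by blast
  then have "iso_arr C i"
    using assms(2,3) split_mono[OF m] unfolding simple_obj_def by (auto simp: mor_iff)
  then show ?thesis using m(1) iso_objI_arr by blast
qed

text \<open>If \<open>Y\<close> is nonzero, its split inclusion is monic into a simple object, hence
  invertible. The projection to \<open>Z\<close> kills this inclusion, so it is 0 and
  \<open>Z\<close> is a zero object.\<close>

lemma simple_not_split:
  assumes "simple_obj C S" "orthogonal_split Y Z S"
  shows "zero_obj C Y \<or> zero_obj C Z"
proof (rule ccontr)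
  assume nz: "\<not> ?thesis"
  obtain i p i' p' where m: "i \<in> mor C Y S" "p \<in> mor C S Y" "i' \<in> mor C Z S" "p' \<in> mor C S Z"
    "p \<cdot> i = ident C Y" "p' \<cdot> i' = ident C Z" "p' \<cdot> i = zero_arr C Y Z"
    using assms(2) unfolding orthogonal_split_def by blast
  have "iso_arr C i"
    using assms(1) nz split_mono[OF m(1,2,5)] m(1) unfolding simple_obj_def by (auto simp: mor_iff)
  then obtain g where g: "g \<in> mor C S Y" "i \<cdot> g = ident C S" using m(1) by (metis iso_arrE)
  have "p' = p' \<cdot> (i \<cdot> g)" using m(4) g(2) by (simp add: mor_iff)
  also have "\<dots> = (p' \<cdot> i) \<cdot> g" using m(1,4) g(1) by (simp add: mor_iff comp_assoc_arr)
  also have "\<dots> = zero_arr C S Z" using g(1) m(7) mor_obj[OF m(4)] by (auto simp: mor_iff)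
  finally have "ident C Z = zero_arr C Z Z" using m(3,6) mor_obj[OF m(4)] by (auto simp: mor_iff)
  then show False using nz mor_obj[OF m(3)] by (simp add: zero_obj_iff)
qed

lemma orthogonal_split_retract:
  assumes "orthogonal_split Y Z T" "retract T S"
  shows "orthogonal_split Y Z S"
proof -
  obtain i p i' p' where m: "i \<in> mor C Y T" "p \<in> mor C T Y" "i' \<in> mor C Z T" "p' \<in> mor C T Z"
    "p \<cdot> i = ident C Y" "p' \<cdot> i' = ident C Z" "p \<cdot> i' = zero_arr C Z Y" "p' \<cdot> i = zero_arr C Y Z"
    using assms(1) unfolding orthogonal_split_def by blast
  obtain j q where j: "j \<in> mor C T S" "q \<in> mor C S T" "q \<cdot> j = ident C T"
    using assms(2) unfolding retract_def by blast
  have "(b \<cdot> q) \<cdot> (j \<cdot> a) = b \<cdot> a" if "a \<in> mor C A T" "b \<in> mor C T B" for a b A B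
  proof -
    have "(b \<cdot> q) \<cdot> (j \<cdot> a) = b \<cdot> ((q \<cdot> j) \<cdot> a)"
      using that j(1,2) by (simp add: mor_iff comp_assoc_arr)
    then show ?thesis using that j(3) by (simp add: mor_iff)
  qed
  then have *: "(p \<cdot> q) \<cdot> (j \<cdot> i) = ident C Y" "(p' \<cdot> q) \<cdot> (j \<cdot> i') = ident C Z"
    "(p \<cdot> q) \<cdot> (j \<cdot> i') = zero_arr C Z Y" "(p' \<cdot> q) \<cdot> (j \<cdot> i) = zero_arr C Y Z"
    using m by auto
  have "j \<cdot> i \<in> mor C Y S" "p \<cdot> q \<in> mor C S Y" "j \<cdot> i' \<in> mor C Z S" "p' \<cdot> q \<in> mor C S Z"
    using m j by (auto intro: comp_mor)
  with * show ?thesis unfolding orthogonal_split_def by blast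
qed

lemma direct_sum_pair_split:
  assumes "direct_sum C Xs S" "i < length Xs" "j < length Xs" "i \<noteq> j"
  shows "orthogonal_split (Xs ! i) (Xs ! j) S"
  using assms(1)
proof (rule direct_sumE)
  fix \<iota> \<pi>
  assume "\<And>i. i < length Xs \<Longrightarrow> \<iota> i \<in> mor C (Xs ! i) S"
    "\<And>i. i < length Xs \<Longrightarrow> \<pi> i \<in> mor C S (Xs ! i)"
    "\<And>i. i < length Xs \<Longrightarrow> \<pi> i \<cdot> \<iota> i = ident C (Xs ! i)"
    "\<And>i j. i < length Xs \<Longrightarrow> j < length Xs \<Longrightarrow> i \<noteq> j \<Longrightarrow>
      \<pi> i \<cdot> \<iota> j = zero_arr C (Xs ! j) (Xs ! i)"
  then show ?thesis unfolding orthogonal_split_def using assms(2-4) by metis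
qed

lemma direct_sum_retract:
  assumes "direct_sum C Xs S" "X \<in> set Xs"
  shows "retract X S"
proof -
  obtain i where i: "i < length Xs" "Xs ! i = X" using assms(2) by (auto simp: in_set_conv_nth)
  show ?thesis using assms(1)
  proof (rule direct_sumE)
    fix \<iota> \<pi>
    assume "\<And>i. i < length Xs \<Longrightarrow> \<iota> i \<in> mor C (Xs ! i) S"
      "\<And>i. i < length Xs \<Longrightarrow> \<pi> i \<in> mor C S (Xs ! i)"
      "\<And>i. i < length Xs \<Longrightarrow> \<pi> i \<cdot> \<iota> i = ident C (Xs ! i)"
    then show ?thesis unfolding retract_def using i by blast
  qed
qed

text \<open>The complement is the kernel \<open>k\<close> of the projection \<open>p\<close>. The
  arrow \<open>1 - i p\<close> factors as \<open>k u\<close>, and the remaining biproduct equations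
  follow by cancelling \<open>k\<close> on the left.\<close>

lemma retract_direct_summand:
  assumes "retract X S"
  shows "direct_summand C X S"
proof -
  obtain i p where m: "i \<in> mor C X S" "p \<in> mor C S X" "p \<cdot> i = ident C X"
    using assms unfolding retract_def by blast
  obtain K k where k: "k \<in> mor C K S" "p \<cdot> k = zero_arr C K X"
    "\<And>T g h. g \<in> mor C T K \<Longrightarrow> h \<in> mor C T K \<Longrightarrow> k \<cdot> g = k \<cdot> h \<Longrightarrow> g = h"
    "\<And>A h. h \<in> mor C A S \<Longrightarrow> p \<cdot> h = zero_arr C A X \<Longrightarrow> \<exists>u \<in> mor C A K. k \<cdot> u = h"
    using kernelE[OF m(2)] by metis
  note o = mor_obj[OF m(1)] mor_obj[OF k(1)]
  note a = m(1,2)[unfolded mor_iff] k(1)[unfolded mor_iff]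
  have pip: "p \<cdot> (i \<cdot> p) = p"
    using a m(3) comp_assoc_arr[of p i p] by simp
  have "p \<cdot> (ident C S \<ominus>\<^sub>a i \<cdot> p) = zero_arr C S X"
    using a o pip by (simp add: comp_minus_simps)
  then obtain u where u: "u \<in> mor C S K" "k \<cdot> u = ident C S \<ominus>\<^sub>a i \<cdot> p"
    using k(4)[of "ident C S \<ominus>\<^sub>a i \<cdot> p" S] a o by (auto simp: mor_iff)
  note a = a u(1)[unfolded mor_iff]
  have uk: "u \<cdot> k = ident C K"
  proof (rule k(3)[of _ K])
    have "k \<cdot> (u \<cdot> k) = (ident C S \<ominus>\<^sub>a i \<cdot> p) \<cdot> k" using a u(2) comp_assoc_arr[of k u k] by simp
    also have "\<dots> = k"
      using a o k(2) comp_assoc_arr[of k p i] by (simp add: comp_minus_simps)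
    finally show "k \<cdot> (u \<cdot> k) = k \<cdot> ident C K" using a o by simp
  qed (use a o in \<open>auto simp: mor_iff\<close>)
  have ui: "u \<cdot> i = zero_arr C X K"
  proof (rule k(3)[of _ X])
    have "k \<cdot> (u \<cdot> i) = (ident C S \<ominus>\<^sub>a i \<cdot> p) \<cdot> i" using a u(2) comp_assoc_arr[of i u k] by simp
    also have "\<dots> = zero_arr C X S"
      using a o m(3) comp_assoc_arr[of i p i] by (simp add: comp_minus_simps)
    finally show "k \<cdot> (u \<cdot> i) = k \<cdot> zero_arr C X K" using a o by simp
  qed (use a o in \<open>auto simp: mor_iff\<close>)
  have sm: "i \<cdot> p \<oplus>\<^sub>a k \<cdot> u = ident C S"
  proof -
    have mm: "i \<cdot> p \<in> mor C S S" "(-1) \<odot>\<^sub>a (i \<cdot> p) \<in> mor C S S" "ident C S \<in> mor C S S"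
      using a o by (auto simp: mor_iff)
    have S: "S \<in> obj C" using o by simp
    have "i \<cdot> p \<oplus>\<^sub>a k \<cdot> u = i \<cdot> p \<oplus>\<^sub>a ((-1) \<odot>\<^sub>a (i \<cdot> p) \<oplus>\<^sub>a ident C S)"
      using u(2) add_arr_comm[OF S S mm(3,2)] by (simp add: minus_arr_def)
    also have "\<dots> = (i \<cdot> p \<oplus>\<^sub>a (-1) \<odot>\<^sub>a (i \<cdot> p)) \<oplus>\<^sub>a ident C S"
      using add_arr_assoc[OF S S mm] by simp
    also have "\<dots> = ident C S"
      using minus_self[of "i \<cdot> p"] add_zero_arr[OF S S mm(3)] a S by (simp add: minus_arr_def)
    finally show ?thesis .
  qed
  have "direct_sum C [X, K] S"
    unfolding direct_sum_pair_iff using m k(1,2) u(1) uk ui sm by blast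
  then show ?thesis unfolding direct_summand_def by blast
qed

end

section \<open>Simple objects as test objects\<close>

context fusion_category
begin

text \<open>By semisimplicity the projections of \<open>T\<close> to its simple summands are jointly
  monic, so simple targets detect every nonzero arrow.\<close>

lemma simples_jointly_monic:
  assumes "f \<in> mor C S T" "\<And>A p. simple_obj C A \<Longrightarrow> p \<in> mor C T A \<Longrightarrow> p \<cdot> f = zero_arr C S A"
  shows "f = zero_arr C S T"
proof -
  note o = mor_obj[OF assms(1)]
  obtain Ss where Ss: "\<forall>A \<in> set Ss. simple_obj C A" "direct_sum C Ss T"
    using semisimple o by blast
  obtain \<pi> where \<pi>: "\<And>i. i < length Ss \<Longrightarrow> \<pi> i \<in> mor C T (Ss ! i)"
    "\<And>A h. h \<in> mor C A T \<Longrightarrow> (\<And>i. i < length Ss \<Longrightarrow> \<pi> i \<cdot> h = zero_arr C A (Ss ! i)) \<Longrightarrow>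
      h = zero_arr C A T" by (rule direct_sum_jointly_monic[OF Ss(2)]) blast
  show ?thesis
  proof (rule \<pi>(2)[OF assms(1)])
    fix i assume "i < length Ss"
    then show "\<pi> i \<cdot> f = zero_arr C S (Ss ! i)" using assms(2) Ss(1) \<pi>(1) by simp
  qed
qed

lemma simples_jointly_epic:
  assumes "f \<in> mor C T S" "\<And>A i. simple_obj C A \<Longrightarrow> i \<in> mor C A T \<Longrightarrow> f \<cdot> i = zero_arr C A S"
  shows "f = zero_arr C T S"
proof -
  note o = mor_obj[OF assms(1)]
  obtain Ss where Ss: "\<forall>A \<in> set Ss. simple_obj C A" "direct_sum C Ss T"
    using semisimple o by blast
  from Ss(2) show ?thesis
  proof (rule direct_sumE)
    fix \<iota> \<pi>
    assume m: "\<And>i. i < length Ss \<Longrightarrow> \<iota> i \<in> mor C (Ss ! i) T"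
      "\<And>i. i < length Ss \<Longrightarrow> \<pi> i \<in> mor C T (Ss ! i)"
      and P: "\<And>P. \<lbrakk>P (zero_arr C T T);
      \<And>g h. g \<in> mor C T T \<Longrightarrow> h \<in> mor C T T \<Longrightarrow> P g \<Longrightarrow> P h \<Longrightarrow> P (g \<oplus>\<^sub>a h);
      \<And>i. i < length Ss \<Longrightarrow> P (\<iota> i \<cdot> \<pi> i)\<rbrakk> \<Longrightarrow> P (ident C T)"
    have "f \<cdot> ident C T = zero_arr C T S"
    proof (rule P)
      fix i assume i: "i < length Ss"
      have "f \<cdot> \<iota> i = zero_arr C (Ss ! i) S" using assms(2) Ss(1) m(1) i by simp
      then show "f \<cdot> (\<iota> i \<cdot> \<pi> i) = zero_arr C T S"
        using m[OF i] assms(1) o comp_assoc_arr[of "\<pi> i" "\<iota> i" f] by (auto simp: mor_iff)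
    next
      fix g h assume gh: "g \<in> mor C T T" "h \<in> mor C T T" "f \<cdot> g = zero_arr C T S"
        "f \<cdot> h = zero_arr C T S"
      then have "f \<cdot> (g \<oplus>\<^sub>a h) = zero_arr C T S \<oplus>\<^sub>a zero_arr C T S"
        using comp_add_right assms(1) by metis
      then show "f \<cdot> (g \<oplus>\<^sub>a h) = zero_arr C T S" using add_arr_zero zero_arr_mor o by simp
    qed (use assms(1) o in \<open>auto simp: mor_iff\<close>)
    then show ?thesis using assms(1) by (simp add: mor_iff)
  qed
qed

text \<open>Some arrow \<open>q\<close> to a simple object does not kill \<open>f\<close>; the
  composite is then invertible by Schur's lemma, and its inverse after \<open>q\<close> retracts
  \<open>f\<close>.\<close>

lemma simple_section:
  assumes "simple_obj C T" "f \<in> mor C T S" "f \<noteq> zero_arr C T S"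
  obtains p where "p \<in> mor C S T" "p \<cdot> f = ident C T"
proof -
  obtain A q where q: "simple_obj C A" "q \<in> mor C S A" "q \<cdot> f \<noteq> zero_arr C T A"
    using simples_jointly_monic[OF assms(2)] assms(3) by blast
  have qf: "q \<cdot> f \<in> mor C T A" using comp_mor[OF assms(2) q(2)] .
  then obtain g where g: "g \<in> mor C A T" "g \<cdot> (q \<cdot> f) = ident C T"
    using schur_iso[OF assms(1) q(1) qf q(3)] by (metis iso_arrE)
  then have "(g \<cdot> q) \<cdot> f = ident C T" using comp_assoc[OF assms(2) q(2) g(1)] by simp
  then show thesis using that comp_mor[OF q(2) g(1)] by blast
qed

lemma simple_retraction:
  assumes "simple_obj C T" "f \<in> mor C S T" "f \<noteq> zero_arr C S T"
  obtains i where "i \<in> mor C T S" "f \<cdot> i = ident C T"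
proof -
  obtain A j where q: "simple_obj C A" "j \<in> mor C A S" "f \<cdot> j \<noteq> zero_arr C A T"
    using simples_jointly_epic[OF assms(2)] assms(3) by blast
  have qf: "f \<cdot> j \<in> mor C A T" using comp_mor[OF q(2) assms(2)] .
  then obtain g where g: "g \<in> mor C T A" "(f \<cdot> j) \<cdot> g = ident C T"
    using schur_iso[OF q(1) assms(1) qf q(3)] by (metis iso_arrE)
  then have "f \<cdot> (j \<cdot> g) = ident C T" using comp_assoc[OF g(1) q(2) assms(2)] by simp
  then show thesis using that comp_mor[OF g(1) q(2)] by blast
qed

lemma simple_map_retract:
  assumes "simple_obj C T" "f \<in> mor C T S \<and> f \<noteq> zero_arr C T S \<or> f \<in> mor C S T \<and> f \<noteq> zero_arr C S T"
  shows "retract T S"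
  using assms(2) unfolding retract_def
  by (metis simple_section[OF assms(1)] simple_retraction[OF assms(1)])

lemma nonzero_simple_retract:
  assumes "S \<in> obj C" "\<not> zero_obj C S"
  obtains T where "simple_obj C T" "retract T S"
proof -
  have "ident C S \<in> mor C S S" "ident C S \<noteq> zero_arr C S S"
    using assms by (auto simp: zero_obj_iff mor_iff)
  then obtain T i where "simple_obj C T" "i \<in> mor C T S" "ident C S \<cdot> i \<noteq> zero_arr C T S"
    using simples_jointly_epic by blast
  then show thesis using that simple_map_retract[of T i S] by (auto simp: mor_iff)
qed

lemma simple_iso:
  assumes "simple_obj C S" "iso_obj C S T"
  shows "simple_obj C T"
  unfolding simple_obj_def
proof (intro conjI allI impI)
  show T: "T \<in> obj C" using assms(2) by (auto simp: iso_obj_def)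
  show "\<not> zero_obj C T"
    using zero_obj_retract[OF iso_obj_retract[OF assms(2)]] simple_objD[OF assms(1)] by blast
  fix f assume f: "mono_arr C f" "cod_of C f = T"
  show "zero_obj C (dom_of C f) \<or> iso_arr C f"
  proof (cases "zero_obj C (dom_of C f)")
    case False
    obtain a b where ab: "a \<in> mor C S T" "b \<in> mor C T S" "b \<cdot> a = ident C S" "a \<cdot> b = ident C T"
      using assms(2) by (metis iso_objE)
    have fa: "f \<in> mor C (dom_of C f) T" using f by (auto simp: mono_arr_def mor_iff)
    note t = ab(1,2)[unfolded mor_iff] fa[unfolded mor_iff]
    have "mono_arr C (b \<cdot> f)"
    proof (rule mono_arrI)
      show "b \<cdot> f \<in> mor C (dom_of C f) S" using comp_mor[OF fa ab(2)] .
      fix X g h assume gh: "g \<in> mor C X (dom_of C f)" "h \<in> mor C X (dom_of C f)"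
        "(b \<cdot> f) \<cdot> g = (b \<cdot> f) \<cdot> h"
      have "f \<cdot> x = a \<cdot> ((b \<cdot> f) \<cdot> x)" if "x \<in> mor C X (dom_of C f)" for x
        using that t ab(4) comp_assoc_arr[of "f \<cdot> x" b a] comp_assoc_arr[of x f b]
        by (simp add: mor_iff)
      then have "f \<cdot> g = f \<cdot> h" using gh by metis
      then show "g = h" using f(1) gh(1,2) unfolding mono_arr_def by blast
    qed
    moreover have "cod_of C (b \<cdot> f) = S" "dom_of C (b \<cdot> f) = dom_of C f" using t by auto
    ultimately have "iso_arr C (b \<cdot> f)" using assms(1) False unfolding simple_obj_def by metis
    then obtain g where g: "g \<in> mor C S (dom_of C f)" "g \<cdot> (b \<cdot> f) = ident C (dom_of C f)"
      "(b \<cdot> f) \<cdot> g = ident C S" using comp_mor[OF fa ab(2)] by (metis iso_arrE)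
    note t = t g(1)[unfolded mor_iff]
    have "f \<cdot> g = a \<cdot> ((b \<cdot> f) \<cdot> g)"
      using t ab(4) comp_assoc_arr[of "f \<cdot> g" b a] comp_assoc_arr[of g f b] by simp
    then have fg: "f \<cdot> g = a" using g(3) t by simp
    have "iso_arr C f"
    proof (rule iso_arrI[OF fa])
      show "g \<cdot> b \<in> mor C T (dom_of C f)" using comp_mor[OF ab(2) g(1)] .
      show "g \<cdot> b \<cdot> f = ident C (dom_of C f)" using g(2) t comp_assoc_arr[of f b g] by simp
      show "f \<cdot> (g \<cdot> b) = ident C T" using fg ab(4) t comp_assoc_arr[of b g f] by simp
    qed
    then show ?thesis ..
  qed simp
qed

lemma direct_sum_single_iso:
  assumes "direct_sum C [A] S"
  shows "iso_obj C A S"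
  using assms
proof (rule direct_sumE)
  fix \<iota> \<pi>
  assume m: "\<And>i. i < length [A] \<Longrightarrow> \<iota> i \<in> mor C ([A] ! i) S"
    "\<And>i. i < length [A] \<Longrightarrow> \<pi> i \<in> mor C S ([A] ! i)"
    "\<And>i. i < length [A] \<Longrightarrow> \<pi> i \<cdot> \<iota> i = ident C ([A] ! i)"
    and S: "S \<in> obj C"
    and s: "finsum (hom_space C S S) (\<lambda>i. \<iota> i \<cdot> \<pi> i) {..<length [A]} = ident C S"
  interpret M: abelian_group "hom_space C S S" by (rule hom_abelian_group[OF S S])
  have m0: "\<iota> 0 \<in> mor C A S" "\<pi> 0 \<in> mor C S A" "\<pi> 0 \<cdot> \<iota> 0 = ident C A"
    using m[of 0] by auto
  have c: "carrier (hom_space C S S) = mor C S S" "add (hom_space C S S) = add_arr C"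
    "ring.zero (hom_space C S S) = zero_arr C S S" by (simp_all add: hom_space_def)
  have x: "\<iota> 0 \<cdot> \<pi> 0 \<in> mor C S S" using comp_mor m0 by blast
  have "{..<length [A]} = {0}" by auto
  then have "\<iota> 0 \<cdot> \<pi> 0 = ident C S"
    using s x add_arr_zero[OF S S x] by (simp add: c Pi_def)
  then show ?thesis using m0 iso_objI by blast
qed

text \<open>A decomposition into no simple objects gives a zero object and one into a single simple
  object gives a simple object, so there are at least two summands to choose from.\<close>

lemma not_simple_split:
  assumes "S \<in> obj C" "\<not> zero_obj C S" "\<not> simple_obj C S"
  obtains Y Z where "simple_obj C Y" "simple_obj C Z" "orthogonal_split Y Z S"
proof -
  obtain Ss where Ss: "\<forall>A \<in> set Ss. simple_obj C A" "direct_sum C Ss S"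
    using semisimple assms by blast
  consider "length Ss = 0" | "length Ss = 1" | "length Ss \<ge> 2" by linarith
  then show thesis
  proof cases
    case 1
    then show ?thesis using Ss(2) assms(2) by (simp add: zero_obj_def)
  next
    case 2
    then obtain A where A: "Ss = [A]" by (auto simp: length_Suc_conv)
    then have "iso_obj C A S" using direct_sum_single_iso Ss(2) by simp
    then show ?thesis using simple_iso Ss(1) A assms(3) by auto
  next
    case 3
    then have "orthogonal_split (Ss ! 0) (Ss ! 1) S"
      by (intro direct_sum_pair_split[OF Ss(2)]) linarith+
    moreover have "Ss ! 0 \<in> set Ss" "Ss ! 1 \<in> set Ss" using 3 by (auto intro: nth_mem)
    ultimately show ?thesis using that Ss(1) by blast
  qed
qed

text \<open>If \<open>Y\<close> had two disjoint simple summands \<open>A\<close> and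
  \<open>B\<close>, the idempotent \<open>i p\<close> onto \<open>A\<close> would be a scalar.
  Composing with the projection to \<open>B\<close> forces this scalar to be 0, and then
  \<open>i = i p i\<close> vanishes. The lemma serves to show that the unit is simple.\<close>

lemma simple_if_scalar_endomorphisms:
  assumes "Y \<in> obj C" "\<not> zero_obj C Y" "\<And>f. f \<in> mor C Y Y \<Longrightarrow> \<exists>c. f = c \<odot>\<^sub>a ident C Y"
  shows "simple_obj C Y"
proof (rule ccontr)
  assume "\<not> simple_obj C Y"
  then obtain A B where AB: "simple_obj C A" "simple_obj C B" "orthogonal_split A B Y"
    using not_simple_split assms by blast
  then obtain i p i' p' where m: "i \<in> mor C A Y" "p \<in> mor C Y A" "i' \<in> mor C B Y" "p' \<in> mor C Y B"
    "p \<cdot> i = ident C A" "p' \<cdot> i' = ident C B" "p' \<cdot> i = zero_arr C A B"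
    unfolding orthogonal_split_def by blast
  note t = m(1-4)[unfolded mor_iff]
  have "i \<cdot> p \<in> mor C Y Y" using comp_mor m by blast
  then obtain c where c: "i \<cdot> p = c \<odot>\<^sub>a ident C Y" using assms(3) by blast
  have "i = (i \<cdot> p) \<cdot> i" using t m(5) comp_assoc_arr[of i p i] by simp
  then have "i = c \<odot>\<^sub>a i" using c t assms(1) by simp
  moreover have "zero_arr C Y B = (p' \<cdot> i) \<cdot> p"
    using t m(7) mor_obj[OF m(4)] mor_obj[OF m(2)] by simp
  then have "zero_arr C Y B = p' \<cdot> (c \<odot>\<^sub>a ident C Y)" using c t comp_assoc_arr[of p i p'] by simp
  then have "zero_arr C Y B = c \<odot>\<^sub>a p'" using t assms(1) by simp
  then have "c = 0"
  proof (rule_tac ccontr)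
    assume "zero_arr C Y B = c \<odot>\<^sub>a p'" "c \<noteq> 0"
    then have "p' = (1 / c) \<odot>\<^sub>a zero_arr C Y B" using t by simp
    then have "p' = zero_arr C Y B" using scale_zero_arr mor_obj[OF m(4)] by simp
    then have "ident C B = zero_arr C B B" using m(6) t mor_obj[OF m(4)] by simp
    then show False using simple_objD(3)[OF AB(2)] by simp
  qed
  ultimately have "i = zero_arr C A Y" using t by simp
  then have "ident C A = zero_arr C A A" using m(5) t mor_obj[OF m(2)] by simp
  then show False using simple_objD(3)[OF AB(1)] by simp
qed

end

section \<open>Endomorphisms of simple objects\<close>

context linear_category
begin

text \<open>Recursion over a list, so that the dimension argument can strip off one generator at a
  time.\<close>

primrec lin_span :: "'o \<Rightarrow> 'o \<Rightarrow> 'm list \<Rightarrow> 'm set" where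
  "lin_span X Y [] = {zero_arr C X Y}"
| "lin_span X Y (b # bs) = {c \<odot>\<^sub>a b \<oplus>\<^sub>a x | c x. x \<in> lin_span X Y bs}"

lemma lin_span_mor:
  assumes "X \<in> obj C" "Y \<in> obj C" "set bs \<subseteq> mor C X Y"
  shows "lin_span X Y bs \<subseteq> mor C X Y"
  using assms(3)
  by (induction bs) (auto intro!: add_arr_mor[OF assms(1,2)] zero_arr_mor[OF assms(1,2)]
    scale_arr_mor[OF assms(1,2)])

lemma lin_comb_Cons:
  assumes o: "X \<in> obj C" "Y \<in> obj C" and m: "b \<in> mor C X Y" "x \<in> mor C X Y" "y \<in> mor C X Y"
  shows "(c \<odot>\<^sub>a b \<oplus>\<^sub>a x) \<oplus>\<^sub>a t \<odot>\<^sub>a (d \<odot>\<^sub>a b \<oplus>\<^sub>a y) = (c + t * d) \<odot>\<^sub>a b \<oplus>\<^sub>a (x \<oplus>\<^sub>a t \<odot>\<^sub>a y)"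
proof -
  note r = add_arr_mor[OF o] scale_arr_mor[OF o]
  let ?cb = "c \<odot>\<^sub>a b" and ?tb = "(t * d) \<odot>\<^sub>a b" and ?ty = "t \<odot>\<^sub>a y"
  have mm: "?cb \<in> mor C X Y" "?tb \<in> mor C X Y" "?ty \<in> mor C X Y" "d \<odot>\<^sub>a b \<in> mor C X Y"
    using m by (auto intro: r)
  have "t \<odot>\<^sub>a (d \<odot>\<^sub>a b \<oplus>\<^sub>a y) = ?tb \<oplus>\<^sub>a ?ty"
    using scale_distrib_mor[OF o mm(4) m(3)] scale_scale_mor[OF o m(1)] by simp
  also have "(?cb \<oplus>\<^sub>a x) \<oplus>\<^sub>a (?tb \<oplus>\<^sub>a ?ty) = ?cb \<oplus>\<^sub>a ((x \<oplus>\<^sub>a ?tb) \<oplus>\<^sub>a ?ty)"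
    using add_arr_assoc[OF o] m mm r by simp
  also have "\<dots> = ?cb \<oplus>\<^sub>a (?tb \<oplus>\<^sub>a (x \<oplus>\<^sub>a ?ty))"
    using add_arr_assoc[OF o] add_arr_comm[OF o m(2) mm(2)] m mm r by simp
  also have "\<dots> = (?cb \<oplus>\<^sub>a ?tb) \<oplus>\<^sub>a (x \<oplus>\<^sub>a ?ty)"
    using add_arr_assoc[OF o mm(1,2), of "x \<oplus>\<^sub>a ?ty"] m mm r by simp
  finally show ?thesis using scale_add_mor[OF o m(1)] by simp
qed

lemma lin_span_comb:
  assumes o: "X \<in> obj C" "Y \<in> obj C" and "set bs \<subseteq> mor C X Y"
    and "x \<in> lin_span X Y bs" "y \<in> lin_span X Y bs"
  shows "x \<oplus>\<^sub>a t \<odot>\<^sub>a y \<in> lin_span X Y bs"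
  using assms(3-)
proof (induction bs arbitrary: x y)
  case Nil
  then show ?case using scale_zero_arr[OF o] add_arr_zero[OF o zero_arr_mor[OF o]] by simp
next
  case (Cons b bs)
  obtain c x' d y' where e: "x = c \<odot>\<^sub>a b \<oplus>\<^sub>a x'" "x' \<in> lin_span X Y bs"
    "y = d \<odot>\<^sub>a b \<oplus>\<^sub>a y'" "y' \<in> lin_span X Y bs" using Cons.prems by auto
  have "x \<oplus>\<^sub>a t \<odot>\<^sub>a y = (c + t * d) \<odot>\<^sub>a b \<oplus>\<^sub>a (x' \<oplus>\<^sub>a t \<odot>\<^sub>a y')"
    unfolding e(1,3)
  proof (rule lin_comb_Cons[OF o])
    show "b \<in> mor C X Y" "x' \<in> mor C X Y" "y' \<in> mor C X Y"
      using lin_span_mor[OF o, of bs] e(2,4) Cons.prems(1) by auto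
  qed
  moreover have "x' \<oplus>\<^sub>a t \<odot>\<^sub>a y' \<in> lin_span X Y bs" using Cons e by auto
  ultimately show ?case by auto
qed

lemma finsum_in_lin_span:
  assumes o: "X \<in> obj C" "Y \<in> obj C" and "distinct bs" "set bs \<subseteq> mor C X Y"
  shows "finsum (hom_space C X Y) (\<lambda>b. c b \<odot>\<^sub>a b) (set bs) \<in> lin_span X Y bs"
proof -
  interpret M: abelian_group "hom_space C X Y" by (rule hom_abelian_group[OF o])
  have d: "carrier (hom_space C X Y) = mor C X Y" "add (hom_space C X Y) = add_arr C"
    "ring.zero (hom_space C X Y) = zero_arr C X Y" by (simp_all add: hom_space_def)
  show ?thesis using assms(3,4)
  proof (induction bs)
    case (Cons b bs)
    have "(\<lambda>b. c b \<odot>\<^sub>a b) \<in> set bs \<rightarrow> carrier (hom_space C X Y)" "c b \<odot>\<^sub>a b \<in> carrier (hom_space C X Y)"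
      using Cons.prems scale_arr_mor[OF o] by (auto simp: d)
    then have "finsum (hom_space C X Y) (\<lambda>b. c b \<odot>\<^sub>a b) (set (b # bs)) =
        c b \<odot>\<^sub>a b \<oplus>\<^sub>a finsum (hom_space C X Y) (\<lambda>b. c b \<odot>\<^sub>a b) (set bs)"
      using Cons.prems by (simp add: d)
    then show ?case using Cons by auto
  qed (simp add: d)
qed

text \<open>
  If \<open>\<phi>\<close> is linear on \<open>W\<close> with values in a finite-dimensional space, it kills a nonzero polynomial, as
  soon as infinitely many degrees occur in \<open>W\<close>: this form survives the induction, where eliminating
  one basis vector with an element of minimal degree loses only that degree.
\<close>

lemma poly_map_kernel:
  fixes \<phi> :: "'k poly \<Rightarrow> 'm"
  assumes o: "X \<in> obj C" "Y \<in> obj C" and "set bs \<subseteq> mor C X Y"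
    and "\<And>p q c. p \<in> W \<Longrightarrow> q \<in> W \<Longrightarrow>
      p + smult c q \<in> W \<and> \<phi> (p + smult c q) = \<phi> p \<oplus>\<^sub>a c \<odot>\<^sub>a \<phi> q"
    and "\<And>p. p \<in> W \<Longrightarrow> \<phi> p \<in> lin_span X Y bs"
    and "infinite (degree ` (W - {0}))"
  shows "\<exists>p \<in> W. p \<noteq> 0 \<and> \<phi> p = zero_arr C X Y"
  using assms(3-)
proof (induction bs arbitrary: W)
  case Nil
  have "W - {0} \<noteq> {}" using Nil(4) by (metis finite.emptyI image_empty)
  then show ?case using Nil(3) by auto
next
  case (Cons b bs)
  let ?L = "lin_span X Y bs"
  define W' where "W' = {p \<in> W. \<phi> p \<in> ?L}"
  have bs: "b \<in> mor C X Y" "set bs \<subseteq> mor C X Y" using Cons.prems(1) by auto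
  have L: "?L \<subseteq> mor C X Y" by (rule lin_span_mor[OF o bs(2)])
  have inf: "infinite (degree ` (W' - {0}))"
  proof (cases "W' = W")
    case False
    then have "\<exists>p. p \<in> W \<and> \<phi> p \<notin> ?L" by (auto simp: W'_def)
    then obtain p0 where p0: "p0 \<in> W" "\<phi> p0 \<notin> ?L"
      and mn: "\<And>q. q \<in> W \<and> \<phi> q \<notin> ?L \<Longrightarrow> degree p0 \<le> degree q"
      using ex_has_least_nat[of "\<lambda>p. p \<in> W \<and> \<phi> p \<notin> ?L" _ degree] by metis
    obtain c0 y where y: "\<phi> p0 = c0 \<odot>\<^sub>a b \<oplus>\<^sub>a y" "y \<in> ?L" using Cons.prems(3)[OF p0(1)] by auto
    have "c0 \<noteq> 0"
    proof
      assume "c0 = 0"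
      then have "\<phi> p0 = y" using y L zero_scale_mor[OF o bs(1)] add_zero_arr[OF o] by auto
      then show False using y p0 by simp
    qed
    have "degree q \<in> insert (degree p0) (degree ` (W' - {0}))" if q: "q \<in> W" "q \<noteq> 0" for q
    proof (cases "\<phi> q \<in> ?L \<or> degree q = degree p0")
      case True
      then show ?thesis using q by (auto simp: W'_def)
    next
      case False
      then have lt: "degree p0 < degree q" using mn[of q] q(1) by auto
      obtain c x where x: "\<phi> q = c \<odot>\<^sub>a b \<oplus>\<^sub>a x" "x \<in> ?L" using Cons.prems(3)[OF q(1)] by auto
      \<comment> \<open>This multiple cancels the coefficient of \<open>b\<close> in
        \<open>\<phi> q\<close>. The strict inequality \<open>degree p0 < degree q\<close> keeps the
        degree of \<open>q\<close> and ensures that the corrected polynomial is nonzero.\<close>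
      let ?t = "- c / c0"
      let ?q = "q + smult ?t p0"
      have xm: "x \<in> mor C X Y" and ym: "y \<in> mor C X Y" using x(2) y(2) L by auto
      have xy: "x \<oplus>\<^sub>a ?t \<odot>\<^sub>a y \<in> ?L" by (rule lin_span_comb[OF o bs(2) x(2) y(2)])
      have "\<phi> ?q = (c + ?t * c0) \<odot>\<^sub>a b \<oplus>\<^sub>a (x \<oplus>\<^sub>a ?t \<odot>\<^sub>a y)"
        using Cons.prems(2)[OF q(1) p0(1), of ?t] lin_comb_Cons[OF o bs(1) xm ym, of c ?t c0]
        unfolding x(1) y(1) by simp
      also have "\<dots> = x \<oplus>\<^sub>a ?t \<odot>\<^sub>a y"
        using \<open>c0 \<noteq> 0\<close> zero_scale_mor[OF o bs(1)] add_zero_arr[OF o] xy L by auto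
      finally have "?q \<in> W'"
        using Cons.prems(2)[OF q(1) p0(1), of ?t] xy unfolding W'_def by simp
      moreover have "degree ?q = degree q"
        using lt by (intro degree_add_eq_left) (use degree_smult_le le_less_trans in blast)
      moreover from this lt have "?q \<noteq> 0" by auto
      ultimately have "degree q \<in> degree ` (W' - {0})" by (intro image_eqI[of _ _ ?q]) auto
      then show ?thesis by simp
    qed
    then have "degree ` (W - {0}) \<subseteq> insert (degree p0) (degree ` (W' - {0}))" by blast
    then show ?thesis using Cons.prems(4) by (meson finite_insert finite_subset)
  qed (use Cons.prems in simp)
  have closed: "p + smult c q \<in> W' \<and> \<phi> (p + smult c q) = \<phi> p \<oplus>\<^sub>a c \<odot>\<^sub>a \<phi> q"
    if "p \<in> W'" "q \<in> W'" for p q c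
    using that Cons.prems(2) lin_span_comb[OF o bs(2)] by (auto simp: W'_def)
  have "\<exists>p \<in> W'. p \<noteq> 0 \<and> \<phi> p = zero_arr C X Y"
    using inf by (rule Cons.IH[OF bs(2) closed, rotated -1]) (simp_all add: W'_def)
  then show ?case by (auto simp: W'_def)
qed

text \<open>Evaluation of the polynomial \<open>p\<close> at the endomorphism \<open>f\<close>, in
  Horner form.\<close>

definition poly_arr :: "'o \<Rightarrow> 'm \<Rightarrow> 'k poly \<Rightarrow> 'm" where
  "poly_arr X f p = fold_coeffs (\<lambda>a r. a \<odot>\<^sub>a ident C X \<oplus>\<^sub>a f \<cdot> r) p (zero_arr C X X)"

lemma poly_arr_0 [simp]: "poly_arr X f 0 = zero_arr C X X"
  by (simp add: poly_arr_def)

lemma poly_arr_pCons: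
  assumes "f \<in> mor C X X"
  shows "poly_arr X f (pCons a p) = a \<odot>\<^sub>a ident C X \<oplus>\<^sub>a f \<cdot> poly_arr X f p"
proof (cases "a = 0 \<and> p = 0")
  case True
  have o: "X \<in> obj C" using mor_obj[OF assms] by simp
  then show ?thesis using True assms add_arr_zero[OF o o zero_arr_mor[OF o o]]
    by (simp add: mor_iff)
qed (auto simp: poly_arr_def fold_coeffs_def cCons_def coeffs_pCons_eq_cCons)

lemma poly_arr_mor:
  assumes "f \<in> mor C X X"
  shows "poly_arr X f p \<in> mor C X X"
  using mor_obj[OF assms] assms
  by (induction p) (auto simp: poly_arr_pCons intro!: add_arr_mor scale_arr_mor zero_arr_mor ident_mor comp_mor)

lemma poly_arr_comb:
  assumes f: "f \<in> mor C X X"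
  shows "poly_arr X f (p + smult c q) = poly_arr X f p \<oplus>\<^sub>a c \<odot>\<^sub>a poly_arr X f q"
proof (induction p q rule: poly_induct2)
  case 0
  have o: "X \<in> obj C" using mor_obj[OF assms] by simp
  then show ?case using scale_zero_arr[OF o o] add_arr_zero[OF o o zero_arr_mor[OF o o]] by simp
next
  case (pCons a p b q)
  have o: "X \<in> obj C" using mor_obj[OF assms] by simp
  note m = poly_arr_mor[OF f, of p] poly_arr_mor[OF f, of q]
  have "f \<cdot> poly_arr X f (p + smult c q) = f \<cdot> poly_arr X f p \<oplus>\<^sub>a c \<odot>\<^sub>a (f \<cdot> poly_arr X f q)"
    using pCons.IH comp_add_right[OF m(1) scale_arr_mor[OF o o m(2)] f] comp_scale_right[OF m(2) f] by simp
  then show ?case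
    using lin_comb_Cons[OF o o ident_mor[OF o] comp_mor[OF m(1) f] comp_mor[OF m(2) f]]
    by (simp add: poly_arr_pCons[OF f])
qed

text \<open>Multiplicativity of evaluation in the one case that occurs: roots are split off one at a
  time.\<close>

lemma poly_arr_linear_factor:
  assumes f: "f \<in> mor C X X"
  shows "poly_arr X f ([:- x, 1:] * q) = (f \<ominus>\<^sub>a x \<odot>\<^sub>a ident C X) \<cdot> poly_arr X f q"
proof -
  have o: "X \<in> obj C" using mor_obj[OF assms] by simp
  note m = poly_arr_mor[OF f, of q, unfolded mor_iff] f[unfolded mor_iff]
  have "[:- x, 1:] * q = pCons 0 q + smult (- x) q" by simp
  then have "poly_arr X f ([:- x, 1:] * q) =
      (zero_arr C X X \<oplus>\<^sub>a f \<cdot> poly_arr X f q) \<oplus>\<^sub>a (- x) \<odot>\<^sub>a poly_arr X f q"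
    using poly_arr_comb[OF f, of "pCons 0 q" "- x" q] poly_arr_pCons[OF f, of 0 q] o by simp
  also have "\<dots> = f \<cdot> poly_arr X f q \<oplus>\<^sub>a (- x) \<odot>\<^sub>a poly_arr X f q"
    using add_zero_arr[OF o o, of "f \<cdot> poly_arr X f q"] m by (simp add: mor_iff)
  also have "\<dots> = (f \<ominus>\<^sub>a x \<odot>\<^sub>a ident C X) \<cdot> poly_arr X f q"
    using m o by (simp add: comp_minus_simps) (simp add: minus_arr_def)
  finally show ?thesis .
qed

end

context fusion_category
begin

text \<open>Evaluation at \<open>f\<close> maps polynomials into a finite-dimensional space, so a
  nonzero \<open>p\<close> kills \<open>f\<close>. At a root \<open>x\<close> of \<open>p\<close>,
  either \<open>f - x\<close> is 0 and \<open>f\<close> is the scalar \<open>x\<close>, or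
  \<open>f - x\<close> is invertible by Schur's lemma and can be cancelled, leaving a polynomial of
  smaller degree.\<close>

lemma schur_scalar:
  assumes N: "simple_obj C N" and f: "f \<in> mor C N N"
  shows "\<exists>c. f = c \<odot>\<^sub>a ident C N"
proof -
  have o: "N \<in> obj C" using simple_objD[OF N] by simp
  obtain B where B: "finite B" "B \<subseteq> mor C N N"
    "\<forall>f \<in> mor C N N. \<exists>c. f = finsum (hom_space C N N) (\<lambda>b. c b \<odot>\<^sub>a b) B"
    using hom_finite_dim[OF o o] by blast
  obtain bs where bs: "set bs = B" "distinct bs" using finite_distinct_list[OF B(1)] by blast
  \<comment> \<open>Monomials realise every degree, as \<open>poly_map_kernel\<close> demands
    infinitely many.\<close>
  have "n \<in> degree ` (UNIV - {0 :: 'k poly})" for n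
    by (rule image_eqI[of _ _ "monom 1 n"]) (simp_all add: degree_monom_eq)
  then have "infinite (degree ` (UNIV - {0 :: 'k poly}))"
    by (metis UNIV_eq_I infinite_UNIV_nat)
  moreover have "poly_arr N f p \<in> lin_span N N bs" for p
  proof -
    obtain c where "poly_arr N f p = finsum (hom_space C N N) (\<lambda>b. c b \<odot>\<^sub>a b) B"
      using B(3) poly_arr_mor[OF f] by blast
    then show ?thesis using finsum_in_lin_span[OF o o bs(2)] B(2) bs(1) by simp
  qed
  ultimately have "\<exists>p \<in> UNIV. p \<noteq> 0 \<and> poly_arr N f p = zero_arr C N N"
    using bs B(2) poly_arr_comb[OF f] by (intro poly_map_kernel[OF o o, of bs]) auto
  then obtain p where "p \<noteq> 0" "poly_arr N f p = zero_arr C N N" by auto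
  then show ?thesis
  proof (induction "degree p" arbitrary: p rule: less_induct)
    case less
    show ?case
    proof (cases "degree p = 0")
      case True
      then obtain a where a: "p = [:a:]" using degree_eq_zeroE by blast
      \<comment> \<open>The constant case is contradictory: a nonzero scalar multiple of the
        identity of a simple object is nonzero.\<close>
      have "a \<odot>\<^sub>a ident C N = zero_arr C N N"
        using less.prems(2) f o add_arr_zero[OF o o, of "a \<odot>\<^sub>a ident C N"]
        by (simp add: a poly_arr_pCons mor_iff)
      then have "(1 / a) \<odot>\<^sub>a (a \<odot>\<^sub>a ident C N) = zero_arr C N N" using scale_zero_arr[OF o o] by simp
      then show ?thesis using simple_objD(3)[OF N] less.prems(1) a o by simp
    next
      case False
      then obtain x where "poly p x = 0" using alg_closed_imp_poly_has_root by blast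
      then obtain q where q: "p = [:- x, 1:] * q" by (metis poly_eq_0_iff_dvd dvd_def)
      have q0: "q \<noteq> 0" using less.prems(1) q by auto
      then have dq: "degree q < degree p"
        using q degree_mult_eq[of "[:- x, 1:]" q] by simp
      let ?g = "f \<ominus>\<^sub>a x \<odot>\<^sub>a ident C N"
      have g: "?g \<in> mor C N N" using f o by (auto simp: mor_iff)
      have e: "?g \<cdot> poly_arr N f q = zero_arr C N N"
        using less.prems(2) poly_arr_linear_factor[OF f] q by simp
      show ?thesis
      proof (cases "?g = zero_arr C N N")
        case True
        then show ?thesis using minus_eq_zero_iff[of f "x \<odot>\<^sub>a ident C N"] f o by (auto simp: mor_iff)
      next
        case False
        then obtain h where h: "h \<in> mor C N N" "h \<cdot> ?g = ident C N"
          using schur_iso[OF N N g] g by (metis iso_arrE)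
        have "poly_arr N f q = (h \<cdot> ?g) \<cdot> poly_arr N f q" using h(2) poly_arr_mor[OF f] by (simp add: mor_iff)
        also have "\<dots> = zero_arr C N N"
          using comp_assoc[OF poly_arr_mor[OF f] g h(1)] e h(1) o by (simp add: mor_iff)
        finally show ?thesis using less.hyps[OF dq q0] by simp
      qed
    qed
  qed
qed

text \<open>
  Steinitz exchange. In the induction step the kernel of \<open>p j\<close> replaces \<open>P\<close>; one of the \<open>g q\<close> is used to
  correct the others so that they factor through this kernel.
\<close>

lemma simple_exchange:
  assumes "finite J" "finite Q"
    and "\<And>j. j \<in> J \<Longrightarrow> simple_obj C (T j) \<and> p j \<in> mor C P (T j)"
    and "\<And>A h. h \<in> mor C A P \<Longrightarrow> (\<And>j. j \<in> J \<Longrightarrow> p j \<cdot> h = zero_arr C A (T j)) \<Longrightarrow> h = zero_arr C A P"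
    and "\<And>q. q \<in> Q \<Longrightarrow> simple_obj C (Y q) \<and> g q \<in> mor C (Y q) P \<and> r q \<in> mor C P (Y q)
      \<and> r q \<cdot> g q = ident C (Y q)"
    and "\<And>q q'. q \<in> Q \<Longrightarrow> q' \<in> Q \<Longrightarrow> q \<noteq> q' \<Longrightarrow> r q \<cdot> g q' = zero_arr C (Y q') (Y q)"
  shows "card Q \<le> card J"
  using assms
proof (induction J arbitrary: P Q p g r rule: finite_induct)
  case empty
  have False if q: "q \<in> Q" for q
  proof -
    note m = empty.prems(4)[OF q]
    then have a: "g q \<in> mor C (Y q) P" "r q \<in> mor C P (Y q)" "r q \<cdot> g q = ident C (Y q)"
      "simple_obj C (Y q)" by auto
    have "g q = zero_arr C (Y q) P" by (rule empty.prems(3)[OF a(1)]) simp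
    then have "r q \<cdot> g q = zero_arr C (Y q) (Y q)" using a(2) simple_objD(1)[OF a(4)] by (simp add: mor_iff)
    then show False using simple_objD(3)[OF a(4)] a(3) by simp
  qed
  then show ?case by (cases "Q = {}") auto
next
  case (insert j J)
  let ?\<pi> = "p j"
  have \<pi>: "simple_obj C (T j)" "?\<pi> \<in> mor C P (T j)" using insert.prems(2) by auto
  note m = insert.prems(4)
  \<comment> \<open>At most one index is given up. The remaining \<open>g' q\<close> are killed by
    \<open>?\<pi>\<close>, hence factor through its kernel, and they pair with the
    \<open>r q'\<close> as the \<open>g q\<close> did.\<close>
  have "\<exists>Q0 g'. Q0 \<subseteq> Q \<and> card Q \<le> card Q0 + 1 \<and> (\<forall>q \<in> Q0. g' q \<in> mor C (Y q) P \<and>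
      ?\<pi> \<cdot> g' q = zero_arr C (Y q) (T j) \<and> (\<forall>q' \<in> Q0. r q' \<cdot> g' q = r q' \<cdot> g q))"
  proof (cases "\<forall>q \<in> Q. ?\<pi> \<cdot> g q = zero_arr C (Y q) (T j)")
    case True
    then show ?thesis using m by (intro exI[of _ Q] exI[of _ g]) auto
  next
    case False
    then obtain q0 where q0: "q0 \<in> Q" "?\<pi> \<cdot> g q0 \<noteq> zero_arr C (Y q0) (T j)" by blast
    have \<phi>: "?\<pi> \<cdot> g q0 \<in> mor C (Y q0) (T j)" using m[OF q0(1)] \<pi>(2) comp_mor by blast
    then obtain \<psi> where \<psi>: "\<psi> \<in> mor C (T j) (Y q0)" "(?\<pi> \<cdot> g q0) \<cdot> \<psi> = ident C (T j)"
      using schur_iso[OF _ \<pi>(1) \<phi> q0(2)] m[OF q0(1)] by (metis iso_arrE)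
    \<comment> \<open>Removes the part of \<open>g q\<close> that \<open>?\<pi>\<close> sees: since
      \<open>\<psi>\<close> is inverse to \<open>?\<pi> \<cdot> g q0\<close>, the difference is
      killed by \<open>?\<pi>\<close>. The pairing with \<open>r q'\<close> is unaffected because
      \<open>r q' \<cdot> g q0\<close> vanishes for \<open>q'\<close> other than
      \<open>q0\<close>.\<close>
    define g' where "g' = (\<lambda>q. g q \<ominus>\<^sub>a g q0 \<cdot> (\<psi> \<cdot> (?\<pi> \<cdot> g q)))"
    have "g' q \<in> mor C (Y q) P \<and> ?\<pi> \<cdot> g' q = zero_arr C (Y q) (T j) \<and>
        (\<forall>q' \<in> Q - {q0}. r q' \<cdot> g' q = r q' \<cdot> g q)" if q: "q \<in> Q - {q0}" for q
    proof -
      have qQ: "q \<in> Q" using q by simp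
      note a = m[OF qQ, unfolded mor_iff] m[OF q0(1), unfolded mor_iff] \<pi>(2)[unfolded mor_iff]
        \<psi>(1)[unfolded mor_iff]
      have "?\<pi> \<cdot> (g q0 \<cdot> (\<psi> \<cdot> (?\<pi> \<cdot> g q))) = ((?\<pi> \<cdot> g q0) \<cdot> \<psi>) \<cdot> (?\<pi> \<cdot> g q)"
        using a by (simp add: comp_assoc_arr)
      also have "\<dots> = ?\<pi> \<cdot> g q" using a \<psi>(2) by simp
      finally have "?\<pi> \<cdot> g' q = zero_arr C (Y q) (T j)"
        using a by (simp add: g'_def comp_minus_simps)
      moreover have "r q' \<cdot> g' q = r q' \<cdot> g q" if q': "q' \<in> Q - {q0}" for q'
      proof -
        have q'Q: "q' \<in> Q" using q' by simp
        note b = a m[OF q'Q, unfolded mor_iff]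
        have "r q' \<cdot> (g q0 \<cdot> (\<psi> \<cdot> (?\<pi> \<cdot> g q))) = (r q' \<cdot> g q0) \<cdot> (\<psi> \<cdot> (?\<pi> \<cdot> g q))"
          using b comp_assoc_arr[of "\<psi> \<cdot> (?\<pi> \<cdot> g q)" "g q0" "r q'"] by simp
        also have "r q' \<cdot> g q0 = zero_arr C (Y q0) (Y q')" using insert.prems(5) q' q0 by auto
        finally have "r q' \<cdot> (g q0 \<cdot> (\<psi> \<cdot> (?\<pi> \<cdot> g q))) = zero_arr C (Y q) (Y q')"
          using b simple_objD(1) by auto
        then show ?thesis using b by (simp add: g'_def comp_minus_simps)
      qed
      moreover have "g' q \<in> mor C (Y q) P" using a by (simp add: g'_def mor_iff)
      ultimately show ?thesis by blast
    qed
    moreover have "card Q \<le> card (Q - {q0}) + 1" using q0(1) insert.prems(1) by (simp add: card_Diff_singleton)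
    ultimately show ?thesis by (intro exI[of _ "Q - {q0}"] exI[of _ g']) auto
  qed
  then obtain Q0 g' where Q0: "Q0 \<subseteq> Q" "card Q \<le> card Q0 + 1"
    and g': "\<And>q. q \<in> Q0 \<Longrightarrow> g' q \<in> mor C (Y q) P"
      "\<And>q. q \<in> Q0 \<Longrightarrow> ?\<pi> \<cdot> g' q = zero_arr C (Y q) (T j)"
      "\<And>q q'. q \<in> Q0 \<Longrightarrow> q' \<in> Q0 \<Longrightarrow> r q' \<cdot> g' q = r q' \<cdot> g q" by metis
  obtain K k where k: "k \<in> mor C K P" "?\<pi> \<cdot> k = zero_arr C K (T j)"
    "\<And>A g h. g \<in> mor C A K \<Longrightarrow> h \<in> mor C A K \<Longrightarrow> k \<cdot> g = k \<cdot> h \<Longrightarrow> g = h"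
    "\<And>A h. h \<in> mor C A P \<Longrightarrow> ?\<pi> \<cdot> h = zero_arr C A (T j) \<Longrightarrow> \<exists>u \<in> mor C A K. k \<cdot> u = h"
    using kernelE[OF \<pi>(2)] by metis
  have "\<forall>q \<in> Q0. \<exists>u. u \<in> mor C (Y q) K \<and> k \<cdot> u = g' q" using k(4) g' by blast
  then obtain u where u: "\<And>q. q \<in> Q0 \<Longrightarrow> u q \<in> mor C (Y q) K \<and> k \<cdot> u q = g' q" by metis
  have r: "(r q \<cdot> k) \<cdot> u q' = r q \<cdot> g q'" if "q \<in> Q0" "q' \<in> Q0" for q q'
    using that u[of q'] g'(3)[of q' q] m[of q] k(1) Q0(1) comp_assoc_arr[of "u q'" k "r q"]
    by (auto simp: mor_iff)
  have "card Q0 \<le> card J"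
  proof (rule insert.IH[of Q0 "\<lambda>i. p i \<cdot> k" K u "\<lambda>q. r q \<cdot> k"])
    show "finite Q0" using Q0(1) insert.prems(1) by (rule finite_subset)
    show "simple_obj C (T i) \<and> p i \<cdot> k \<in> mor C K (T i)" if "i \<in> J" for i
      using insert.prems(2)[of i] that k(1) comp_mor by auto
    show "simple_obj C (Y q) \<and> u q \<in> mor C (Y q) K \<and> r q \<cdot> k \<in> mor C K (Y q)
        \<and> r q \<cdot> k \<cdot> u q = ident C (Y q)" if "q \<in> Q0" for q
      using m[of q] that Q0(1) u r comp_mor[OF k(1)] by auto
    show "r q \<cdot> k \<cdot> u q' = zero_arr C (Y q') (Y q)" if "q \<in> Q0" "q' \<in> Q0" "q \<noteq> q'" for q q'
      using r[OF that(1,2)] insert.prems(5)[of q q'] that Q0(1) by auto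
    fix A h assume h: "h \<in> mor C A K" "\<And>i. i \<in> J \<Longrightarrow> p i \<cdot> k \<cdot> h = zero_arr C A (T i)"
    have o: "A \<in> obj C" "K \<in> obj C" "P \<in> obj C" using mor_obj h(1) k(1) by auto
    have kh: "k \<cdot> h \<in> mor C A P" using comp_mor h(1) k(1) by blast
    \<comment> \<open>On the kernel the projections indexed by \<open>J\<close> alone are jointly
      monic, because \<open>p j\<close> already vanishes there.\<close>
    have "k \<cdot> h = zero_arr C A P"
    proof (rule insert.prems(3)[OF kh])
      fix i assume i: "i \<in> insert j J"
      have e: "p i \<cdot> (k \<cdot> h) = (p i \<cdot> k) \<cdot> h" using insert.prems(2)[OF i] comp_assoc h(1) k(1) by metis
      show "p i \<cdot> (k \<cdot> h) = zero_arr C A (T i)"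
      proof (cases "i = j")
        case True
        then show ?thesis using e k(2) h(1) simple_objD(1)[OF \<pi>(1)] by (auto simp: mor_iff)
      qed (use i e h in simp)
    qed
    then show "h = zero_arr C A K" using k(3)[OF h(1) zero_arr_mor] k(1) o by (auto simp: mor_iff)
  qed
  then show ?case using Q0(2) insert.hyps by simp
qed

end

section \<open>Duality in linear monoidal categories\<close>

context linear_monoidal_category
begin

abbreviation unit_object ("\<one>\<^sub>o") where "\<one>\<^sub>o \<equiv> unit_obj C"

lemma unit_obj_simp [simp]: "\<one>\<^sub>o \<in> obj C"
  by (rule unit_in_obj)

lemma tensor_obj_simp [simp]: "X \<in> obj C \<Longrightarrow> Y \<in> obj C \<Longrightarrow> X \<otimes>\<^sub>o Y \<in> obj C"
  by (rule tensor_in_obj)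

lemma tensor_arr_simps [simp]:
  assumes "f \<in> arr C" "g \<in> arr C"
  shows "f \<otimes>\<^sub>a g \<in> arr C" "dom_of C (f \<otimes>\<^sub>a g) = dom_of C f \<otimes>\<^sub>o dom_of C g"
    "cod_of C (f \<otimes>\<^sub>a g) = cod_of C f \<otimes>\<^sub>o cod_of C g"
  using tensor_mor[OF assms[THEN mor_self]] by (auto simp: mor_iff)

lemma associator_simps [simp]:
  assumes "X \<in> obj C" "Y \<in> obj C" "Z \<in> obj C"
  shows "associator C X Y Z \<in> arr C" "dom_of C (associator C X Y Z) = (X \<otimes>\<^sub>o Y) \<otimes>\<^sub>o Z"
    "cod_of C (associator C X Y Z) = X \<otimes>\<^sub>o (Y \<otimes>\<^sub>o Z)"
  using associator_mor[OF assms] by (auto simp: mor_iff)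

lemma unitor_simps [simp]:
  assumes "X \<in> obj C"
  shows "left_unitor C X \<in> arr C" "dom_of C (left_unitor C X) = \<one>\<^sub>o \<otimes>\<^sub>o X"
    "cod_of C (left_unitor C X) = X"
    "right_unitor C X \<in> arr C" "dom_of C (right_unitor C X) = X \<otimes>\<^sub>o \<one>\<^sub>o"
    "cod_of C (right_unitor C X) = X"
  using left_unitor_mor[OF assms] right_unitor_mor[OF assms] by (auto simp: mor_iff)

lemma tensor_comp_arr:
  assumes "f \<in> arr C" "g \<in> arr C" "f' \<in> arr C" "g' \<in> arr C"
    "cod_of C f = dom_of C g" "cod_of C f' = dom_of C g'"
  shows "(g \<otimes>\<^sub>a g') \<cdot> (f \<otimes>\<^sub>a f') = (g \<cdot> f) \<otimes>\<^sub>a (g' \<cdot> f')"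
  using tensor_comp[of f _ _ g _ f' _ _ g'] assms by (auto simp: mor_iff)

lemma tensor_zero [simp]:
  assumes "f \<in> arr C" "X \<in> obj C" "Y \<in> obj C"
  shows "zero_arr C X Y \<otimes>\<^sub>a f = zero_arr C (X \<otimes>\<^sub>o dom_of C f) (Y \<otimes>\<^sub>o cod_of C f)"
    "f \<otimes>\<^sub>a zero_arr C X Y = zero_arr C (dom_of C f \<otimes>\<^sub>o X) (cod_of C f \<otimes>\<^sub>o Y)"
  using tensor_scale_left[OF zero_arr_mor[OF assms(2,3)] mor_self[OF assms(1)], of 0]
    tensor_scale_right[OF mor_self[OF assms(1)] zero_arr_mor[OF assms(2,3)], of 0] assms by auto

lemma tensor_minus:
  assumes "f \<in> arr C" "f' \<in> arr C" "dom_of C f' = dom_of C f" "cod_of C f' = cod_of C f"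
    and "g \<in> arr C"
  shows "(f \<ominus>\<^sub>a f') \<otimes>\<^sub>a g = (f \<otimes>\<^sub>a g) \<ominus>\<^sub>a (f' \<otimes>\<^sub>a g)"
    "g \<otimes>\<^sub>a (f \<ominus>\<^sub>a f') = (g \<otimes>\<^sub>a f) \<ominus>\<^sub>a (g \<otimes>\<^sub>a f')"
proof -
  let ?X = "dom_of C f" and ?Y = "cod_of C f"
  have m: "f \<in> mor C ?X ?Y" "f' \<in> mor C ?X ?Y" "(-1) \<odot>\<^sub>a f' \<in> mor C ?X ?Y"
    using assms by (auto simp: mor_iff)
  note g = mor_self[OF assms(5)]
  show "(f \<ominus>\<^sub>a f') \<otimes>\<^sub>a g = (f \<otimes>\<^sub>a g) \<ominus>\<^sub>a (f' \<otimes>\<^sub>a g)"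
    unfolding minus_arr_def using tensor_add_left[OF m(1,3) g] tensor_scale_left[OF m(2) g] by simp
  show "g \<otimes>\<^sub>a (f \<ominus>\<^sub>a f') = (g \<otimes>\<^sub>a f) \<ominus>\<^sub>a (g \<otimes>\<^sub>a f')"
    unfolding minus_arr_def using tensor_add_right[OF g m(1,3)] tensor_scale_right[OF g m(2)] by simp
qed

text \<open>Composites are kept nested to the right, where a known product
  \<open>x \<cdot> y\<close> is not a subterm; this rule applies it in front of a tail
  \<open>k\<close>.\<close>

lemma comp_rewrite:
  assumes "x \<cdot> y = z" "k \<in> arr C" "y \<in> arr C" "x \<in> arr C" "cod_of C k = dom_of C y"
    "cod_of C y = dom_of C x"
  shows "x \<cdot> (y \<cdot> k) = z \<cdot> k"
  using comp_assoc_arr[OF assms(2-6)] assms(1) by simp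

lemma associator_inverse:
  assumes "X \<in> obj C" "Y \<in> obj C" "Z \<in> obj C"
  obtains b where "b \<in> arr C" "dom_of C b = X \<otimes>\<^sub>o (Y \<otimes>\<^sub>o Z)" "cod_of C b = (X \<otimes>\<^sub>o Y) \<otimes>\<^sub>o Z"
    "b \<cdot> associator C X Y Z = ident C ((X \<otimes>\<^sub>o Y) \<otimes>\<^sub>o Z)"
    "associator C X Y Z \<cdot> b = ident C (X \<otimes>\<^sub>o (Y \<otimes>\<^sub>o Z))"
  using associator_iso[OF assms] associator_mor[OF assms] by (metis iso_arrE mor_iff)

lemma iso_cancel_zero:
  assumes "iso_arr C f" "f \<in> mor C X Y"
  shows "h \<in> mor C T X \<Longrightarrow> f \<cdot> h = zero_arr C T Y \<Longrightarrow> h = zero_arr C T X"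
    "h \<in> mor C Y T \<Longrightarrow> h \<cdot> f = zero_arr C X T \<Longrightarrow> h = zero_arr C Y T"
proof -
  obtain g where g: "g \<in> mor C Y X" "g \<cdot> f = ident C X" "f \<cdot> g = ident C Y"
    using assms by (metis iso_arrE)
  show "h = zero_arr C T X" if h: "h \<in> mor C T X" "f \<cdot> h = zero_arr C T Y"
  proof -
    have "g \<cdot> (f \<cdot> h) = h" using g(2) h(1) comp_assoc[OF h(1) assms(2) g(1)] by (simp add: mor_iff)
    then show ?thesis using h g(1) mor_obj[OF h(1)] by (auto simp: mor_iff)
  qed
  show "h = zero_arr C Y T" if h: "h \<in> mor C Y T" "h \<cdot> f = zero_arr C X T"
  proof -
    have "(h \<cdot> f) \<cdot> g = h" using g(3) h(1) comp_assoc[OF g(1) assms(2) h(1)] by (simp add: mor_iff)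
    then show ?thesis using h g(1) mor_obj[OF h(1)] by (auto simp: mor_iff)
  qed
qed

lemma tensor_unit_faithful:
  assumes "f \<in> mor C X Y"
  shows "f \<otimes>\<^sub>a ident C \<one>\<^sub>o = zero_arr C (X \<otimes>\<^sub>o \<one>\<^sub>o) (Y \<otimes>\<^sub>o \<one>\<^sub>o) \<Longrightarrow> f = zero_arr C X Y"
    "ident C \<one>\<^sub>o \<otimes>\<^sub>a f = zero_arr C (\<one>\<^sub>o \<otimes>\<^sub>o X) (\<one>\<^sub>o \<otimes>\<^sub>o Y) \<Longrightarrow> f = zero_arr C X Y"
proof -
  note o = mor_obj[OF assms]
  show "f = zero_arr C X Y" if "f \<otimes>\<^sub>a ident C \<one>\<^sub>o = zero_arr C (X \<otimes>\<^sub>o \<one>\<^sub>o) (Y \<otimes>\<^sub>o \<one>\<^sub>o)"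
  proof (rule iso_cancel_zero(2)[OF right_unitor_iso right_unitor_mor assms])
    show "f \<cdot> right_unitor C X = zero_arr C (X \<otimes>\<^sub>o \<one>\<^sub>o) Y"
      using right_unitor_natural[OF assms] that o by simp
  qed (use o in auto)
  show "f = zero_arr C X Y" if "ident C \<one>\<^sub>o \<otimes>\<^sub>a f = zero_arr C (\<one>\<^sub>o \<otimes>\<^sub>o X) (\<one>\<^sub>o \<otimes>\<^sub>o Y)"
  proof (rule iso_cancel_zero(2)[OF left_unitor_iso left_unitor_mor assms])
    show "f \<cdot> left_unitor C X = zero_arr C (\<one>\<^sub>o \<otimes>\<^sub>o X) Y"
      using left_unitor_natural[OF assms] that o by simp
  qed (use o in auto)
qed

text \<open>The witnesses hidden in \<open>left_dual\<close>, with the inverse associator unpacked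
  and both zigzag identities nested to the right so that \<open>comp_rewrite\<close>
  applies.\<close>

definition dual_pair where
  "dual_pair N D ev coev b \<longleftrightarrow> N \<in> obj C \<and> D \<in> obj C \<and>
    ev \<in> mor C (D \<otimes>\<^sub>o N) \<one>\<^sub>o \<and> coev \<in> mor C \<one>\<^sub>o (N \<otimes>\<^sub>o D) \<and>
    b \<in> mor C (D \<otimes>\<^sub>o (N \<otimes>\<^sub>o D)) ((D \<otimes>\<^sub>o N) \<otimes>\<^sub>o D) \<and>
    b \<cdot> associator C D N D = ident C ((D \<otimes>\<^sub>o N) \<otimes>\<^sub>o D) \<and>
    associator C D N D \<cdot> b = ident C (D \<otimes>\<^sub>o (N \<otimes>\<^sub>o D)) \<and>
    right_unitor C N \<cdot> ((ident C N \<otimes>\<^sub>a ev) \<cdot> (associator C N D N \<cdot> (coev \<otimes>\<^sub>a ident C N)))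
      = left_unitor C N \<and>
    left_unitor C D \<cdot> ((ev \<otimes>\<^sub>a ident C D) \<cdot> (b \<cdot> (ident C D \<otimes>\<^sub>a coev))) = right_unitor C D"

lemma left_dualE:
  assumes "left_dual C N D"
  obtains ev coev b where "dual_pair N D ev coev b"
proof -
  from assms obtain ev coev b where o: "N \<in> obj C" "D \<in> obj C" and
    m: "ev \<in> mor C (D \<otimes>\<^sub>o N) \<one>\<^sub>o" "coev \<in> mor C \<one>\<^sub>o (N \<otimes>\<^sub>o D)"
    "inverse_arrs C (associator C D N D) b"
    and z: "right_unitor C N \<cdot> (ident C N \<otimes>\<^sub>a ev) \<cdot> associator C N D N \<cdot> (coev \<otimes>\<^sub>a ident C N)
      = left_unitor C N"
      "left_unitor C D \<cdot> (ev \<otimes>\<^sub>a ident C D) \<cdot> b \<cdot> (ident C D \<otimes>\<^sub>a coev) = right_unitor C D"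
    unfolding left_dual_def by blast
  have b: "b \<in> mor C (D \<otimes>\<^sub>o (N \<otimes>\<^sub>o D)) ((D \<otimes>\<^sub>o N) \<otimes>\<^sub>o D)"
    "b \<cdot> associator C D N D = ident C ((D \<otimes>\<^sub>o N) \<otimes>\<^sub>o D)"
    "associator C D N D \<cdot> b = ident C (D \<otimes>\<^sub>o (N \<otimes>\<^sub>o D))"
    using m(3) o unfolding inverse_arrs_def by simp_all
  have "dual_pair N D ev coev b"
    unfolding dual_pair_def using o m(1,2) b z by (simp add: mor_iff comp_assoc_arr)
  then show thesis by (rule that)
qed

text \<open>The zigzag identity for \<open>D\<close> recovers \<open>h\<close> from
  \<open>ev \<cdot> (h \<otimes> 1)\<close>: inserting it after \<open>h\<close> and moving
  \<open>h\<close> inward by naturality exposes that composite as an inner factor.\<close>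

lemma ev_detects:
  assumes d: "dual_pair N D ev coev b" and h: "h \<in> mor C B D"
    and 0: "ev \<cdot> (h \<otimes>\<^sub>a ident C N) = zero_arr C (B \<otimes>\<^sub>o N) \<one>\<^sub>o"
  shows "h = zero_arr C B D"
proof -
  note d' = d[unfolded dual_pair_def]
  have o [simp]: "N \<in> obj C" "D \<in> obj C" "B \<in> obj C" using d' mor_obj[OF h] by auto
  have m: "ev \<in> mor C (D \<otimes>\<^sub>o N) \<one>\<^sub>o" "coev \<in> mor C \<one>\<^sub>o (N \<otimes>\<^sub>o D)"
    "b \<in> mor C (D \<otimes>\<^sub>o (N \<otimes>\<^sub>o D)) ((D \<otimes>\<^sub>o N) \<otimes>\<^sub>o D)" using d' by auto
  note [simp] = m[unfolded mor_iff] h[unfolded mor_iff]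
  obtain a' where a': "a' \<in> arr C" "dom_of C a' = B \<otimes>\<^sub>o (N \<otimes>\<^sub>o D)" "cod_of C a' = (B \<otimes>\<^sub>o N) \<otimes>\<^sub>o D"
    "associator C B N D \<cdot> a' = ident C (B \<otimes>\<^sub>o (N \<otimes>\<^sub>o D))"
    using associator_inverse[of B N D] by auto
  note [simp] = a'(1-3)
  \<comment> \<open>The part of the rewritten zigzag that no longer involves \<open>h\<close>:
    coevaluation tensored with \<open>B\<close>, rebracketed.\<close>
  let ?K = "a' \<cdot> (ident C B \<otimes>\<^sub>a coev)"
  have nat: "associator C D N D \<cdot> ((h \<otimes>\<^sub>a ident C N) \<otimes>\<^sub>a ident C D)
      = (h \<otimes>\<^sub>a ident C (N \<otimes>\<^sub>o D)) \<cdot> associator C B N D"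
    using associator_natural[OF h ident_mor[of N] ident_mor[of D]] by (simp add: tensor_ident)
  have "h \<cdot> right_unitor C B = right_unitor C D \<cdot> (h \<otimes>\<^sub>a ident C \<one>\<^sub>o)"
    using right_unitor_natural[OF h] by simp
  also have "\<dots> = left_unitor C D \<cdot> ((ev \<otimes>\<^sub>a ident C D) \<cdot> (b \<cdot> ((ident C D \<otimes>\<^sub>a coev) \<cdot> (h \<otimes>\<^sub>a ident C \<one>\<^sub>o))))"
    using d' by (simp add: comp_assoc_arr flip: d'[THEN conjunct2, THEN conjunct2, THEN conjunct2,
      THEN conjunct2, THEN conjunct2, THEN conjunct2, THEN conjunct2, THEN conjunct2])
  also have "(ident C D \<otimes>\<^sub>a coev) \<cdot> (h \<otimes>\<^sub>a ident C \<one>\<^sub>o) = (h \<otimes>\<^sub>a ident C (N \<otimes>\<^sub>o D)) \<cdot> (ident C B \<otimes>\<^sub>a coev)"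
    by (simp add: tensor_comp_arr)
  also have "\<dots> = (h \<otimes>\<^sub>a ident C (N \<otimes>\<^sub>o D)) \<cdot> (associator C B N D \<cdot> ?K)"
    using comp_rewrite[OF a'(4), of "ident C B \<otimes>\<^sub>a coev"] by simp
  also have "\<dots> = associator C D N D \<cdot> (((h \<otimes>\<^sub>a ident C N) \<otimes>\<^sub>a ident C D) \<cdot> ?K)"
    using comp_rewrite[OF nat, of ?K] by (simp add: comp_assoc_arr)
  also have "b \<cdot> \<dots> = ((h \<otimes>\<^sub>a ident C N) \<otimes>\<^sub>a ident C D) \<cdot> ?K"
    using comp_rewrite[of b "associator C D N D", of _ "((h \<otimes>\<^sub>a ident C N) \<otimes>\<^sub>a ident C D) \<cdot> ?K"] d' by simp
  also have "(ev \<otimes>\<^sub>a ident C D) \<cdot> \<dots> = ((ev \<cdot> (h \<otimes>\<^sub>a ident C N)) \<otimes>\<^sub>a ident C D) \<cdot> ?K"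
    by (rule comp_rewrite) (simp_all add: tensor_comp_arr)
  also have "\<dots> = zero_arr C (B \<otimes>\<^sub>o \<one>\<^sub>o) (\<one>\<^sub>o \<otimes>\<^sub>o D)" using 0 by simp
  finally have "h \<cdot> right_unitor C B = zero_arr C (B \<otimes>\<^sub>o \<one>\<^sub>o) D" by simp
  then show ?thesis
    using iso_cancel_zero(2)[OF right_unitor_iso right_unitor_mor h] by simp
qed

text \<open>Mirror argument with the zigzag identity for \<open>N\<close>: moving \<open>p\<close>
  inward exposes \<open>(p \<otimes> 1) \<cdot> coev\<close> as a factor.\<close>

lemma coev_detects:
  assumes d: "dual_pair N D ev coev b" and p: "p \<in> mor C N B"
    and 0: "(p \<otimes>\<^sub>a ident C D) \<cdot> coev = zero_arr C \<one>\<^sub>o (B \<otimes>\<^sub>o D)"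
  shows "p = zero_arr C N B"
proof -
  note d' = d[unfolded dual_pair_def]
  have o [simp]: "N \<in> obj C" "D \<in> obj C" "B \<in> obj C" using d' mor_obj[OF p] by auto
  have m: "ev \<in> mor C (D \<otimes>\<^sub>o N) \<one>\<^sub>o" "coev \<in> mor C \<one>\<^sub>o (N \<otimes>\<^sub>o D)" using d' by auto
  note [simp] = m[unfolded mor_iff] p[unfolded mor_iff]
  have nat: "associator C B D N \<cdot> ((p \<otimes>\<^sub>a ident C D) \<otimes>\<^sub>a ident C N)
      = (p \<otimes>\<^sub>a ident C (D \<otimes>\<^sub>o N)) \<cdot> associator C N D N"
    using associator_natural[OF p ident_mor[of D] ident_mor[of N]] by (simp add: tensor_ident)
  have nr: "p \<cdot> right_unitor C N = right_unitor C B \<cdot> (p \<otimes>\<^sub>a ident C \<one>\<^sub>o)"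
    using right_unitor_natural[OF p] by simp
  let ?K = "associator C N D N \<cdot> (coev \<otimes>\<^sub>a ident C N)"
  have "p \<cdot> left_unitor C N = p \<cdot> (right_unitor C N \<cdot> ((ident C N \<otimes>\<^sub>a ev) \<cdot> ?K))"
    using d' by simp
  also have "\<dots> = right_unitor C B \<cdot> ((p \<otimes>\<^sub>a ident C \<one>\<^sub>o) \<cdot> ((ident C N \<otimes>\<^sub>a ev) \<cdot> ?K))"
    using comp_rewrite[OF nr, of "(ident C N \<otimes>\<^sub>a ev) \<cdot> ?K"] by (simp add: comp_assoc_arr)
  also have "(p \<otimes>\<^sub>a ident C \<one>\<^sub>o) \<cdot> ((ident C N \<otimes>\<^sub>a ev) \<cdot> ?K)
      = ((ident C B \<otimes>\<^sub>a ev) \<cdot> (p \<otimes>\<^sub>a ident C (D \<otimes>\<^sub>o N))) \<cdot> ?K"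
    by (rule comp_rewrite) (simp_all add: tensor_comp_arr)
  also have "\<dots> = (ident C B \<otimes>\<^sub>a ev) \<cdot> ((p \<otimes>\<^sub>a ident C (D \<otimes>\<^sub>o N)) \<cdot> ?K)"
    by (simp add: comp_assoc_arr)
  also have "(p \<otimes>\<^sub>a ident C (D \<otimes>\<^sub>o N)) \<cdot> ?K
      = associator C B D N \<cdot> (((p \<otimes>\<^sub>a ident C D) \<otimes>\<^sub>a ident C N) \<cdot> (coev \<otimes>\<^sub>a ident C N))"
    using comp_rewrite[OF nat[symmetric], of "coev \<otimes>\<^sub>a ident C N"] by (simp add: comp_assoc_arr)
  also have "((p \<otimes>\<^sub>a ident C D) \<otimes>\<^sub>a ident C N) \<cdot> (coev \<otimes>\<^sub>a ident C N)
      = zero_arr C (\<one>\<^sub>o \<otimes>\<^sub>o N) ((B \<otimes>\<^sub>o D) \<otimes>\<^sub>o N)"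
    using 0 by (simp add: tensor_comp_arr)
  finally have "p \<cdot> left_unitor C N = zero_arr C (\<one>\<^sub>o \<otimes>\<^sub>o N) B" by simp
  then show ?thesis
    using iso_cancel_zero(2)[OF left_unitor_iso left_unitor_mor p] by simp
qed

text \<open>
  The map \<open>Hom(A, B \<otimes> D) \<rightarrow> Hom(A \<otimes> N, B \<otimes> 1)\<close> of the duality adjunction is injective.
\<close>

lemma adjunct_detects:
  assumes d: "dual_pair N D ev coev b" and h: "h \<in> mor C A (B \<otimes>\<^sub>o D)" and B [simp]: "B \<in> obj C"
    and 0: "(ident C B \<otimes>\<^sub>a ev) \<cdot> (associator C B D N \<cdot> (h \<otimes>\<^sub>a ident C N))
      = zero_arr C (A \<otimes>\<^sub>o N) (B \<otimes>\<^sub>o \<one>\<^sub>o)"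
  shows "h = zero_arr C A (B \<otimes>\<^sub>o D)"
proof -
  note d' = d[unfolded dual_pair_def]
  have o [simp]: "N \<in> obj C" "D \<in> obj C" "A \<in> obj C" using d' mor_obj[OF h] by auto
  have m: "ev \<in> mor C (D \<otimes>\<^sub>o N) \<one>\<^sub>o" "coev \<in> mor C \<one>\<^sub>o (N \<otimes>\<^sub>o D)"
    "b \<in> mor C (D \<otimes>\<^sub>o (N \<otimes>\<^sub>o D)) ((D \<otimes>\<^sub>o N) \<otimes>\<^sub>o D)"
    and ba: "b \<cdot> associator C D N D = ident C ((D \<otimes>\<^sub>o N) \<otimes>\<^sub>o D)"
    and z: "right_unitor C D = left_unitor C D \<cdot> ((ev \<otimes>\<^sub>a ident C D) \<cdot> (b \<cdot> (ident C D \<otimes>\<^sub>a coev)))"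
    using d' by auto
  note [simp] = m[unfolded mor_iff] h[unfolded mor_iff]
  let ?i = "ident C"
  obtain a' where a': "a' \<in> arr C" "dom_of C a' = A \<otimes>\<^sub>o (N \<otimes>\<^sub>o D)" "cod_of C a' = (A \<otimes>\<^sub>o N) \<otimes>\<^sub>o D"
    "associator C A N D \<cdot> a' = ident C (A \<otimes>\<^sub>o (N \<otimes>\<^sub>o D))"
    using associator_inverse[of A N D] by auto
  note [simp] = a'(1-3)
  let ?c = "a' \<cdot> (?i A \<otimes>\<^sub>a coev)"
  let ?h = "(h \<otimes>\<^sub>a ?i N) \<otimes>\<^sub>a ?i D"
  have nat1: "associator C B D (N \<otimes>\<^sub>o D) \<cdot> (?i (B \<otimes>\<^sub>o D) \<otimes>\<^sub>a coev)
      = (?i B \<otimes>\<^sub>a (?i D \<otimes>\<^sub>a coev)) \<cdot> associator C B D \<one>\<^sub>o"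
    using associator_natural[OF ident_mor[of B] ident_mor[of D] m(2)] by (simp add: tensor_ident)
  have nat2: "associator C (B \<otimes>\<^sub>o D) N D \<cdot> ?h = (h \<otimes>\<^sub>a ?i (N \<otimes>\<^sub>o D)) \<cdot> associator C A N D"
    using associator_natural[OF h ident_mor[of N] ident_mor[of D]] by (simp add: tensor_ident)
  have nat3: "associator C B \<one>\<^sub>o D \<cdot> ((?i B \<otimes>\<^sub>a ev) \<otimes>\<^sub>a ?i D)
      = (?i B \<otimes>\<^sub>a (ev \<otimes>\<^sub>a ?i D)) \<cdot> associator C B (D \<otimes>\<^sub>o N) D"
    using associator_natural[OF ident_mor[of B] m(1) ident_mor[of D]] by simp
  \<comment> \<open>The pentagon for \<open>B\<close>, \<open>D\<close>, \<open>N\<close>,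
    \<open>D\<close> produces the associator of \<open>D\<close>, \<open>N\<close>, \<open>D\<close>
    tensored with \<open>B\<close>, which the \<open>b\<close> from the zigzag then cancels.\<close>
  have pent: "associator C B D (N \<otimes>\<^sub>o D) \<cdot> associator C (B \<otimes>\<^sub>o D) N D
      = (?i B \<otimes>\<^sub>a associator C D N D) \<cdot> (associator C B (D \<otimes>\<^sub>o N) D \<cdot> (associator C B D N \<otimes>\<^sub>a ?i D))"
    using pentagon[of B D N D] by (simp add: comp_assoc_arr)
  have s1: "(?i (B \<otimes>\<^sub>o D) \<otimes>\<^sub>a coev) \<cdot> (h \<otimes>\<^sub>a ?i \<one>\<^sub>o) = associator C (B \<otimes>\<^sub>o D) N D \<cdot> (?h \<cdot> ?c)"
  proof -
    have "(?i (B \<otimes>\<^sub>o D) \<otimes>\<^sub>a coev) \<cdot> (h \<otimes>\<^sub>a ?i \<one>\<^sub>o) = (h \<otimes>\<^sub>a ?i (N \<otimes>\<^sub>o D)) \<cdot> (?i A \<otimes>\<^sub>a coev)"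
      by (simp add: tensor_comp_arr)
    also have "\<dots> = (h \<otimes>\<^sub>a ?i (N \<otimes>\<^sub>o D)) \<cdot> (associator C A N D \<cdot> ?c)"
      using comp_rewrite[OF a'(4), of "?i A \<otimes>\<^sub>a coev"] by simp
    also have "\<dots> = associator C (B \<otimes>\<^sub>o D) N D \<cdot> (?h \<cdot> ?c)"
      using comp_rewrite[OF nat2, of ?c] by (simp add: comp_assoc_arr)
    finally show ?thesis .
  qed
  have s2: "(?i B \<otimes>\<^sub>a b) \<cdot> (associator C B D (N \<otimes>\<^sub>o D) \<cdot> associator C (B \<otimes>\<^sub>o D) N D)
      = associator C B (D \<otimes>\<^sub>o N) D \<cdot> (associator C B D N \<otimes>\<^sub>a ?i D)"
  proof -
    have "(?i B \<otimes>\<^sub>a b) \<cdot> (?i B \<otimes>\<^sub>a associator C D N D) = ?i (B \<otimes>\<^sub>o ((D \<otimes>\<^sub>o N) \<otimes>\<^sub>o D))"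
      using ba by (simp add: tensor_comp_arr tensor_ident)
    from comp_rewrite[OF this, of "associator C B (D \<otimes>\<^sub>o N) D \<cdot> (associator C B D N \<otimes>\<^sub>a ?i D)"]
    show ?thesis unfolding pent by simp
  qed
  \<comment> \<open>Here the vanishing of the adjunct enters, tensored on the right with
    \<open>D\<close>.\<close>
  have s3: "((?i B \<otimes>\<^sub>a ev) \<otimes>\<^sub>a ?i D) \<cdot> ((associator C B D N \<otimes>\<^sub>a ?i D) \<cdot> ?h)
      = zero_arr C ((A \<otimes>\<^sub>o N) \<otimes>\<^sub>o D) ((B \<otimes>\<^sub>o \<one>\<^sub>o) \<otimes>\<^sub>o D)"
    using 0 by (simp add: tensor_comp_arr)
  have "?i B \<otimes>\<^sub>a right_unitor C D =
      (?i B \<otimes>\<^sub>a left_unitor C D) \<cdot> ((?i B \<otimes>\<^sub>a (ev \<otimes>\<^sub>a ?i D)) \<cdot> ((?i B \<otimes>\<^sub>a b) \<cdot> (?i B \<otimes>\<^sub>a (?i D \<otimes>\<^sub>a coev))))"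
    unfolding z by (simp add: tensor_comp_arr)
  then have "(?i B \<otimes>\<^sub>a right_unitor C D) \<cdot> (associator C B D \<one>\<^sub>o \<cdot> (h \<otimes>\<^sub>a ?i \<one>\<^sub>o)) =
      (?i B \<otimes>\<^sub>a left_unitor C D) \<cdot> ((?i B \<otimes>\<^sub>a (ev \<otimes>\<^sub>a ?i D)) \<cdot> ((?i B \<otimes>\<^sub>a b) \<cdot>
        ((?i B \<otimes>\<^sub>a (?i D \<otimes>\<^sub>a coev)) \<cdot> (associator C B D \<one>\<^sub>o \<cdot> (h \<otimes>\<^sub>a ?i \<one>\<^sub>o)))))"
    by (simp add: comp_assoc_arr)
  also have "(?i B \<otimes>\<^sub>a (?i D \<otimes>\<^sub>a coev)) \<cdot> (associator C B D \<one>\<^sub>o \<cdot> (h \<otimes>\<^sub>a ?i \<one>\<^sub>o))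
      = associator C B D (N \<otimes>\<^sub>o D) \<cdot> (associator C (B \<otimes>\<^sub>o D) N D \<cdot> (?h \<cdot> ?c))"
    using comp_rewrite[OF nat1[symmetric], of "h \<otimes>\<^sub>a ?i \<one>\<^sub>o"] s1 by (simp add: comp_assoc_arr)
  also have "(?i B \<otimes>\<^sub>a b) \<cdot> \<dots> = associator C B (D \<otimes>\<^sub>o N) D \<cdot> ((associator C B D N \<otimes>\<^sub>a ?i D) \<cdot> (?h \<cdot> ?c))"
    using comp_rewrite[OF s2, of "?h \<cdot> ?c"] by (simp add: comp_assoc_arr)
  also have "(?i B \<otimes>\<^sub>a (ev \<otimes>\<^sub>a ?i D)) \<cdot> \<dots>
      = associator C B \<one>\<^sub>o D \<cdot> (((?i B \<otimes>\<^sub>a ev) \<otimes>\<^sub>a ?i D) \<cdot> ((associator C B D N \<otimes>\<^sub>a ?i D) \<cdot> (?h \<cdot> ?c)))"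
    using comp_rewrite[OF nat3[symmetric], of "(associator C B D N \<otimes>\<^sub>a ?i D) \<cdot> (?h \<cdot> ?c)"]
    by (simp add: comp_assoc_arr)
  also have "((?i B \<otimes>\<^sub>a ev) \<otimes>\<^sub>a ?i D) \<cdot> ((associator C B D N \<otimes>\<^sub>a ?i D) \<cdot> (?h \<cdot> ?c))
      = zero_arr C (A \<otimes>\<^sub>o \<one>\<^sub>o) ((B \<otimes>\<^sub>o \<one>\<^sub>o) \<otimes>\<^sub>o D)"
    using comp_rewrite[OF s3, of ?c] by (simp add: comp_assoc_arr)
  finally have k: "(?i B \<otimes>\<^sub>a right_unitor C D) \<cdot> (associator C B D \<one>\<^sub>o \<cdot> (h \<otimes>\<^sub>a ?i \<one>\<^sub>o))
      = zero_arr C (A \<otimes>\<^sub>o \<one>\<^sub>o) (B \<otimes>\<^sub>o D)" by simp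
  obtain r' where r': "r' \<in> mor C D (D \<otimes>\<^sub>o \<one>\<^sub>o)" "r' \<cdot> right_unitor C D = ?i (D \<otimes>\<^sub>o \<one>\<^sub>o)"
    "right_unitor C D \<cdot> r' = ?i D"
    using right_unitor_iso[OF o(2)] right_unitor_mor[OF o(2)] by (metis iso_arrE)
  \<comment> \<open>By \<open>k\<close>, the arrow \<open>h \<otimes> 1\<close> vanishes after two
    isomorphisms; these are stripped in turn, and finally the tensor factor 1.\<close>
  have "iso_arr C (?i B \<otimes>\<^sub>a right_unitor C D)"
    using r' by (intro iso_arrI[of _ "B \<otimes>\<^sub>o (D \<otimes>\<^sub>o \<one>\<^sub>o)" "B \<otimes>\<^sub>o D" "?i B \<otimes>\<^sub>a r'"])
      (auto simp: mor_iff tensor_comp_arr tensor_ident)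
  from iso_cancel_zero(1)[OF this _ _ k]
  have "associator C B D \<one>\<^sub>o \<cdot> (h \<otimes>\<^sub>a ?i \<one>\<^sub>o) = zero_arr C (A \<otimes>\<^sub>o \<one>\<^sub>o) (B \<otimes>\<^sub>o (D \<otimes>\<^sub>o \<one>\<^sub>o))"
    by (simp add: mor_iff)
  from iso_cancel_zero(1)[OF associator_iso associator_mor _ this]
  have "h \<otimes>\<^sub>a ?i \<one>\<^sub>o = zero_arr C (A \<otimes>\<^sub>o \<one>\<^sub>o) ((B \<otimes>\<^sub>o D) \<otimes>\<^sub>o \<one>\<^sub>o)"
    by (simp add: mor_iff)
  then show ?thesis using tensor_unit_faithful(1)[OF h] by simp
qed

section \<open>Tensoring retracts, splittings, isomorphisms and zero objects with a fixed
  object\<close>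

lemma tensor_retract:
  assumes "retract Y S" "A \<in> obj C"
  shows "retract (A \<otimes>\<^sub>o Y) (A \<otimes>\<^sub>o S)" "retract (Y \<otimes>\<^sub>o A) (S \<otimes>\<^sub>o A)"
proof -
  obtain i p where m: "i \<in> mor C Y S" "p \<in> mor C S Y" "p \<cdot> i = ident C Y"
    using assms(1) unfolding retract_def by blast
  note o = mor_obj[OF m(1)] assms(2)
  have "(ident C A \<otimes>\<^sub>a p) \<cdot> (ident C A \<otimes>\<^sub>a i) = ident C (A \<otimes>\<^sub>o Y)"
    "(p \<otimes>\<^sub>a ident C A) \<cdot> (i \<otimes>\<^sub>a ident C A) = ident C (Y \<otimes>\<^sub>o A)"
    using m o by (simp_all add: tensor_comp_arr tensor_ident mor_iff)
  then show "retract (A \<otimes>\<^sub>o Y) (A \<otimes>\<^sub>o S)" "retract (Y \<otimes>\<^sub>o A) (S \<otimes>\<^sub>o A)"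
    unfolding retract_def using tensor_mor m ident_mor[OF assms(2)] by blast+
qed

lemma tensor_orthogonal_split:
  assumes "orthogonal_split Y Z S" "A \<in> obj C"
  shows "orthogonal_split (A \<otimes>\<^sub>o Y) (A \<otimes>\<^sub>o Z) (A \<otimes>\<^sub>o S)"
    "orthogonal_split (Y \<otimes>\<^sub>o A) (Z \<otimes>\<^sub>o A) (S \<otimes>\<^sub>o A)"
proof -
  obtain i p i' p' where m: "i \<in> mor C Y S" "p \<in> mor C S Y" "i' \<in> mor C Z S" "p' \<in> mor C S Z"
    "p \<cdot> i = ident C Y" "p' \<cdot> i' = ident C Z" "p \<cdot> i' = zero_arr C Z Y" "p' \<cdot> i = zero_arr C Y Z"
    using assms(1) unfolding orthogonal_split_def by blast
  note o = mor_obj[OF m(1)] mor_obj[OF m(3)] assms(2)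
  let ?l = "\<lambda>f. ident C A \<otimes>\<^sub>a f" and ?r = "\<lambda>f. f \<otimes>\<^sub>a ident C A"
  have "?l p \<cdot> ?l i = ident C (A \<otimes>\<^sub>o Y)" "?l p' \<cdot> ?l i' = ident C (A \<otimes>\<^sub>o Z)"
    "?l p \<cdot> ?l i' = zero_arr C (A \<otimes>\<^sub>o Z) (A \<otimes>\<^sub>o Y)" "?l p' \<cdot> ?l i = zero_arr C (A \<otimes>\<^sub>o Y) (A \<otimes>\<^sub>o Z)"
    "?r p \<cdot> ?r i = ident C (Y \<otimes>\<^sub>o A)" "?r p' \<cdot> ?r i' = ident C (Z \<otimes>\<^sub>o A)"
    "?r p \<cdot> ?r i' = zero_arr C (Z \<otimes>\<^sub>o A) (Y \<otimes>\<^sub>o A)" "?r p' \<cdot> ?r i = zero_arr C (Y \<otimes>\<^sub>o A) (Z \<otimes>\<^sub>o A)"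
    using m o by (simp_all add: tensor_comp_arr tensor_ident mor_iff)
  then show "orthogonal_split (A \<otimes>\<^sub>o Y) (A \<otimes>\<^sub>o Z) (A \<otimes>\<^sub>o S)"
    "orthogonal_split (Y \<otimes>\<^sub>o A) (Z \<otimes>\<^sub>o A) (S \<otimes>\<^sub>o A)"
    unfolding orthogonal_split_def using tensor_mor m(1-4) ident_mor[OF assms(2)] by blast+
qed

lemma tensor_iso:
  assumes "iso_obj C X Y" "A \<in> obj C"
  shows "iso_obj C (A \<otimes>\<^sub>o X) (A \<otimes>\<^sub>o Y)" "iso_obj C (X \<otimes>\<^sub>o A) (Y \<otimes>\<^sub>o A)"
proof -
  obtain f g where m: "f \<in> mor C X Y" "g \<in> mor C Y X" "g \<cdot> f = ident C X" "f \<cdot> g = ident C Y"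
    using assms(1) by (metis iso_objE)
  note o = mor_obj[OF m(1)] assms(2)
  show "iso_obj C (A \<otimes>\<^sub>o X) (A \<otimes>\<^sub>o Y)"
    using m o by (intro iso_objI[of "ident C A \<otimes>\<^sub>a f" _ _ "ident C A \<otimes>\<^sub>a g"])
      (auto simp: tensor_comp_arr tensor_ident mor_iff)
  show "iso_obj C (X \<otimes>\<^sub>o A) (Y \<otimes>\<^sub>o A)"
    using m o by (intro iso_objI[of "f \<otimes>\<^sub>a ident C A" _ _ "g \<otimes>\<^sub>a ident C A"])
      (auto simp: tensor_comp_arr tensor_ident mor_iff)
qed

lemma tensor_zero_obj:
  assumes "zero_obj C Y" "A \<in> obj C"
  shows "zero_obj C (A \<otimes>\<^sub>o Y)" "zero_obj C (Y \<otimes>\<^sub>o A)"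
  using assms tensor_ident[of A Y] tensor_ident[of Y A] by (auto simp: zero_obj_iff)

lemma assoc_iso:
  "X \<in> obj C \<Longrightarrow> Y \<in> obj C \<Longrightarrow> Z \<in> obj C \<Longrightarrow> iso_obj C ((X \<otimes>\<^sub>o Y) \<otimes>\<^sub>o Z) (X \<otimes>\<^sub>o (Y \<otimes>\<^sub>o Z))"
  using iso_objI_arr associator_mor associator_iso by blast

lemma unit_iso:
  assumes "X \<in> obj C"
  shows "iso_obj C (\<one>\<^sub>o \<otimes>\<^sub>o X) X" "iso_obj C (X \<otimes>\<^sub>o \<one>\<^sub>o) X"
  using iso_objI_arr left_unitor_mor left_unitor_iso right_unitor_mor right_unitor_iso assms by blast+

end

text \<open>Tensoring with \<open>Y\<close> is additive, so the induction rule for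
  \<open>ident C S\<close> applies inside the tensor product. This gives the needed part of
  distributivity without building a biproduct of the tensored components.\<close>

lemma (in linear_monoidal_category) direct_sum_tensor_jointly_monic:
  assumes "direct_sum C Xs S" "Y \<in> obj C"
  obtains \<pi> where "\<And>i. i < length Xs \<Longrightarrow> \<pi> i \<in> mor C S (Xs ! i)"
    "\<And>A h. h \<in> mor C A (S \<otimes>\<^sub>o Y) \<Longrightarrow>
      (\<And>i. i < length Xs \<Longrightarrow> (\<pi> i \<otimes>\<^sub>a ident C Y) \<cdot> h = zero_arr C A (Xs ! i \<otimes>\<^sub>o Y)) \<Longrightarrow>
      h = zero_arr C A (S \<otimes>\<^sub>o Y)"
    "\<And>A h. h \<in> mor C A (Y \<otimes>\<^sub>o S) \<Longrightarrow>
      (\<And>i. i < length Xs \<Longrightarrow> (ident C Y \<otimes>\<^sub>a \<pi> i) \<cdot> h = zero_arr C A (Y \<otimes>\<^sub>o Xs ! i)) \<Longrightarrow>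
      h = zero_arr C A (Y \<otimes>\<^sub>o S)"
  using assms(1)
proof (rule direct_sumE)
  fix \<iota> \<pi>
  assume m: "\<And>i. i < length Xs \<Longrightarrow> \<iota> i \<in> mor C (Xs ! i) S"
    "\<And>i. i < length Xs \<Longrightarrow> \<pi> i \<in> mor C S (Xs ! i)" and S: "S \<in> obj C"
    and P: "\<And>P. \<lbrakk>P (zero_arr C S S);
      \<And>g h. g \<in> mor C S S \<Longrightarrow> h \<in> mor C S S \<Longrightarrow> P g \<Longrightarrow> P h \<Longrightarrow> P (g \<oplus>\<^sub>a h);
      \<And>i. i < length Xs \<Longrightarrow> P (\<iota> i \<cdot> \<pi> i)\<rbrakk> \<Longrightarrow> P (ident C S)"
  note Y = ident_mor[OF assms(2)]
  show thesis
  proof (rule that[OF m(2)])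
    fix A h assume h: "h \<in> mor C A (S \<otimes>\<^sub>o Y)"
      "\<And>i. i < length Xs \<Longrightarrow> (\<pi> i \<otimes>\<^sub>a ident C Y) \<cdot> h = zero_arr C A (Xs ! i \<otimes>\<^sub>o Y)"
    note o = mor_obj[OF h(1)]
    have "(ident C S \<otimes>\<^sub>a ident C Y) \<cdot> h = zero_arr C A (S \<otimes>\<^sub>o Y)"
    proof (rule P)
      fix i assume i: "i < length Xs"
      have "((\<iota> i \<cdot> \<pi> i) \<otimes>\<^sub>a ident C Y) \<cdot> h = (\<iota> i \<otimes>\<^sub>a ident C Y) \<cdot> ((\<pi> i \<otimes>\<^sub>a ident C Y) \<cdot> h)"
        using m[OF i] h(1) assms(2)
          comp_rewrite[of "\<iota> i \<otimes>\<^sub>a ident C Y" "\<pi> i \<otimes>\<^sub>a ident C Y" "(\<iota> i \<cdot> \<pi> i) \<otimes>\<^sub>a ident C Y" h]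
        by (simp add: mor_iff tensor_comp_arr)
      then show "((\<iota> i \<cdot> \<pi> i) \<otimes>\<^sub>a ident C Y) \<cdot> h = zero_arr C A (S \<otimes>\<^sub>o Y)"
        using m[OF i] h(2)[OF i] o assms(2) by (simp add: mor_iff)
    next
      fix f g assume fg: "f \<in> mor C S S" "g \<in> mor C S S"
        "(f \<otimes>\<^sub>a ident C Y) \<cdot> h = zero_arr C A (S \<otimes>\<^sub>o Y)" "(g \<otimes>\<^sub>a ident C Y) \<cdot> h = zero_arr C A (S \<otimes>\<^sub>o Y)"
      have "((f \<oplus>\<^sub>a g) \<otimes>\<^sub>a ident C Y) \<cdot> h = (f \<otimes>\<^sub>a ident C Y) \<cdot> h \<oplus>\<^sub>a (g \<otimes>\<^sub>a ident C Y) \<cdot> h"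
        using tensor_add_left[OF fg(1,2) Y] comp_add_left[OF h(1)] tensor_mor[OF fg(1) Y] tensor_mor[OF fg(2) Y]
        by metis
      then show "((f \<oplus>\<^sub>a g) \<otimes>\<^sub>a ident C Y) \<cdot> h = zero_arr C A (S \<otimes>\<^sub>o Y)"
        using fg add_arr_zero[OF _ _ zero_arr_mor] o by simp
    qed (use h(1) o assms(2) S in \<open>auto simp: mor_iff\<close>)
    then show "h = zero_arr C A (S \<otimes>\<^sub>o Y)" using h(1) S assms(2) by (simp add: mor_iff tensor_ident)
  next
    fix A h assume h: "h \<in> mor C A (Y \<otimes>\<^sub>o S)"
      "\<And>i. i < length Xs \<Longrightarrow> (ident C Y \<otimes>\<^sub>a \<pi> i) \<cdot> h = zero_arr C A (Y \<otimes>\<^sub>o Xs ! i)"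
    note o = mor_obj[OF h(1)]
    have "(ident C Y \<otimes>\<^sub>a ident C S) \<cdot> h = zero_arr C A (Y \<otimes>\<^sub>o S)"
    proof (rule P)
      fix i assume i: "i < length Xs"
      have "(ident C Y \<otimes>\<^sub>a (\<iota> i \<cdot> \<pi> i)) \<cdot> h = (ident C Y \<otimes>\<^sub>a \<iota> i) \<cdot> ((ident C Y \<otimes>\<^sub>a \<pi> i) \<cdot> h)"
        using m[OF i] h(1) assms(2)
          comp_rewrite[of "ident C Y \<otimes>\<^sub>a \<iota> i" "ident C Y \<otimes>\<^sub>a \<pi> i" "ident C Y \<otimes>\<^sub>a (\<iota> i \<cdot> \<pi> i)" h]
        by (simp add: mor_iff tensor_comp_arr)
      then show "(ident C Y \<otimes>\<^sub>a (\<iota> i \<cdot> \<pi> i)) \<cdot> h = zero_arr C A (Y \<otimes>\<^sub>o S)"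
        using m[OF i] h(2)[OF i] o assms(2) by (simp add: mor_iff)
    next
      fix f g assume fg: "f \<in> mor C S S" "g \<in> mor C S S"
        "(ident C Y \<otimes>\<^sub>a f) \<cdot> h = zero_arr C A (Y \<otimes>\<^sub>o S)" "(ident C Y \<otimes>\<^sub>a g) \<cdot> h = zero_arr C A (Y \<otimes>\<^sub>o S)"
      have "(ident C Y \<otimes>\<^sub>a (f \<oplus>\<^sub>a g)) \<cdot> h = (ident C Y \<otimes>\<^sub>a f) \<cdot> h \<oplus>\<^sub>a (ident C Y \<otimes>\<^sub>a g) \<cdot> h"
        using tensor_add_right[OF Y fg(1,2)] comp_add_left[OF h(1)] tensor_mor[OF Y fg(1)] tensor_mor[OF Y fg(2)]
        by metis
      then show "(ident C Y \<otimes>\<^sub>a (f \<oplus>\<^sub>a g)) \<cdot> h = zero_arr C A (Y \<otimes>\<^sub>o S)"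
        using fg add_arr_zero[OF _ _ zero_arr_mor] o by simp
    qed (use h(1) o assms(2) S in \<open>auto simp: mor_iff\<close>)
    then show "h = zero_arr C A (Y \<otimes>\<^sub>o S)" using h(1) S assms(2) by (simp add: mor_iff tensor_ident)
  qed
qed

section \<open>Invertible objects\<close>

context fusion_category
begin

text \<open>The scalars come from \<open>unit_endomorphisms\<close>. Their uniqueness excludes a
  zero unit, for which 0 and 1 would represent the same endomorphism.\<close>

lemma unit_simple: "simple_obj C \<one>\<^sub>o"
proof (rule simple_if_scalar_endomorphisms)
  have i: "ident C \<one>\<^sub>o \<in> mor C \<one>\<^sub>o \<one>\<^sub>o" by (rule ident_mor) simp
  show "\<not> zero_obj C \<one>\<^sub>o"
  proof
    assume "zero_obj C \<one>\<^sub>o"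
    then have "ident C \<one>\<^sub>o = 0 \<odot>\<^sub>a ident C \<one>\<^sub>o" "ident C \<one>\<^sub>o = 1 \<odot>\<^sub>a ident C \<one>\<^sub>o"
      by (simp_all add: zero_obj_iff)
    then show False using unit_endomorphisms[OF i] zero_neq_one by blast
  qed
  show "\<exists>c. f = c \<odot>\<^sub>a ident C \<one>\<^sub>o" if "f \<in> mor C \<one>\<^sub>o \<one>\<^sub>o" for f
    using unit_endomorphisms[OF that] by blast
qed simp

lemma simple_split_nonzero:
  assumes "simple_obj C T" "i \<in> mor C T S" "p \<in> mor C S T" "p \<cdot> i = ident C T"
  shows "i \<noteq> zero_arr C T S" "p \<noteq> zero_arr C S T"
proof -
  have nz: "p \<cdot> i \<noteq> zero_arr C T T" using assms(4) simple_objD(3)[OF assms(1)] by simp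
  note o = mor_obj[OF assms(2)]
  have "p \<cdot> zero_arr C T S = zero_arr C T T" "zero_arr C S T \<cdot> i = zero_arr C T T"
    using assms(2,3) o by (simp_all add: mor_iff)
  then show "i \<noteq> zero_arr C T S" "p \<noteq> zero_arr C S T" using nz by auto
qed

text \<open>Stands in for uniqueness of decompositions: the inclusion of \<open>T\<close> is
  nonzero, so some projection does not kill it, and a nonzero arrow out of a simple object
  splits.\<close>

lemma simple_direct_sum_retract:
  assumes "direct_sum C Xs S" "simple_obj C T" "retract T S"
  obtains X where "X \<in> set Xs" "retract T X"
proof -
  obtain i p where m: "i \<in> mor C T S" "p \<in> mor C S T" "p \<cdot> i = ident C T"
    using assms(3) unfolding retract_def by blast
  obtain \<pi> where \<pi>: "\<And>i. i < length Xs \<Longrightarrow> \<pi> i \<in> mor C S (Xs ! i)"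
    "\<And>A h. h \<in> mor C A S \<Longrightarrow> (\<And>i. i < length Xs \<Longrightarrow> \<pi> i \<cdot> h = zero_arr C A (Xs ! i)) \<Longrightarrow>
      h = zero_arr C A S" by (rule direct_sum_jointly_monic[OF assms(1)]) blast
  have "i \<noteq> zero_arr C T S" by (rule simple_split_nonzero(1)[OF assms(2) m])
  then obtain n where n: "n < length Xs" "\<pi> n \<cdot> i \<noteq> zero_arr C T (Xs ! n)" using \<pi>(2)[OF m(1)] by blast
  then have "retract T (Xs ! n)"
    using simple_map_retract[OF assms(2)] comp_mor[OF m(1) \<pi>(1)[OF n(1)]] by blast
  then show thesis using that[of "Xs ! n"] n(1) by simp
qed

lemma simple_direct_sum_tensor_retract:
  assumes "direct_sum C Xs S" "simple_obj C T" "Y \<in> obj C"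
  shows "retract T (S \<otimes>\<^sub>o Y) \<Longrightarrow> \<exists>X \<in> set Xs. retract T (X \<otimes>\<^sub>o Y)"
    "retract T (Y \<otimes>\<^sub>o S) \<Longrightarrow> \<exists>X \<in> set Xs. retract T (Y \<otimes>\<^sub>o X)"
proof -
  obtain \<pi> where \<pi>: "\<And>i. i < length Xs \<Longrightarrow> \<pi> i \<in> mor C S (Xs ! i)"
    "\<And>A h. h \<in> mor C A (S \<otimes>\<^sub>o Y) \<Longrightarrow>
      (\<And>i. i < length Xs \<Longrightarrow> (\<pi> i \<otimes>\<^sub>a ident C Y) \<cdot> h = zero_arr C A (Xs ! i \<otimes>\<^sub>o Y)) \<Longrightarrow>
      h = zero_arr C A (S \<otimes>\<^sub>o Y)"
    "\<And>A h. h \<in> mor C A (Y \<otimes>\<^sub>o S) \<Longrightarrow>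
      (\<And>i. i < length Xs \<Longrightarrow> (ident C Y \<otimes>\<^sub>a \<pi> i) \<cdot> h = zero_arr C A (Y \<otimes>\<^sub>o Xs ! i)) \<Longrightarrow>
      h = zero_arr C A (Y \<otimes>\<^sub>o S)"
    using direct_sum_tensor_jointly_monic[OF assms(1,3)] by metis
  note nz = simple_split_nonzero(1)[OF assms(2)]
  show "\<exists>X \<in> set Xs. retract T (X \<otimes>\<^sub>o Y)" if r: "retract T (S \<otimes>\<^sub>o Y)"
  proof -
    obtain i where i: "i \<in> mor C T (S \<otimes>\<^sub>o Y)" "i \<noteq> zero_arr C T (S \<otimes>\<^sub>o Y)"
      using r nz unfolding retract_def by blast
    then obtain n where n: "n < length Xs" "(\<pi> n \<otimes>\<^sub>a ident C Y) \<cdot> i \<noteq> zero_arr C T (Xs ! n \<otimes>\<^sub>o Y)"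
      using \<pi>(2)[OF i(1)] by blast
    then have "retract T (Xs ! n \<otimes>\<^sub>o Y)"
      using simple_map_retract[OF assms(2)] comp_mor[OF i(1) tensor_mor[OF \<pi>(1)[OF n(1)] ident_mor[OF assms(3)]]]
      by blast
    then show ?thesis using n(1) nth_mem by blast
  qed
  show "\<exists>X \<in> set Xs. retract T (Y \<otimes>\<^sub>o X)" if r: "retract T (Y \<otimes>\<^sub>o S)"
  proof -
    obtain i where i: "i \<in> mor C T (Y \<otimes>\<^sub>o S)" "i \<noteq> zero_arr C T (Y \<otimes>\<^sub>o S)"
      using r nz unfolding retract_def by blast
    then obtain n where n: "n < length Xs" "(ident C Y \<otimes>\<^sub>a \<pi> n) \<cdot> i \<noteq> zero_arr C T (Y \<otimes>\<^sub>o Xs ! n)"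
      using \<pi>(3)[OF i(1)] by blast
    then have "retract T (Y \<otimes>\<^sub>o Xs ! n)"
      using simple_map_retract[OF assms(2)] comp_mor[OF i(1) tensor_mor[OF ident_mor[OF assms(3)] \<pi>(1)[OF n(1)]]]
      by blast
    then show ?thesis using n(1) nth_mem by blast
  qed
qed

lemma inverse_cancel:
  assumes "A \<in> obj C" "Y \<in> obj C" "Y' \<in> obj C" "iso_obj C (Y \<otimes>\<^sub>o Y') \<one>\<^sub>o"
  shows "iso_obj C A ((A \<otimes>\<^sub>o Y) \<otimes>\<^sub>o Y')"
proof -
  have "iso_obj C ((A \<otimes>\<^sub>o Y) \<otimes>\<^sub>o Y') (A \<otimes>\<^sub>o (Y \<otimes>\<^sub>o Y'))" using assms by (simp add: assoc_iso)
  moreover have "iso_obj C (A \<otimes>\<^sub>o (Y \<otimes>\<^sub>o Y')) (A \<otimes>\<^sub>o \<one>\<^sub>o)" using tensor_iso assms by blast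
  moreover have "iso_obj C (A \<otimes>\<^sub>o \<one>\<^sub>o) A" using unit_iso assms by blast
  ultimately show ?thesis using iso_obj_sym iso_obj_trans by blast
qed

text \<open>Tensoring with the inverse would carry two disjoint summands of \<open>Y\<close> to
  disjoint summands of a copy of the unit. They stay nonzero, since tensoring back recovers them, so
  the unit would not be simple.\<close>

lemma invertible_simple:
  assumes "invertible_obj C Y"
  shows "simple_obj C Y"
proof (rule ccontr)
  assume ns: "\<not> simple_obj C Y"
  obtain Y' where o: "Y \<in> obj C" "Y' \<in> obj C"
    and i: "iso_obj C (Y \<otimes>\<^sub>o Y') \<one>\<^sub>o" "iso_obj C (Y' \<otimes>\<^sub>o Y) \<one>\<^sub>o"
    using assms unfolding invertible_obj_def by blast
  have s: "simple_obj C (Y \<otimes>\<^sub>o Y')" using simple_iso[OF unit_simple] i(1) iso_obj_sym by blast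
  have "\<not> zero_obj C Y" using tensor_zero_obj(2) o(2) simple_objD(2)[OF s] by blast
  then obtain A B where AB: "simple_obj C A" "simple_obj C B" "orthogonal_split A B Y"
    using not_simple_split o(1) ns by blast
  have z: "\<not> zero_obj C (T \<otimes>\<^sub>o Y')" if "simple_obj C T" for T
    using inverse_cancel[OF _ o(2,1) i(2), of T] tensor_zero_obj(2)[OF _ o(1), of "T \<otimes>\<^sub>o Y'"]
      zero_obj_retract[OF iso_obj_retract] simple_objD[OF that] by blast
  show False
    using simple_not_split[OF s tensor_orthogonal_split(2)[OF AB(3) o(2)]] z AB(1,2) by blast
qed

lemma invertible_iso:
  assumes "invertible_obj C X" "iso_obj C X Y"
  shows "invertible_obj C Y"
proof -
  obtain X' where o: "X' \<in> obj C"
    and i: "iso_obj C (X \<otimes>\<^sub>o X') \<one>\<^sub>o" "iso_obj C (X' \<otimes>\<^sub>o X) \<one>\<^sub>o"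
    using assms(1) unfolding invertible_obj_def by blast
  have s: "iso_obj C Y X" by (rule iso_obj_sym[OF assms(2)])
  have "iso_obj C (Y \<otimes>\<^sub>o X') \<one>\<^sub>o" "iso_obj C (X' \<otimes>\<^sub>o Y) \<one>\<^sub>o"
    using iso_obj_trans[OF tensor_iso(2)[OF s o] i(1)] iso_obj_trans[OF tensor_iso(1)[OF s o] i(2)] by auto
  then show ?thesis unfolding invertible_obj_def using o s by (auto simp: iso_obj_def)
qed

lemma invertible_tensor:
  assumes "invertible_obj C X" "invertible_obj C Y"
  shows "invertible_obj C (X \<otimes>\<^sub>o Y)"
proof -
  obtain X' where X: "X \<in> obj C" "X' \<in> obj C"
    and i: "iso_obj C (X \<otimes>\<^sub>o X') \<one>\<^sub>o" "iso_obj C (X' \<otimes>\<^sub>o X) \<one>\<^sub>o"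
    using assms(1) unfolding invertible_obj_def by blast
  obtain Y' where Y: "Y \<in> obj C" "Y' \<in> obj C"
    and j: "iso_obj C (Y \<otimes>\<^sub>o Y') \<one>\<^sub>o" "iso_obj C (Y' \<otimes>\<^sub>o Y) \<one>\<^sub>o"
    using assms(2) unfolding invertible_obj_def by blast
  have *: "iso_obj C ((A \<otimes>\<^sub>o B) \<otimes>\<^sub>o (B' \<otimes>\<^sub>o A')) \<one>\<^sub>o"
    if "A \<in> obj C" "B \<in> obj C" "A' \<in> obj C" "B' \<in> obj C" "iso_obj C (A \<otimes>\<^sub>o A') \<one>\<^sub>o" "iso_obj C (B \<otimes>\<^sub>o B') \<one>\<^sub>o"
    for A B A' B'
  proof -
    have "iso_obj C ((A \<otimes>\<^sub>o B) \<otimes>\<^sub>o (B' \<otimes>\<^sub>o A')) (((A \<otimes>\<^sub>o B) \<otimes>\<^sub>o B') \<otimes>\<^sub>o A')"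
      using that by (intro iso_obj_sym[OF assoc_iso]) auto
    moreover have "iso_obj C (((A \<otimes>\<^sub>o B) \<otimes>\<^sub>o B') \<otimes>\<^sub>o A') (A \<otimes>\<^sub>o A')"
      using that by (intro tensor_iso(2) iso_obj_sym[OF inverse_cancel]) auto
    ultimately show ?thesis using that(5) iso_obj_trans by blast
  qed
  show ?thesis unfolding invertible_obj_def
    using *[OF X(1) Y(1) X(2) Y(2) i(1) j(1)] *[OF Y(2) X(2) Y(1) X(1) j(2) i(2)] X Y
    by (auto intro!: bexI[of _ "Y' \<otimes>\<^sub>o X'"])
qed

text \<open>Evaluation restricted to \<open>T\<close>, or coevaluation projected to
  \<open>T\<close>, is a nonzero arrow between \<open>T \<otimes> X\<close> and the unit, hence
  splits. Covering both kinds of dual allows closure under left and right duals to be proved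
  together.\<close>

lemma retract_dual_unit:
  assumes "simple_obj C T" "retract T D" "left_dual C X D \<or> left_dual C D X"
  shows "retract \<one>\<^sub>o (T \<otimes>\<^sub>o X)"
  using assms(3)
proof
  obtain i p where m: "i \<in> mor C T D" "p \<in> mor C D T" "p \<cdot> i = ident C T"
    using assms(2) unfolding retract_def by blast
  note nz = simple_split_nonzero[OF assms(1) m]
  {
    assume "left_dual C X D"
    then obtain ev coev b where d: "dual_pair X D ev coev b" by (rule left_dualE)
    then have "ev \<in> mor C (D \<otimes>\<^sub>o X) \<one>\<^sub>o" "X \<in> obj C" by (auto simp: dual_pair_def)
    then have "ev \<cdot> (i \<otimes>\<^sub>a ident C X) \<in> mor C (T \<otimes>\<^sub>o X) \<one>\<^sub>o"
      using comp_mor tensor_mor m(1) ident_mor by blast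
    then show ?thesis
      using simple_map_retract[OF unit_simple] ev_detects[OF d m(1)] nz(1) by blast
  next
    assume "left_dual C D X"
    then obtain ev coev b where d: "dual_pair D X ev coev b" by (rule left_dualE)
    then have "coev \<in> mor C \<one>\<^sub>o (D \<otimes>\<^sub>o X)" "X \<in> obj C" by (auto simp: dual_pair_def)
    then have "(p \<otimes>\<^sub>a ident C X) \<cdot> coev \<in> mor C \<one>\<^sub>o (T \<otimes>\<^sub>o X)"
      using comp_mor tensor_mor m(2) ident_mor by blast
    then show ?thesis
      using simple_map_retract[OF unit_simple] coev_detects[OF d m(2)] nz(2) by blast
  }
qed

text \<open>A concrete upper bound for \<open>pointed_part\<close>, which is only given as an
  intersection. Testing all simple retracts avoids fixing a decomposition of
  \<open>S\<close>.\<close>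

definition invertibly_generated :: "'o set" where
  "invertibly_generated = {S \<in> obj C. \<forall>T. simple_obj C T \<and> retract T S \<longrightarrow> invertible_obj C T}"

lemma full_abelian_subcatI:
  assumes "A \<subseteq> obj C" "\<And>X S. S \<in> A \<Longrightarrow> retract X S \<Longrightarrow> X \<in> A"
    and "\<And>Xs S. set Xs \<subseteq> A \<Longrightarrow> direct_sum C Xs S \<Longrightarrow> S \<in> A"
  shows "full_abelian_subcat C A"
  unfolding full_abelian_subcat_def
proof (intro conjI allI impI)
  show "Y \<in> A" if "X \<in> A" "iso_obj C X Y" for X Y
    using that assms(2) iso_obj_retract iso_obj_sym by blast
  show "X \<in> A" if "S \<in> A" "direct_summand C X S" for X S
    using that assms(2) direct_sum_retract unfolding direct_summand_def by fastforce
qed (use assms in auto)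

lemma full_abelian_subcatD:
  assumes "full_abelian_subcat C A"
  shows "A \<subseteq> obj C" "S \<in> A \<Longrightarrow> retract Y S \<Longrightarrow> Y \<in> A"
    "set Xs \<subseteq> A \<Longrightarrow> direct_sum C Xs S \<Longrightarrow> S \<in> A"
proof -
  note A = assms[unfolded full_abelian_subcat_def]
  show "A \<subseteq> obj C" by (rule A[THEN conjunct1])
  show "set Xs \<subseteq> A \<Longrightarrow> direct_sum C Xs S \<Longrightarrow> S \<in> A"
    by (rule A[THEN conjunct2, THEN conjunct2, THEN conjunct1, rule_format])
  show "S \<in> A \<Longrightarrow> retract Y S \<Longrightarrow> Y \<in> A"
    by (rule A[THEN conjunct2, THEN conjunct2, THEN conjunct2, rule_format, OF _ retract_direct_summand])
qed

lemma invertibly_generated_fusion_subcat: "fusion_subcat C invertibly_generated"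
  unfolding fusion_subcat_def
proof (intro conjI allI impI ballI)
  show "full_abelian_subcat C invertibly_generated"
  proof (rule full_abelian_subcatI)
    show "X \<in> invertibly_generated" if "S \<in> invertibly_generated" "retract X S" for X S
      using that retract_trans retract_obj unfolding invertibly_generated_def by blast
    show "S \<in> invertibly_generated" if S: "set Xs \<subseteq> invertibly_generated" "direct_sum C Xs S" for Xs S
    proof -
      have "S \<in> obj C" using S(2) by (simp add: direct_sum_def)
      then show ?thesis
        using simple_direct_sum_retract[OF S(2)] S(1) unfolding invertibly_generated_def by blast
    qed
  qed (auto simp: invertibly_generated_def)
  have unit_inv: "invertible_obj C \<one>\<^sub>o"
    unfolding invertible_obj_def using unit_iso[of "\<one>\<^sub>o"] by auto
  show "\<one>\<^sub>o \<in> invertibly_generated"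
    using retract_simple_iso[OF _ unit_simple] invertible_iso[OF unit_inv] iso_obj_sym simple_objD(2)
    unfolding invertibly_generated_def by auto
  show "X \<otimes>\<^sub>o Y \<in> invertibly_generated"
    if XY: "X \<in> invertibly_generated" "Y \<in> invertibly_generated" for X Y
    unfolding invertibly_generated_def
  proof (intro CollectI conjI allI impI)
    have o: "X \<in> obj C" "Y \<in> obj C" using XY by (auto simp: invertibly_generated_def)
    then show "X \<otimes>\<^sub>o Y \<in> obj C" by simp
    fix T assume T: "simple_obj C T \<and> retract T (X \<otimes>\<^sub>o Y)"
    obtain Xs where Xs: "direct_sum C Xs X" "\<forall>S \<in> set Xs. simple_obj C S" using semisimple[OF o(1)] by blast
    obtain Ys where Ys: "direct_sum C Ys Y" "\<forall>S \<in> set Ys. simple_obj C S" using semisimple[OF o(2)] by blast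
    \<comment> \<open>\<open>T\<close> is traced to a product of simple summands of \<open>X\<close>
      and \<open>Y\<close>. That product is invertible, hence simple, hence isomorphic to
      \<open>T\<close>.\<close>
    obtain A where A: "A \<in> set Xs" "retract T (A \<otimes>\<^sub>o Y)"
      using simple_direct_sum_tensor_retract(1)[OF Xs(1) _ o(2)] T by blast
    have "A \<in> obj C" using Xs(2) A(1) simple_objD(1) by blast
    then obtain B where B: "B \<in> set Ys" "retract T (A \<otimes>\<^sub>o B)"
      using simple_direct_sum_tensor_retract(2)[OF Ys(1)] T A(2) by blast
    have "invertible_obj C A" "invertible_obj C B"
      using A(1) B(1) Xs Ys XY direct_sum_retract unfolding invertibly_generated_def by blast+
    then have "invertible_obj C (A \<otimes>\<^sub>o B)" by (rule invertible_tensor)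
    then show "invertible_obj C T"
      using retract_simple_iso[OF B(2) invertible_simple] T simple_objD(2) invertible_iso iso_obj_sym by blast
  qed
  show "D \<in> invertibly_generated"
    if X: "X \<in> invertibly_generated" and D: "left_dual C X D \<or> left_dual C D X" for X D
    unfolding invertibly_generated_def
  proof (intro CollectI conjI allI impI)
    show "D \<in> obj C" using D by (auto simp: left_dual_def)
    fix T assume T: "simple_obj C T \<and> retract T D"
    have o: "X \<in> obj C" "T \<in> obj C" using X T simple_objD by (auto simp: invertibly_generated_def)
    obtain Xs where Xs: "direct_sum C Xs X" "\<forall>S \<in> set Xs. simple_obj C S" using semisimple[OF o(1)] by blast
    \<comment> \<open>The unit is a retract of \<open>T \<otimes> A\<close> with \<open>A\<close>
      invertible. Tensoring with the inverse \<open>A'\<close> makes \<open>A'\<close> a retract of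
      the simple \<open>T\<close>, so the two are isomorphic.\<close>
    obtain A where A: "A \<in> set Xs" "retract \<one>\<^sub>o (T \<otimes>\<^sub>o A)"
      using simple_direct_sum_tensor_retract(2)[OF Xs(1) unit_simple o(2)] retract_dual_unit T D by blast
    have "invertible_obj C A"
      using A(1) Xs X direct_sum_retract unfolding invertibly_generated_def by blast
    then obtain A' where A': "A \<in> obj C" "A' \<in> obj C" "iso_obj C (A \<otimes>\<^sub>o A') \<one>\<^sub>o" "iso_obj C (A' \<otimes>\<^sub>o A) \<one>\<^sub>o"
      unfolding invertible_obj_def by blast
    then have inv: "invertible_obj C A'" unfolding invertible_obj_def by blast
    have "retract A' (\<one>\<^sub>o \<otimes>\<^sub>o A')" using unit_iso(1)[OF A'(2)] iso_obj_sym iso_obj_retract by blast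
    moreover have "retract (\<one>\<^sub>o \<otimes>\<^sub>o A') ((T \<otimes>\<^sub>o A) \<otimes>\<^sub>o A')" by (rule tensor_retract(2)[OF A(2) A'(2)])
    moreover have "retract ((T \<otimes>\<^sub>o A) \<otimes>\<^sub>o A') T"
      using inverse_cancel[OF o(2) A'(1,2,3)] iso_obj_sym iso_obj_retract by blast
    ultimately have "retract A' T" using retract_trans by blast
    then have "iso_obj C A' T"
      using retract_simple_iso T simple_objD(2)[OF invertible_simple[OF inv]] by blast
    then show "invertible_obj C T" by (rule invertible_iso[OF inv])
  qed
qed

lemma pointed_part_subset: "pointed_part C \<subseteq> invertibly_generated"
proof -
  have "{X. simple_obj C X \<and> invertible_obj C X} \<subseteq> invertibly_generated"
  proof clarify
    fix X assume X: "simple_obj C X" "invertible_obj C X"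
    then show "X \<in> invertibly_generated"
      using retract_simple_iso[OF _ X(1)] invertible_iso[OF X(2)] iso_obj_sym simple_objD
      unfolding invertibly_generated_def by blast
  qed
  then show ?thesis
    unfolding pointed_part_def generated_fusion_subcat_def
    using invertibly_generated_fusion_subcat by blast
qed

lemma invertible_in_pointed_part: "invertible_obj C X \<Longrightarrow> X \<in> pointed_part C"
  unfolding pointed_part_def generated_fusion_subcat_def using invertible_simple by blast

lemma pointed_part_fusion_subcat: "fusion_subcat C (pointed_part C)"
proof -
  let ?F = "{A. fusion_subcat C A \<and> {X. simple_obj C X \<and> invertible_obj C X} \<subseteq> A}"
  have p: "pointed_part C = \<Inter>?F" by (simp add: pointed_part_def generated_fusion_subcat_def)
  \<comment> \<open>A known member of the family bounds the intersection; over an empty family it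
    would be the whole type.\<close>
  have s: "pointed_part C \<subseteq> obj C"
    using pointed_part_subset by (auto simp: invertibly_generated_def)
  have "full_abelian_subcat C (\<Inter>?F)"
    unfolding full_abelian_subcat_def
  proof (intro conjI allI impI)
    show "\<Inter>?F \<subseteq> obj C" using s p by simp
    show "Y \<in> \<Inter>?F" if "X \<in> \<Inter>?F" "iso_obj C X Y" for X Y
      using that unfolding fusion_subcat_def full_abelian_subcat_def by blast
    show "S \<in> \<Inter>?F" if a: "set Xs \<subseteq> \<Inter>?F" "direct_sum C Xs S" for Xs S
    proof
      fix A assume A: "A \<in> ?F"
      then have "set Xs \<subseteq> A" using a(1) by blast
      then show "S \<in> A" using A a(2) unfolding fusion_subcat_def full_abelian_subcat_def by blast
    qed
    show "X \<in> \<Inter>?F" if "S \<in> \<Inter>?F" "direct_summand C X S" for X S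
      using that unfolding fusion_subcat_def full_abelian_subcat_def by blast
  qed
  then show ?thesis unfolding p fusion_subcat_def by blast
qed

end

section \<open>Graded extensions of Fibonacci categories\<close>

text \<open>Expresses the Fibonacci structure inside \<open>C\<close> itself, through an object of
  the trivial component, so that the equivalence with an external category is treated only once, at
  the end.\<close>

locale fibonacci_graded = fusion_category C
  for C :: "('o, 'm, 'k::{alg_closed_field, field_char_0}) moncat" (structure) +
  fixes G :: "('g, 'x) monoid_scheme" and D :: "'g \<Rightarrow> 'o set" and X :: 'o
  assumes group_G: "Group.group G"
    and grading: "faithful_grading C G D"
    and unit_component: "\<one>\<^sub>o \<in> D \<one>\<^bsub>G\<^esub>"
    and X_component: "X \<in> D \<one>\<^bsub>G\<^esub>"
    and X_square: "direct_sum C [\<one>\<^sub>o, X] (X \<otimes>\<^sub>o X)"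
    and simples: "simple_obj C T \<Longrightarrow> T \<in> D \<one>\<^bsub>G\<^esub> \<Longrightarrow> iso_obj C \<one>\<^sub>o T \<or> iso_obj C X T"
begin

interpretation grp: Group.group G by (rule group_G)

lemma X_obj [simp]: "X \<in> obj C"
  using X_square by (simp add: direct_sum_def)

lemmas grading_conjuncts = grading[unfolded faithful_grading_def]

lemmas component_subcat = grading_conjuncts[THEN conjunct1, rule_format]
  and component_orthogonal = grading_conjuncts[THEN conjunct2, THEN conjunct1, rule_format]
  and decomposition_exists =
    grading_conjuncts[THEN conjunct2, THEN conjunct2, THEN conjunct1, rule_format]
  and component_nonzero =
    grading_conjuncts[THEN conjunct2, THEN conjunct2, THEN conjunct2, THEN conjunct1, rule_format]
  and component_tensor = grading_conjuncts[THEN conjunct2, THEN conjunct2, THEN conjunct2,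
    THEN conjunct2, THEN conjunct1, rule_format]
  and component_duals = grading_conjuncts[THEN conjunct2, THEN conjunct2, THEN conjunct2,
    THEN conjunct2, THEN conjunct2, rule_format]

lemma component_obj: "g \<in> carrier G \<Longrightarrow> S \<in> D g \<Longrightarrow> S \<in> obj C"
  using full_abelian_subcatD(1)[OF component_subcat] by blast

lemma component_retract: "g \<in> carrier G \<Longrightarrow> S \<in> D g \<Longrightarrow> retract Y S \<Longrightarrow> Y \<in> D g"
  by (rule full_abelian_subcatD(2)[OF component_subcat])

lemma component_dual: "g \<in> carrier G \<Longrightarrow> S \<in> D g \<Longrightarrow> left_dual C S T \<Longrightarrow> T \<in> D (inv\<^bsub>G\<^esub> g)"
  using component_duals[of g] by blast

lemma homogeneous_decomposition:
  assumes "S \<in> obj C"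
  obtains gs Y where "set gs = carrier G" "\<And>g. g \<in> carrier G \<Longrightarrow> Y g \<in> D g" "direct_sum C (map Y gs) S"
  using decomposition_exists[OF assms] that by blast

text \<open>\<open>T\<close> is a retract of itself, hence of one homogeneous part of its
  decomposition, and components are closed under retracts.\<close>

lemma simple_homogeneous:
  assumes "simple_obj C T"
  obtains g where "g \<in> carrier G" "T \<in> D g"
proof -
  have T: "T \<in> obj C" using simple_objD[OF assms] by simp
  obtain gs Y where Y: "set gs = carrier G" "\<And>g. g \<in> carrier G \<Longrightarrow> Y g \<in> D g"
    "direct_sum C (map Y gs) T" by (rule homogeneous_decomposition[OF T]) blast
  have "retract T T" using iso_obj_retract T by simp
  then obtain Z where "Z \<in> set (map Y gs)" "retract T Z"
    using simple_direct_sum_retract[OF Y(3) assms] by blast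
  then obtain g where "g \<in> carrier G" "retract T (Y g)" using Y(1) by auto
  then show thesis using that component_retract Y(2) by blast
qed

lemma retract_same_component:
  assumes "g \<in> carrier G" "h \<in> carrier G" "S \<in> D g" "T \<in> D h" "retract S T" "\<not> zero_obj C S"
  shows "g = h"
proof (rule ccontr)
  assume "g \<noteq> h"
  then have z: "mor C S T = {zero_arr C S T}"
    using component_orthogonal assms(1-4) by blast
  obtain i p where m: "i \<in> mor C S T" "p \<in> mor C T S" "p \<cdot> i = ident C S"
    using assms(5) unfolding retract_def by blast
  have "i = zero_arr C S T" using m(1) z by simp
  then have "p \<cdot> i = zero_arr C S S" using m(2) mor_obj[OF m(1)] by (simp add: mor_iff)
  then have "ident C S = zero_arr C S S" using m(3) by simp
  then show False using assms(6) mor_obj[OF m(1)] by (simp add: zero_obj_iff)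
qed

text \<open>Left and right duals are treated alike through the degree: a simple summand
  \<open>T\<close> of the dual lies in some \<open>D h\<close>, and \<open>T \<otimes> S\<close>
  lies in \<open>D h\<close> but contains the unit, so \<open>h\<close> is the identity.\<close>

lemma component_one_fusion_subcat: "fusion_subcat C (D \<one>\<^bsub>G\<^esub>)"
  unfolding fusion_subcat_def
proof (intro conjI ballI allI impI)
  show "full_abelian_subcat C (D \<one>\<^bsub>G\<^esub>)" by (rule component_subcat) simp
  show "S \<otimes>\<^sub>o T \<in> D \<one>\<^bsub>G\<^esub>" if "S \<in> D \<one>\<^bsub>G\<^esub>" "T \<in> D \<one>\<^bsub>G\<^esub>" for S T
    using component_tensor[OF _ _ that] by simp
  fix S D' assume S: "S \<in> D \<one>\<^bsub>G\<^esub>" and d: "left_dual C S D' \<or> left_dual C D' S"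
  have "D' \<in> obj C" using d by (auto simp: left_dual_def)
  then obtain Ss where Ss: "\<forall>T \<in> set Ss. simple_obj C T" "direct_sum C Ss D'" using semisimple by blast
  have "T \<in> D \<one>\<^bsub>G\<^esub>" if T: "T \<in> set Ss" for T
  proof -
    have s: "simple_obj C T" using Ss(1) T by blast
    obtain h where h: "h \<in> carrier G" "T \<in> D h" using simple_homogeneous[OF s] .
    have "T \<otimes>\<^sub>o S \<in> D h" using component_tensor[OF h(1) _ h(2) S] h(1) by simp
    moreover have "retract \<one>\<^sub>o (T \<otimes>\<^sub>o S)"
      using retract_dual_unit[OF s direct_sum_retract[OF Ss(2) T] d] .
    ultimately have "\<one>\<^bsub>G\<^esub> = h"
      using retract_same_component[OF _ h(1) unit_component] simple_objD(2)[OF unit_simple] by simp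
    then show ?thesis using h(2) by simp
  qed
  then show "D' \<in> D \<one>\<^bsub>G\<^esub>"
    by (intro full_abelian_subcatD(3)[OF component_subcat _ Ss(2)]) auto
qed (rule unit_component)

section \<open>Multiplication by \<open>X\<close> on a graded component\<close>

lemma X_square_tensor_split:
  assumes "M \<in> obj C"
  shows "orthogonal_split (\<one>\<^sub>o \<otimes>\<^sub>o M) (X \<otimes>\<^sub>o M) (X \<otimes>\<^sub>o (X \<otimes>\<^sub>o M))"
proof -
  have "orthogonal_split \<one>\<^sub>o X (X \<otimes>\<^sub>o X)" using direct_sum_pair_split[OF X_square, of 0 1] by simp
  from tensor_orthogonal_split(2)[OF this assms]
  show ?thesis by (rule orthogonal_split_retract) (intro iso_obj_retract assoc_iso, use assms in auto)
qed

lemma orthogonal_split_retracts: "orthogonal_split Y Z S \<Longrightarrow> retract Y S \<and> retract Z S"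
  unfolding orthogonal_split_def retract_def by blast

text \<open>A copy of \<open>M\<close> is a retract of \<open>X \<otimes> (X \<otimes> M)\<close>,
  which would vanish together with \<open>X \<otimes> M\<close>.\<close>

lemma X_tensor_nonzero:
  assumes "M \<in> obj C" "\<not> zero_obj C M"
  shows "\<not> zero_obj C (X \<otimes>\<^sub>o M)"
proof
  assume "zero_obj C (X \<otimes>\<^sub>o M)"
  then have "zero_obj C (X \<otimes>\<^sub>o (X \<otimes>\<^sub>o M))" using tensor_zero_obj by simp
  then have "zero_obj C (\<one>\<^sub>o \<otimes>\<^sub>o M)"
    using orthogonal_split_retracts[OF X_square_tensor_split[OF assms(1)]] zero_obj_retract by blast
  then show False using unit_iso(1)[OF assms(1)] iso_obj_sym iso_obj_retract zero_obj_retract assms(2) by blast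
qed

lemma X_not_invertible: "\<not> invertible_obj C X"
proof
  assume i: "invertible_obj C X"
  have "orthogonal_split \<one>\<^sub>o X (X \<otimes>\<^sub>o X)" using direct_sum_pair_split[OF X_square, of 0 1] by simp
  then show False
    using simple_not_split[OF invertible_simple[OF invertible_tensor[OF i i]]]
      simple_objD(2)[OF unit_simple] simple_objD(2)[OF invertible_simple[OF i]] by blast
qed

text \<open>
  If no simple object among \<open>M\<close> and the \<open>n\<close> summands \<open>S\<^sub>i\<close> of \<open>X \<otimes> M\<close> had a simple product with \<open>X\<close>, then
  \<open>n \<ge> 2\<close>, and \<open>X \<otimes> X \<otimes> M\<close>, which is the sum of \<open>M\<close> and all \<open>S\<^sub>i\<close>, would have \<open>2 n > n + 1\<close>
  independent simple subobjects.
\<close>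

lemma simple_X_product_exists:
  assumes g: "g \<in> carrier G" and M: "simple_obj C M" "M \<in> D g"
  shows "\<exists>N. simple_obj C N \<and> N \<in> D g \<and> simple_obj C (X \<otimes>\<^sub>o N)"
proof (rule ccontr)
  assume "\<not> ?thesis"
  then have no: "\<not> simple_obj C (X \<otimes>\<^sub>o N)" if "simple_obj C N" "N \<in> D g" for N using that by blast
  have Mo [simp]: "M \<in> obj C" using simple_objD[OF M(1)] by simp
  obtain Ss where Ss: "\<forall>S \<in> set Ss. simple_obj C S" "direct_sum C Ss (X \<otimes>\<^sub>o M)"
    using semisimple[of "X \<otimes>\<^sub>o M"] by auto
  let ?n = "length Ss" and ?P = "X \<otimes>\<^sub>o (X \<otimes>\<^sub>o M)"
  have s: "simple_obj C (Ss ! i)" "Ss ! i \<in> obj C" if "i < ?n" for i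
    using Ss(1) that simple_objD(1) nth_mem by blast+
  have XM: "X \<otimes>\<^sub>o M \<in> D g" using component_tensor[OF _ g X_component M(2)] g by simp
  have nXM: "\<not> simple_obj C (X \<otimes>\<^sub>o M)" by (rule no[OF M])
  have nXS: "\<not> simple_obj C (X \<otimes>\<^sub>o Ss ! i)" if i: "i < ?n" for i
    by (rule no[OF s(1)[OF i] component_retract[OF g XM direct_sum_retract[OF Ss(2) nth_mem[OF i]]]])
  have n2: "2 \<le> ?n"
  proof -
    have "?n \<noteq> 0"
      using Ss(2) X_tensor_nonzero[OF Mo simple_objD(2)[OF M(1)]] by (auto simp: zero_obj_def)
    moreover have "?n \<noteq> 1"
    proof
      assume "?n = 1"
      then obtain A where A: "Ss = [A]" by (auto simp: length_Suc_conv)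
      then show False using direct_sum_single_iso Ss simple_iso nXM by auto
    qed
    ultimately show ?thesis by linarith
  qed
  obtain \<iota> \<pi> where m: "\<And>i. i < ?n \<Longrightarrow> \<iota> i \<in> mor C (Ss ! i) (X \<otimes>\<^sub>o M)"
    "\<And>i. i < ?n \<Longrightarrow> \<pi> i \<in> mor C (X \<otimes>\<^sub>o M) (Ss ! i)"
    "\<And>i. i < ?n \<Longrightarrow> \<pi> i \<cdot> \<iota> i = ident C (Ss ! i)"
    "\<And>i j. i < ?n \<Longrightarrow> j < ?n \<Longrightarrow> i \<noteq> j \<Longrightarrow> \<pi> i \<cdot> \<iota> j = zero_arr C (Ss ! j) (Ss ! i)"
    and jm: "\<And>A h. h \<in> mor C A (X \<otimes>\<^sub>o M) \<Longrightarrow> (\<And>i. i < ?n \<Longrightarrow> \<pi> i \<cdot> h = zero_arr C A (Ss ! i)) \<Longrightarrow>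
      h = zero_arr C A (X \<otimes>\<^sub>o M)"
    by (rule direct_sum_jointly_monic[OF Ss(2)]) blast
  obtain \<rho> where \<rho>: "\<And>i. i < length [\<one>\<^sub>o, X] \<Longrightarrow> \<rho> i \<in> mor C (X \<otimes>\<^sub>o X) ([\<one>\<^sub>o, X] ! i)"
    and jr: "\<And>A h. h \<in> mor C A ((X \<otimes>\<^sub>o X) \<otimes>\<^sub>o M) \<Longrightarrow> (\<And>i. i < length [\<one>\<^sub>o, X] \<Longrightarrow>
      (\<rho> i \<otimes>\<^sub>a ident C M) \<cdot> h = zero_arr C A ([\<one>\<^sub>o, X] ! i \<otimes>\<^sub>o M)) \<Longrightarrow> h = zero_arr C A ((X \<otimes>\<^sub>o X) \<otimes>\<^sub>o M)"
    by (rule direct_sum_tensor_jointly_monic[OF X_square Mo]) blast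
  have \<rho>': "\<rho> 0 \<in> mor C (X \<otimes>\<^sub>o X) \<one>\<^sub>o" "\<rho> (Suc 0) \<in> mor C (X \<otimes>\<^sub>o X) X" using \<rho>[of 0] \<rho>[of "Suc 0"] by auto
  obtain a where a: "a \<in> arr C" "dom_of C a = ?P" "cod_of C a = (X \<otimes>\<^sub>o X) \<otimes>\<^sub>o M"
    "associator C X X M \<cdot> a = ident C ?P"
    by (rule associator_inverse[of X X M]) auto
  \<comment> \<open>The \<open>n + 1\<close> simple quotients of
    \<open>X \<otimes> (X \<otimes> M)\<close>: an index \<open>j < n\<close> leads through
    \<open>X \<otimes> M\<close> to \<open>Ss ! j\<close>, and the last index \<open>n\<close> leads
    to \<open>M\<close> through the unit summand of \<open>X \<otimes> X\<close>.\<close>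
  define p where "p = (\<lambda>j. if j < ?n then \<pi> j \<cdot> ((\<rho> (Suc 0) \<otimes>\<^sub>a ident C M) \<cdot> a)
    else left_unitor C M \<cdot> ((\<rho> 0 \<otimes>\<^sub>a ident C M) \<cdot> a))"
  define T where "T = (\<lambda>j. if j < ?n then Ss ! j else M)"
  note t [simp] = \<rho>'[unfolded mor_iff] a(1-3)
  \<comment> \<open>Two disjoint simple summands of \<open>X \<otimes> Ss ! i\<close>, labelled by a
    Boolean so that all of them together are indexed by the \<open>2 n\<close> pairs in
    \<open>?Q\<close>.\<close>
  define split2 where "split2 = (\<lambda>i Y u v. \<forall>b::bool. simple_obj C (Y b) \<and>
    u b \<in> mor C (Y b) (X \<otimes>\<^sub>o Ss ! i) \<and> v b \<in> mor C (X \<otimes>\<^sub>o Ss ! i) (Y b) \<and>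
    (\<forall>c. v b \<cdot> u c = (if b = c then ident C (Y b) else zero_arr C (Y c) (Y b))))"
  have "\<exists>Y u v. i < ?n \<longrightarrow> split2 i Y u v" for i
  proof (cases "i < ?n")
    case True
    obtain Y Z where YZ: "simple_obj C Y" "simple_obj C Z" "orthogonal_split Y Z (X \<otimes>\<^sub>o Ss ! i)"
      using not_simple_split[OF _ X_tensor_nonzero[OF s(2)[OF True] simple_objD(2)[OF s(1)[OF True]]] nXS[OF True]]
        s(2)[OF True] by auto
    obtain u v u' v' where uv: "u \<in> mor C Y (X \<otimes>\<^sub>o Ss ! i)" "v \<in> mor C (X \<otimes>\<^sub>o Ss ! i) Y"
      "u' \<in> mor C Z (X \<otimes>\<^sub>o Ss ! i)" "v' \<in> mor C (X \<otimes>\<^sub>o Ss ! i) Z" "v \<cdot> u = ident C Y" "v' \<cdot> u' = ident C Z"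
      "v \<cdot> u' = zero_arr C Z Y" "v' \<cdot> u = zero_arr C Y Z"
      using YZ(3) unfolding orthogonal_split_def by blast
    show ?thesis
      unfolding split2_def using YZ(1,2) uv
      by (intro exI[of _ "\<lambda>b. if b then Y else Z"] exI[of _ "\<lambda>b. if b then u else u'"]
          exI[of _ "\<lambda>b. if b then v else v'"]) auto
  qed auto
  then obtain Y u v where "\<And>i. i < ?n \<Longrightarrow> split2 i (Y i) (u i) (v i)" by metis
  then have Y: "\<And>i b. i < ?n \<Longrightarrow> simple_obj C (Y i b)"
    and u: "\<And>i b. i < ?n \<Longrightarrow> u i b \<in> mor C (Y i b) (X \<otimes>\<^sub>o Ss ! i)"
    and v: "\<And>i b. i < ?n \<Longrightarrow> v i b \<in> mor C (X \<otimes>\<^sub>o Ss ! i) (Y i b)"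
    and vu: "\<And>i b c. i < ?n \<Longrightarrow> v i b \<cdot> u i c = (if b = c then ident C (Y i b) else zero_arr C (Y i c) (Y i b))"
    unfolding split2_def by blast+
  let ?Q = "{..<?n} \<times> (UNIV :: bool set)"
  let ?g = "\<lambda>(i, b). (ident C X \<otimes>\<^sub>a \<iota> i) \<cdot> u i b"
  let ?r = "\<lambda>(i, b). v i b \<cdot> (ident C X \<otimes>\<^sub>a \<pi> i)"
  \<comment> \<open>Different \<open>i\<close> are separated by the biproduct
    \<open>X \<otimes> M\<close>, different Booleans by the splitting of
    \<open>X \<otimes> Ss ! i\<close>.\<close>
  have gr: "?r (i, b) \<cdot> ?g (j, c) = (if (i, b) = (j, c) then ident C (Y i b) else zero_arr C (Y j c) (Y i b))"
    if ij: "i < ?n" "j < ?n" for i j b c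
  proof -
    note tt = m(1)[OF ij(2), unfolded mor_iff] m(2)[OF ij(1), unfolded mor_iff]
      u[OF ij(2), of c, unfolded mor_iff] v[OF ij(1), of b, unfolded mor_iff]
    have "?r (i, b) \<cdot> ?g (j, c) = v i b \<cdot> ((ident C X \<otimes>\<^sub>a (\<pi> i \<cdot> \<iota> j)) \<cdot> u j c)"
      using tt comp_rewrite[of "ident C X \<otimes>\<^sub>a \<pi> i" "ident C X \<otimes>\<^sub>a \<iota> j" "ident C X \<otimes>\<^sub>a (\<pi> i \<cdot> \<iota> j)" "u j c"]
      by (simp add: comp_assoc_arr tensor_comp_arr)
    then show ?thesis
      using tt m(3)[OF ij(1)] m(4)[OF ij] vu[OF ij(1)] s(2)[OF ij(1)] s(2)[OF ij(2)]
        simple_objD(1)[OF Y[OF ij(2), of c]]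
      by (cases "i = j") (auto simp: tensor_ident)
  qed
  have "card ?Q \<le> card {..?n}"
  proof (rule simple_exchange[of "{..?n}" ?Q T p ?P "\<lambda>(i, b). Y i b" ?g ?r])
    show "simple_obj C (T j) \<and> p j \<in> mor C ?P (T j)" if "j \<in> {..?n}" for j
      using s M(1) m(2)[of j] by (auto simp: T_def p_def mor_iff)
    show "simple_obj C (case q of (i, b) \<Rightarrow> Y i b) \<and> ?g q \<in> mor C (case q of (i, b) \<Rightarrow> Y i b) ?P \<and>
        ?r q \<in> mor C ?P (case q of (i, b) \<Rightarrow> Y i b) \<and> ?r q \<cdot> ?g q = ident C (case q of (i, b) \<Rightarrow> Y i b)"
      if q: "q \<in> ?Q" for q
    proof -
      obtain i b where ib: "q = (i, b)" "i < ?n" using q by auto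
      then show ?thesis
        using Y[OF ib(2)] gr[OF ib(2) ib(2), of b b] m(1,2)[OF ib(2)] u[OF ib(2), of b] v[OF ib(2), of b]
        by (auto simp: mor_iff)
    qed
    show "?r q \<cdot> ?g q' = zero_arr C (case q' of (i, b) \<Rightarrow> Y i b) (case q of (i, b) \<Rightarrow> Y i b)"
      if "q \<in> ?Q" "q' \<in> ?Q" "q \<noteq> q'" for q q'
      using that gr by (cases q; cases q') auto
    fix A h assume h: "h \<in> mor C A ?P" "\<And>j. j \<in> {..?n} \<Longrightarrow> p j \<cdot> h = zero_arr C A (T j)"
    have A [simp]: "A \<in> obj C" using mor_obj[OF h(1)] by simp
    note [simp] = h(1)[unfolded mor_iff]
    have 0: "(\<rho> 0 \<otimes>\<^sub>a ident C M) \<cdot> (a \<cdot> h) = zero_arr C A (\<one>\<^sub>o \<otimes>\<^sub>o M)"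
    proof (rule iso_cancel_zero(1)[OF left_unitor_iso left_unitor_mor])
      show "left_unitor C M \<cdot> ((\<rho> 0 \<otimes>\<^sub>a ident C M) \<cdot> (a \<cdot> h)) = zero_arr C A M"
        using h(2)[of ?n] by (simp add: p_def T_def comp_assoc_arr)
    qed (auto simp: mor_iff)
    have 1: "(\<rho> (Suc 0) \<otimes>\<^sub>a ident C M) \<cdot> (a \<cdot> h) = zero_arr C A (X \<otimes>\<^sub>o M)"
    proof (rule jm)
      fix i assume i: "i < ?n"
      then show "\<pi> i \<cdot> ((\<rho> (Suc 0) \<otimes>\<^sub>a ident C M) \<cdot> (a \<cdot> h)) = zero_arr C A (Ss ! i)"
        using h(2)[of i] m(2)[OF i] by (simp add: p_def T_def comp_assoc_arr mor_iff)
    qed (simp add: mor_iff)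
    have "a \<cdot> h = zero_arr C A ((X \<otimes>\<^sub>o X) \<otimes>\<^sub>o M)"
    proof (rule jr)
      show "(\<rho> i \<otimes>\<^sub>a ident C M) \<cdot> (a \<cdot> h) = zero_arr C A ([\<one>\<^sub>o, X] ! i \<otimes>\<^sub>o M)" if "i < length [\<one>\<^sub>o, X]" for i
        using that 0 1 by (auto simp: less_Suc_eq)
    qed (simp add: mor_iff)
    then have "associator C X X M \<cdot> (a \<cdot> h) = zero_arr C A ?P" by simp
    then show "h = zero_arr C A ?P" using comp_rewrite[OF a(4), of h] by simp
  qed auto
  \<comment> \<open>The exchange yields \<open>2 n \<le> n + 1\<close>, since \<open>{..n}\<close>
    includes \<open>n\<close>; this contradicts \<open>2 \<le> n\<close>.\<close>
  then show False using n2 by (simp add: card_cartesian_product)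
qed

text \<open>A splitting \<open>\<rho>\<close> of coevaluation is shown to be its inverse: an arrow
  from a simple object into \<open>N \<otimes> N'\<close> that \<open>\<rho>\<close> kills must
  vanish, and only the unit and \<open>X\<close> have to be tested as sources. The other product is
  handled through simplicity.\<close>

lemma invertible_in_component:
  assumes g: "g \<in> carrier G"
  obtains N N' where "N \<in> D g" "N' \<in> D (inv\<^bsub>G\<^esub> g)"
    "iso_obj C (N \<otimes>\<^sub>o N') \<one>\<^sub>o" "iso_obj C (N' \<otimes>\<^sub>o N) \<one>\<^sub>o"
proof -
  obtain S where S: "S \<in> D g" "\<not> zero_obj C S"
    using component_nonzero[OF g] by blast
  obtain M where M: "simple_obj C M" "retract M S"
    using nonzero_simple_retract[OF component_obj[OF g S(1)] S(2)] .
  obtain N where N: "simple_obj C N" "N \<in> D g" "simple_obj C (X \<otimes>\<^sub>o N)"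
    using simple_X_product_exists[OF g M(1) component_retract[OF g S(1) M(2)]] by blast
  have o [simp]: "N \<in> obj C" using simple_objD[OF N(1)] by simp
  \<comment> \<open>Otherwise \<open>X \<otimes> (X \<otimes> N)\<close> would be simple, although
    it has the disjoint nonzero summands \<open>N\<close> and \<open>X \<otimes> N\<close>.\<close>
  have ni: "\<not> iso_obj C (X \<otimes>\<^sub>o N) N"
  proof
    assume i: "iso_obj C (X \<otimes>\<^sub>o N) N"
    have "simple_obj C (X \<otimes>\<^sub>o (X \<otimes>\<^sub>o N))"
      by (rule simple_iso[OF N(3) iso_obj_sym[OF tensor_iso(1)[OF i X_obj]]])
    from simple_not_split[OF this X_square_tensor_split[OF o]]
    show False
      using simple_objD(2) N simple_iso[OF N(1) iso_obj_sym[OF unit_iso(1)[OF o]]] by blast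
  qed
  obtain N' where ld: "left_dual C N N'" using left_duals_exist[OF o] by blast
  then obtain ev coev b where d: "dual_pair N N' ev coev b" by (rule left_dualE)
  note d' = d[unfolded dual_pair_def]
  have o' [simp]: "N' \<in> obj C" using d' by blast
  have m: "ev \<in> mor C (N' \<otimes>\<^sub>o N) \<one>\<^sub>o" "coev \<in> mor C \<one>\<^sub>o (N \<otimes>\<^sub>o N')" using d' by auto
  note [simp] = m[unfolded mor_iff]
  have N': "N' \<in> D (inv\<^bsub>G\<^esub> g)" by (rule component_dual[OF g N(2) ld])
  have NN': "N \<otimes>\<^sub>o N' \<in> D \<one>\<^bsub>G\<^esub>" using component_tensor[OF g _ N(2) N'] g by simp
  have coev0: "coev \<noteq> zero_arr C \<one>\<^sub>o (N \<otimes>\<^sub>o N')"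
  proof
    assume "coev = zero_arr C \<one>\<^sub>o (N \<otimes>\<^sub>o N')"
    then have "ident C N = zero_arr C N N"
      by (intro coev_detects[OF d ident_mor]) (simp_all add: tensor_ident)
    then show False using simple_objD(3)[OF N(1)] by simp
  qed
  then obtain \<rho> where \<rho>: "\<rho> \<in> mor C (N \<otimes>\<^sub>o N') \<one>\<^sub>o" "\<rho> \<cdot> coev = ident C \<one>\<^sub>o"
    using simple_section[OF unit_simple m(2)] by blast
  note [simp] = \<rho>(1)[unfolded mor_iff]
  \<comment> \<open>The adjunct of \<open>h\<close>, an arrow from \<open>T \<otimes> N\<close> to
    \<open>N \<otimes> 1\<close>. Up to unitors, the adjunct of \<open>coev\<close> is the identity
    of \<open>N\<close>.\<close>
  let ?flat = "\<lambda>h. (ident C N \<otimes>\<^sub>a ev) \<cdot> (associator C N N' N \<cdot> (h \<otimes>\<^sub>a ident C N))"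
  have flat: "?flat h \<in> mor C (T \<otimes>\<^sub>o N) (N \<otimes>\<^sub>o \<one>\<^sub>o)" if "h \<in> mor C T (N \<otimes>\<^sub>o N')" for h T
    using that by (auto simp: mor_iff)
  have unit_case: "h = zero_arr C \<one>\<^sub>o (N \<otimes>\<^sub>o N')"
    if h: "h \<in> mor C \<one>\<^sub>o (N \<otimes>\<^sub>o N')" "\<rho> \<cdot> h = zero_arr C \<one>\<^sub>o \<one>\<^sub>o" for h
  proof -
    note [simp] = h(1)[unfolded mor_iff]
    obtain l' where l': "l' \<in> mor C N (\<one>\<^sub>o \<otimes>\<^sub>o N)" "l' \<cdot> left_unitor C N = ident C (\<one>\<^sub>o \<otimes>\<^sub>o N)"
      using left_unitor_iso[OF o] left_unitor_mor[OF o] by (metis iso_arrE)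
    note [simp] = l'(1)[unfolded mor_iff]
    let ?r = "right_unitor C N" and ?l = "left_unitor C N"
    have "?r \<cdot> ?flat h \<cdot> l' \<in> mor C N N" by (simp add: mor_iff)
    \<comment> \<open>Between copies of the simple \<open>N\<close> the adjunct of \<open>h\<close>
      is a scalar \<open>c\<close>. Then \<open>h\<close> and \<open>c\<close> times
      \<open>coev\<close> have the same adjunct and are equal, and
      \<open>\<rho> \<cdot> h = 0\<close> forces \<open>c = 0\<close>.\<close>
    then obtain c where c: "?r \<cdot> ?flat h \<cdot> l' = c \<odot>\<^sub>a ident C N" using schur_scalar[OF N(1)] by blast
    have "?r \<cdot> ?flat h = (?r \<cdot> ?flat h \<cdot> l') \<cdot> ?l"
      using l'(2) comp_assoc_arr[of ?l l' "?r \<cdot> ?flat h"] by simp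
    also have "\<dots> = c \<odot>\<^sub>a ?l" unfolding c by simp
    finally have rh: "?r \<cdot> ?flat h = c \<odot>\<^sub>a ?l" .
    have rc: "?r \<cdot> ?flat coev = ?l" using d' by simp
    let ?h = "h \<ominus>\<^sub>a c \<odot>\<^sub>a coev"
    have sc: "(c \<odot>\<^sub>a coev) \<otimes>\<^sub>a ident C N = c \<odot>\<^sub>a (coev \<otimes>\<^sub>a ident C N)"
      by (rule tensor_scale_left[OF m(2) ident_mor[OF o]])
    have "?flat ?h = ?flat h \<ominus>\<^sub>a c \<odot>\<^sub>a ?flat coev"
      by (simp add: tensor_minus comp_minus_simps sc)
    then have "?r \<cdot> ?flat ?h = (?r \<cdot> ?flat h) \<ominus>\<^sub>a c \<odot>\<^sub>a (?r \<cdot> ?flat coev)"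
      by (simp add: comp_minus_simps)
    then have "?r \<cdot> ?flat ?h = zero_arr C (\<one>\<^sub>o \<otimes>\<^sub>o N) N" unfolding rh rc by simp
    then have "?flat ?h = zero_arr C (\<one>\<^sub>o \<otimes>\<^sub>o N) (N \<otimes>\<^sub>o \<one>\<^sub>o)"
      by (intro iso_cancel_zero(1)[OF right_unitor_iso right_unitor_mor] flat) (auto simp: mor_iff)
    then have "?h = zero_arr C \<one>\<^sub>o (N \<otimes>\<^sub>o N')"
      by (intro adjunct_detects[OF d]) (auto simp: mor_iff)
    then have hc: "h = c \<odot>\<^sub>a coev" using minus_eq_zero_iff[of h "c \<odot>\<^sub>a coev"] by simp
    then have "c \<odot>\<^sub>a ident C \<one>\<^sub>o = zero_arr C \<one>\<^sub>o \<one>\<^sub>o" using h(2) \<rho>(2) by simp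
    then have "c \<odot>\<^sub>a ident C \<one>\<^sub>o = 0 \<odot>\<^sub>a ident C \<one>\<^sub>o" by simp
    then have "c = 0" using unit_endomorphisms[of "c \<odot>\<^sub>a ident C \<one>\<^sub>o"] by (auto simp: mor_iff)
    then show ?thesis using hc by simp
  qed
  \<comment> \<open>A nonzero adjunct would be an isomorphism between the simple objects
    \<open>X \<otimes> N\<close> and \<open>N \<otimes> 1\<close>, which \<open>ni\<close>
    excludes.\<close>
  have X_case: "h = zero_arr C X (N \<otimes>\<^sub>o N')" if h: "h \<in> mor C X (N \<otimes>\<^sub>o N')" for h
  proof (rule adjunct_detects[OF d h o])
    show "?flat h = zero_arr C (X \<otimes>\<^sub>o N) (N \<otimes>\<^sub>o \<one>\<^sub>o)"
    proof (rule ccontr)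
      assume nz: "?flat h \<noteq> zero_arr C (X \<otimes>\<^sub>o N) (N \<otimes>\<^sub>o \<one>\<^sub>o)"
      have "simple_obj C (N \<otimes>\<^sub>o \<one>\<^sub>o)" by (rule simple_iso[OF N(1) iso_obj_sym[OF unit_iso(2)[OF o]]])
      then have "iso_obj C (X \<otimes>\<^sub>o N) (N \<otimes>\<^sub>o \<one>\<^sub>o)"
        using schur_iso[OF N(3) _ flat[OF h] nz] iso_objI_arr[OF flat[OF h]] by blast
      then show False using ni iso_obj_trans unit_iso(2)[OF o] by blast
    qed
  qed
  have detect: "h = zero_arr C T (N \<otimes>\<^sub>o N')"
    if T: "simple_obj C T" and h: "h \<in> mor C T (N \<otimes>\<^sub>o N')" "\<rho> \<cdot> h = zero_arr C T \<one>\<^sub>o" for T h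
  proof (rule ccontr)
    assume nz: "h \<noteq> zero_arr C T (N \<otimes>\<^sub>o N')"
    then have "retract T (N \<otimes>\<^sub>o N')" using simple_map_retract[OF T] h(1) by blast
    then have "T \<in> D \<one>\<^bsub>G\<^esub>" using component_retract[OF _ NN'] by simp
    then obtain Z where Z: "iso_obj C Z T" "Z = \<one>\<^sub>o \<or> Z = X" using simples[OF T] by blast
    obtain t where t: "t \<in> mor C Z T" "iso_arr C t" using Z(1) unfolding iso_obj_def by blast
    have ht: "h \<cdot> t \<in> mor C Z (N \<otimes>\<^sub>o N')" by (rule comp_mor[OF t(1) h(1)])
    have "h \<cdot> t = zero_arr C Z (N \<otimes>\<^sub>o N')"
    proof (cases "Z = X")
      case True
      then show ?thesis using X_case ht by simp
    next
      case False
      have "\<rho> \<cdot> (h \<cdot> t) = zero_arr C Z \<one>\<^sub>o"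
        using comp_rewrite[OF h(2), of t] t(1) h(1) by (auto simp: mor_iff)
      then show ?thesis using unit_case ht Z(2) False by simp
    qed
    then show False using iso_cancel_zero(2)[OF t(2,1) h(1)] nz by blast
  qed
  \<comment> \<open>\<open>\<rho>\<close> kills this difference because it splits
    \<open>coev\<close>, so \<open>detect\<close> applies to every arrow from a simple object
    followed by it.\<close>
  have "ident C (N \<otimes>\<^sub>o N') \<ominus>\<^sub>a coev \<cdot> \<rho> = zero_arr C (N \<otimes>\<^sub>o N') (N \<otimes>\<^sub>o N')" (is "?k = _")
  proof (rule simples_jointly_epic)
    show k: "?k \<in> mor C (N \<otimes>\<^sub>o N') (N \<otimes>\<^sub>o N')" by (simp add: mor_iff)
    fix A i assume A: "simple_obj C A" "i \<in> mor C A (N \<otimes>\<^sub>o N')"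
    have "\<rho> \<cdot> ?k = zero_arr C (N \<otimes>\<^sub>o N') \<one>\<^sub>o"
      using comp_rewrite[OF \<rho>(2), of \<rho>] by (simp add: comp_minus_simps)
    then have "\<rho> \<cdot> (?k \<cdot> i) = zero_arr C A \<one>\<^sub>o"
      using comp_rewrite[of \<rho> ?k _ i] A(2) k by (auto simp: mor_iff)
    then show "?k \<cdot> i = zero_arr C A (N \<otimes>\<^sub>o N')" by (rule detect[OF A(1) comp_mor[OF A(2) k]])
  qed
  then have "coev \<cdot> \<rho> = ident C (N \<otimes>\<^sub>o N')"
    using minus_eq_zero_iff[of "ident C (N \<otimes>\<^sub>o N')" "coev \<cdot> \<rho>"] by simp
  then have i1: "iso_obj C (N \<otimes>\<^sub>o N') \<one>\<^sub>o" using iso_objI[OF \<rho>(1) m(2)] \<rho>(2) by blast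
  have "\<not> zero_obj C N'"
    using tensor_zero_obj(1)[OF _ o] zero_obj_retract iso_obj_retract iso_obj_sym[OF i1]
      simple_objD(2)[OF unit_simple] by blast
  then have "ev \<noteq> zero_arr C (N' \<otimes>\<^sub>o N) \<one>\<^sub>o"
    using ev_detects[OF d ident_mor[OF o']] by (auto simp: zero_obj_iff tensor_ident)
  then have r1: "retract \<one>\<^sub>o (N' \<otimes>\<^sub>o N)" using simple_map_retract[OF unit_simple] m(1) by blast
  \<comment> \<open>A splitting of \<open>N' \<otimes> N\<close> would tensor to one of
    \<open>N \<otimes> (N' \<otimes> N)\<close>, which is isomorphic to the simple \<open>N\<close>.
    Both parts stay nonzero because \<open>A\<close> is a retract of
    \<open>N' \<otimes> (N \<otimes> A)\<close>.\<close>
  have "simple_obj C (N' \<otimes>\<^sub>o N)"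
  proof (rule ccontr)
    assume "\<not> simple_obj C (N' \<otimes>\<^sub>o N)"
    moreover have "\<not> zero_obj C (N' \<otimes>\<^sub>o N)" using r1 zero_obj_retract simple_objD(2)[OF unit_simple] by blast
    ultimately obtain A B where AB: "simple_obj C A" "simple_obj C B" "orthogonal_split A B (N' \<otimes>\<^sub>o N)"
      using not_simple_split[of "N' \<otimes>\<^sub>o N"] by auto
    have "iso_obj C (N \<otimes>\<^sub>o (N' \<otimes>\<^sub>o N)) N"
      using iso_obj_trans[OF iso_obj_sym[OF assoc_iso[OF o o' o]]
        iso_obj_trans[OF tensor_iso(2)[OF i1 o] unit_iso(1)[OF o]]] .
    then have "simple_obj C (N \<otimes>\<^sub>o (N' \<otimes>\<^sub>o N))" using simple_iso[OF N(1)] iso_obj_sym by blast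
    moreover have "\<not> zero_obj C (N \<otimes>\<^sub>o A)" if A: "simple_obj C A" for A
    proof
      assume "zero_obj C (N \<otimes>\<^sub>o A)"
      then have z: "zero_obj C (N' \<otimes>\<^sub>o (N \<otimes>\<^sub>o A))" by (rule tensor_zero_obj(1)[OF _ o'])
      have Ao: "A \<in> obj C" using simple_objD[OF A] by simp
      have "retract A (\<one>\<^sub>o \<otimes>\<^sub>o A)" using iso_obj_retract iso_obj_sym unit_iso(1)[OF Ao] by blast
      moreover have "retract (\<one>\<^sub>o \<otimes>\<^sub>o A) ((N' \<otimes>\<^sub>o N) \<otimes>\<^sub>o A)" by (rule tensor_retract(2)[OF r1 Ao])
      moreover have "retract ((N' \<otimes>\<^sub>o N) \<otimes>\<^sub>o A) (N' \<otimes>\<^sub>o (N \<otimes>\<^sub>o A))"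
        using iso_obj_retract assoc_iso[OF o' o Ao] by blast
      ultimately have "zero_obj C A" using z zero_obj_retract by blast
      then show False using simple_objD(2)[OF A] by blast
    qed
    ultimately show False
      using simple_not_split[OF _ tensor_orthogonal_split(1)[OF AB(3) o]] AB(1,2) by blast
  qed
  then have "iso_obj C (N' \<otimes>\<^sub>o N) \<one>\<^sub>o"
    using retract_simple_iso[OF r1] simple_objD(2)[OF unit_simple] iso_obj_sym by blast
  then show thesis using that N(2) N' i1 by blast
qed

lemma component_exact_factorization: "exact_factorization C (D \<one>\<^bsub>G\<^esub>) (pointed_part C)"
  unfolding exact_factorization_def
proof (intro conjI component_one_fusion_subcat pointed_part_fusion_subcat)
  show "product_subcat C (D \<one>\<^bsub>G\<^esub>) (pointed_part C) = obj C"
  proof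
    show "product_subcat C (D \<one>\<^bsub>G\<^esub>) (pointed_part C) \<subseteq> obj C"
      by (auto simp: product_subcat_def direct_sum_def)
    show "obj C \<subseteq> product_subcat C (D \<one>\<^bsub>G\<^esub>) (pointed_part C)"
    proof
      fix S assume "S \<in> obj C"
      then obtain gs Y where Y: "set gs = carrier G" "\<And>g. g \<in> carrier G \<Longrightarrow> Y g \<in> D g"
        "direct_sum C (map Y gs) S" by (rule homogeneous_decomposition) blast
      have "\<exists>A \<in> D \<one>\<^bsub>G\<^esub>. \<exists>B \<in> pointed_part C. direct_summand C (Y g) (A \<otimes>\<^sub>o B)" if g: "g \<in> carrier G" for g
      proof -
        obtain N N' where N: "N \<in> D g" "N' \<in> D (inv\<^bsub>G\<^esub> g)"
          "iso_obj C (N \<otimes>\<^sub>o N') \<one>\<^sub>o" "iso_obj C (N' \<otimes>\<^sub>o N) \<one>\<^sub>o" by (rule invertible_in_component[OF g])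
        have o: "N \<in> obj C" "N' \<in> obj C" "Y g \<in> obj C"
          using component_obj[OF g] component_obj[of "inv\<^bsub>G\<^esub> g"] N Y(2)[OF g] g by auto
        have "N \<in> pointed_part C"
          using invertible_in_pointed_part o N(3,4) unfolding invertible_obj_def by blast
        moreover have "Y g \<otimes>\<^sub>o N' \<in> D \<one>\<^bsub>G\<^esub>"
          using component_tensor[OF g _ Y(2)[OF g] N(2)] g by simp
        moreover have "direct_summand C (Y g) ((Y g \<otimes>\<^sub>o N') \<otimes>\<^sub>o N)"
          using retract_direct_summand[OF iso_obj_retract[OF inverse_cancel[OF o(3,2,1) N(4)]]] .
        ultimately show ?thesis by blast
      qed
      then have "\<forall>Z \<in> set (map Y gs). \<exists>A \<in> D \<one>\<^bsub>G\<^esub>. \<exists>B \<in> pointed_part C. direct_summand C Z (A \<otimes>\<^sub>o B)"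
        using Y(1) by simp
      then show "S \<in> product_subcat C (D \<one>\<^bsub>G\<^esub>) (pointed_part C)"
        unfolding product_subcat_def using Y(3) by blast
    qed
  qed
  show "D \<one>\<^bsub>G\<^esub> \<inter> pointed_part C = vec_subcat C"
  proof
    show "vec_subcat C \<subseteq> D \<one>\<^bsub>G\<^esub> \<inter> pointed_part C"
    proof
      fix S assume "S \<in> vec_subcat C"
      then obtain n where n: "direct_sum C (replicate n \<one>\<^sub>o) S" by (auto simp: vec_subcat_def)
      \<comment> \<open>Sums of copies of the unit lie in every fusion subcategory, in particular in
        both factors.\<close>
      have "S \<in> A" if "fusion_subcat C A" for A
      proof -
        have A: "full_abelian_subcat C A" "\<one>\<^sub>o \<in> A" using that unfolding fusion_subcat_def by blast+
        then show ?thesis by (intro full_abelian_subcatD(3)[OF A(1) _ n]) auto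
      qed
      then show "S \<in> D \<one>\<^bsub>G\<^esub> \<inter> pointed_part C"
        using component_one_fusion_subcat pointed_part_fusion_subcat by blast
    qed
    show "D \<one>\<^bsub>G\<^esub> \<inter> pointed_part C \<subseteq> vec_subcat C"
    proof
      fix S assume S: "S \<in> D \<one>\<^bsub>G\<^esub> \<inter> pointed_part C"
      then have Si: "S \<in> D \<one>\<^bsub>G\<^esub>" "S \<in> invertibly_generated" using pointed_part_subset by blast+
      then have "S \<in> obj C" by (auto simp: invertibly_generated_def)
      then obtain Ss where Ss: "\<forall>T \<in> set Ss. simple_obj C T" "direct_sum C Ss S" using semisimple by blast
      have "iso_obj C T \<one>\<^sub>o" if T: "T \<in> set Ss" for T
      proof -
        have s: "simple_obj C T" and r: "retract T S" using Ss(1) T direct_sum_retract[OF Ss(2) T] by auto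
        have "T \<in> D \<one>\<^bsub>G\<^esub>" using component_retract[OF _ Si(1) r] by simp
        moreover have "invertible_obj C T" using Si(2) s r unfolding invertibly_generated_def by blast
        then have "\<not> iso_obj C X T" using X_not_invertible invertible_iso iso_obj_sym by blast
        ultimately show ?thesis using simples[OF s] iso_obj_sym by blast
      qed
      then have "direct_sum C (replicate (length Ss) \<one>\<^sub>o) S"
        by (intro direct_sum_component_iso[OF Ss(2)]) auto
      then show "S \<in> vec_subcat C" unfolding vec_subcat_def by blast
    qed
  qed
qed

end

section \<open>Transport along the equivalence with the Fibonacci category\<close>

lemma mor_full_subcat:
  "mor (full_subcat C A) X Y = (if X \<in> A \<and> Y \<in> A then mor C X Y else {})"
  by (auto simp: mor_def full_subcat_def)

lemma full_subcat_simps: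
  "comp_arr (full_subcat C A) = comp_arr C" "ident (full_subcat C A) = ident C"
  "add_arr (full_subcat C A) = add_arr C" "zero_arr (full_subcat C A) = zero_arr C"
  "tensor_obj (full_subcat C A) = tensor_obj C" "unit_obj (full_subcat C A) = unit_obj C"
  "obj (full_subcat C A) = obj C \<inter> A" "dom_of (full_subcat C A) = dom_of C"
  "cod_of (full_subcat C A) = cod_of C" "scale_arr (full_subcat C A) = scale_arr C"
  by (simp_all add: full_subcat_def)

lemma iso_arr_full_subcat: "iso_arr (full_subcat C A) f \<Longrightarrow> iso_arr C f"
  unfolding iso_arr_def inverse_arrs_def
  by (auto simp: full_subcat_simps mor_full_subcat split: if_splits) (auto simp: full_subcat_def)

lemma iso_obj_full_subcat: "iso_obj (full_subcat C A) X Y \<Longrightarrow> iso_obj C X Y"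
  unfolding iso_obj_def
  using iso_arr_full_subcat by (fastforce simp: full_subcat_simps mor_full_subcat split: if_splits)

text \<open>The generator is the image of the nontrivial simple object. Simplicity is never
  transported along the functor: it preserves retracts and preserves and reflects zero objects, and
  this suffices to classify the simple objects of the trivial component.\<close>

lemma fibonacci_extension_graded:
  fixes F :: "('p, 'n, 'k::{alg_closed_field, field_char_0}) moncat"
    and C :: "('o, 'm, 'k) moncat"
  assumes "fibonacci_category F" "graded_extension F C G D"
  obtains X where "fibonacci_graded C G D X"
proof -
  let ?B = "full_subcat C (D \<one>\<^bsub>G\<^esub>)"
  interpret C: fusion_category C using assms(2) by (simp add: graded_extension_def)
  interpret F: fusion_category F using assms(1) by (simp add: fibonacci_category_def)
  have grp: "Group.group G" and gr: "faithful_grading C G D" and te: "tensor_equivalent F ?B"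
    using assms(2) by (auto simp: graded_extension_def)
  interpret G: Group.group G by (rule grp)
  have fa: "full_abelian_subcat C (D \<one>\<^bsub>G\<^esub>)"
    using gr[unfolded faithful_grading_def, THEN conjunct1] G.one_closed by blast
  then have D1: "D \<one>\<^bsub>G\<^esub> \<subseteq> obj C" by (simp add: full_abelian_subcat_def)
  obtain \<Phi>\<^sub>o \<Phi>\<^sub>a J u where func: "linear_monoidal_functor F ?B \<Phi>\<^sub>o \<Phi>\<^sub>a J u"
    and ff: "\<And>X Y. X \<in> obj F \<Longrightarrow> Y \<in> obj F \<Longrightarrow> bij_betw \<Phi>\<^sub>a (mor F X Y) (mor ?B (\<Phi>\<^sub>o X) (\<Phi>\<^sub>o Y))"
    and es: "\<And>Y. Y \<in> obj ?B \<Longrightarrow> \<exists>X \<in> obj F. iso_obj ?B (\<Phi>\<^sub>o X) Y"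
    using te unfolding tensor_equivalent_def by blast
  interpret \<Phi>: linear_monoidal_functor F ?B \<Phi>\<^sub>o \<Phi>\<^sub>a J u by (rule func)
  have ob: "\<Phi>\<^sub>o A \<in> D \<one>\<^bsub>G\<^esub>" "\<Phi>\<^sub>o A \<in> obj C" if "A \<in> obj F" for A
    using \<Phi>.map_obj[OF that] by (auto simp: full_subcat_simps)
  have mo: "\<Phi>\<^sub>a f \<in> mor C (\<Phi>\<^sub>o A) (\<Phi>\<^sub>o B)" if "f \<in> mor F A B" for f A B
    using \<Phi>.map_mor[OF that] by (auto simp: mor_full_subcat split: if_splits)
  have id: "\<Phi>\<^sub>a (ident F A) = ident C (\<Phi>\<^sub>o A)" if "A \<in> obj F" for A
    using \<Phi>.map_ident[OF that] by (simp add: full_subcat_simps)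
  have co: "\<Phi>\<^sub>a (g \<cdot>\<^bsub>F\<^esub> f) = \<Phi>\<^sub>a g \<cdot>\<^bsub>C\<^esub> \<Phi>\<^sub>a f" if "f \<in> mor F A B" "g \<in> mor F B E" for f g A B E
    using \<Phi>.map_comp[OF that] by (simp add: full_subcat_simps)
  have ad: "\<Phi>\<^sub>a (f \<oplus>\<^sub>a\<^bsub>F\<^esub> g) = \<Phi>\<^sub>a f \<oplus>\<^sub>a\<^bsub>C\<^esub> \<Phi>\<^sub>a g" if "f \<in> mor F A B" "g \<in> mor F A B" for f g A B
    using \<Phi>.map_add[OF that] by (simp add: full_subcat_simps)
  \<comment> \<open>Preservation of zero arrows follows from linearity, a zero arrow being 0 times
    itself.\<close>
  have ze: "\<Phi>\<^sub>a (zero_arr F A B) = zero_arr C (\<Phi>\<^sub>o A) (\<Phi>\<^sub>o B)" if "A \<in> obj F" "B \<in> obj F" for A B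
  proof -
    note z = F.zero_arr_mor[OF that]
    have "\<Phi>\<^sub>a (0 \<odot>\<^sub>a\<^bsub>F\<^esub> zero_arr F A B) = 0 \<odot>\<^sub>a\<^bsub>C\<^esub> \<Phi>\<^sub>a (zero_arr F A B)"
      using \<Phi>.map_scale[OF z, of 0] by (simp add: full_subcat_simps)
    then show ?thesis using C.zero_scale_mor[OF ob(2) ob(2) mo[OF z]] that F.scale_zero_arr[OF that] by simp
  qed
  have un: "unit_obj C \<in> D \<one>\<^bsub>G\<^esub>" using \<Phi>.C.unit_in_obj by (simp add: full_subcat_simps)
  have re: "C.retract (\<Phi>\<^sub>o A) (\<Phi>\<^sub>o B)" if "F.retract A B" for A B
  proof -
    obtain i p where m: "i \<in> mor F A B" "p \<in> mor F B A" "p \<cdot>\<^bsub>F\<^esub> i = ident F A"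
      using \<open>F.retract A B\<close> unfolding F.retract_def by blast
    then have "\<Phi>\<^sub>a p \<cdot>\<^bsub>C\<^esub> \<Phi>\<^sub>a i = ident C (\<Phi>\<^sub>o A)"
      using co[OF m(1,2)] id F.mor_obj[OF m(1)] by simp
    then show ?thesis unfolding C.retract_def using mo m by blast
  qed
  \<comment> \<open>Faithfulness gives the reflecting direction: it distinguishes an identity from a
    zero arrow.\<close>
  have zo: "zero_obj C (\<Phi>\<^sub>o A) \<longleftrightarrow> zero_obj F A" if A: "A \<in> obj F" for A
  proof -
    have "ident F A = zero_arr F A A" if "\<Phi>\<^sub>a (ident F A) = \<Phi>\<^sub>a (zero_arr F A A)"
      using ff[OF A A] that F.ident_mor[OF A] F.zero_arr_mor[OF A A]
      unfolding bij_betw_def inj_on_def by blast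
    then show ?thesis using A ob(2)[OF A] id[OF A] ze[OF A A]
      by (auto simp: F.zero_obj_iff C.zero_obj_iff)
  qed
  obtain X0 where X0: "simple_obj F X0"
    "\<forall>S. simple_obj F S \<longrightarrow> iso_obj F S (unit_obj F) \<or> iso_obj F S X0"
    "direct_sum F [unit_obj F, X0] (X0 \<otimes>\<^sub>o\<^bsub>F\<^esub> X0)"
    using assms(1) unfolding fibonacci_category_def by blast
  have X0o: "X0 \<in> obj F" using F.simple_objD[OF X0(1)] by simp
  let ?X = "\<Phi>\<^sub>o X0"
  have ui: "iso_obj C (unit_obj C) (\<Phi>\<^sub>o (unit_obj F))"
    using \<Phi>.u_mor iso_arr_full_subcat[OF \<Phi>.u_iso] C.iso_objI_arr[of u]
    by (auto simp: full_subcat_simps mor_full_subcat split: if_splits)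
  have "direct_sum C [\<Phi>\<^sub>o (unit_obj F), ?X] (\<Phi>\<^sub>o (X0 \<otimes>\<^sub>o\<^bsub>F\<^esub> X0))"
  proof -
    let ?U = "unit_obj F" and ?S = "X0 \<otimes>\<^sub>o\<^bsub>F\<^esub> X0"
    obtain i p j q where m: "i \<in> mor F ?U ?S" "p \<in> mor F ?S ?U" "j \<in> mor F X0 ?S" "q \<in> mor F ?S X0"
      and r: "p \<cdot>\<^bsub>F\<^esub> i = ident F ?U" "q \<cdot>\<^bsub>F\<^esub> j = ident F X0" "p \<cdot>\<^bsub>F\<^esub> j = zero_arr F X0 ?U"
        "q \<cdot>\<^bsub>F\<^esub> i = zero_arr F ?U X0" and s: "i \<cdot>\<^bsub>F\<^esub> p \<oplus>\<^sub>a\<^bsub>F\<^esub> j \<cdot>\<^bsub>F\<^esub> q = ident F ?S"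
      using X0(3) unfolding F.direct_sum_pair_iff by blast
    have o: "?U \<in> obj F" "?S \<in> obj F" using X0o by auto
    have "\<Phi>\<^sub>a p \<cdot>\<^bsub>C\<^esub> \<Phi>\<^sub>a i = ident C (\<Phi>\<^sub>o ?U)" "\<Phi>\<^sub>a q \<cdot>\<^bsub>C\<^esub> \<Phi>\<^sub>a j = ident C ?X"
      "\<Phi>\<^sub>a p \<cdot>\<^bsub>C\<^esub> \<Phi>\<^sub>a j = zero_arr C ?X (\<Phi>\<^sub>o ?U)" "\<Phi>\<^sub>a q \<cdot>\<^bsub>C\<^esub> \<Phi>\<^sub>a i = zero_arr C (\<Phi>\<^sub>o ?U) ?X"
      using co[OF m(1,2)] co[OF m(3,4)] co[OF m(3,2)] co[OF m(1,4)] r id ze o X0o by auto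
    moreover have "\<Phi>\<^sub>a i \<cdot>\<^bsub>C\<^esub> \<Phi>\<^sub>a p \<oplus>\<^sub>a\<^bsub>C\<^esub> \<Phi>\<^sub>a j \<cdot>\<^bsub>C\<^esub> \<Phi>\<^sub>a q = ident C (\<Phi>\<^sub>o ?S)"
      using ad[OF F.comp_mor[OF m(2,1)] F.comp_mor[OF m(4,3)]] co[OF m(2,1)] co[OF m(4,3)] s id o by simp
    ultimately show ?thesis unfolding C.direct_sum_pair_iff using mo m by blast
  qed
  \<comment> \<open>The tensor constraint identifies the image of the square with the square of the
    image; the unit constraint then replaces the image of the unit by the unit.\<close>
  moreover have "iso_obj C (\<Phi>\<^sub>o (X0 \<otimes>\<^sub>o\<^bsub>F\<^esub> X0)) (?X \<otimes>\<^sub>o\<^bsub>C\<^esub> ?X)"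
    using \<Phi>.J_mor[OF X0o X0o] iso_arr_full_subcat[OF \<Phi>.J_iso[OF X0o X0o]]
      C.iso_obj_sym[OF C.iso_objI_arr[of "J X0 X0"]]
    by (auto simp: full_subcat_simps mor_full_subcat split: if_splits)
  ultimately have "direct_sum C [\<Phi>\<^sub>o (unit_obj F), ?X] (?X \<otimes>\<^sub>o\<^bsub>C\<^esub> ?X)"
    by (rule C.direct_sum_pair_target_iso)
  then have sq: "direct_sum C [unit_obj C, ?X] (?X \<otimes>\<^sub>o\<^bsub>C\<^esub> ?X)"
    by (rule C.direct_sum_component_iso) (use C.iso_obj_sym[OF ui] ob(2)[OF X0o] in \<open>auto simp: less_Suc_eq\<close>)
  have si: "iso_obj C (unit_obj C) T \<or> iso_obj C ?X T" if T: "simple_obj C T" "T \<in> D \<one>\<^bsub>G\<^esub>" for T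
  proof -
    have "T \<in> obj ?B" using T D1 by (auto simp: full_subcat_simps)
    then obtain A where A: "A \<in> obj F" "iso_obj C (\<Phi>\<^sub>o A) T"
      using es iso_obj_full_subcat[of C "D \<one>\<^bsub>G\<^esub>"] by metis
    have "\<not> zero_obj F A"
      using zo[OF A(1)] C.zero_obj_retract[OF C.iso_obj_retract[OF C.iso_obj_sym[OF A(2)]]] C.simple_objD(2)[OF T(1)]
      by blast
    then obtain S where S: "simple_obj F S" "F.retract S A" by (rule F.nonzero_simple_retract[OF A(1)])
    \<comment> \<open>By essential surjectivity \<open>T\<close> is the image of some
      \<open>A\<close>. An object \<open>Z\<close> isomorphic to a simple retract of
      \<open>A\<close> has a nonzero image that is a retract of the simple \<open>T\<close>, hence
      isomorphic to it; \<open>Z\<close> will be the unit or \<open>X0\<close>.\<close>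
    have key: "iso_obj C (\<Phi>\<^sub>o Z) T" if Z: "iso_obj F S Z" for Z
    proof -
      have "F.retract Z A" using F.retract_trans F.iso_obj_retract[OF F.iso_obj_sym[OF Z]] S(2) by blast
      then have "C.retract (\<Phi>\<^sub>o Z) T" using re C.retract_trans C.iso_obj_retract[OF A(2)] by blast
      moreover have "\<not> zero_obj C (\<Phi>\<^sub>o Z)"
        using zo F.simple_objD[OF F.simple_iso[OF S(1) Z]] by blast
      ultimately show ?thesis using C.retract_simple_iso T(1) by blast
    qed
    show ?thesis using X0(2) S(1) key C.iso_obj_trans[OF ui] by blast
  qed
  have "fibonacci_graded C G D ?X"
    unfolding fibonacci_graded_def fibonacci_graded_axioms_def
    using C.fusion_category_axioms grp gr un ob(1)[OF X0o] sq si by blast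
  then show thesis by (rule that)
qed

theorem theorem4p6:
  fixes F :: "('p, 'n, 'k::{alg_closed_field, field_char_0}) moncat"
    and C :: "('o, 'm, 'k) moncat"
    and G :: "('g, 'x) monoid_scheme"
    and D :: "'g \<Rightarrow> 'o set"
  assumes "fibonacci_category F"
    and "graded_extension F C G D"
  shows "exact_factorization C (D \<one>\<^bsub>G\<^esub>) (pointed_part C)"
proof -
  obtain X where "fibonacci_graded C G D X" using assms by (rule fibonacci_extension_graded)
  then show ?thesis by (rule fibonacci_graded.component_exact_factorization)
qed

end
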